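(* Let $n\ge2$, let $\Omega\subset\mathbb{R}^n$ be a bounded domain, let $q\in(1,2)$, $p=q/(q-1)$ and $\alpha\in(0,1)$. Let $u\in W^{1,q}_{loc}(\Omega)$ be a local weak solution in $\Omega$ of $$-\mathrm{div}\left((|\nabla u|-1)_+^{q-1}\frac{\nabla u}{|\nabla u|}\right)=f.$$ Then: $$f\in W^{1,p}_{loc}(\Omega)\ \Rightarrow\ \nabla u\in L^r_{loc}(\Omega)\ \text{ for all } r\in\left[1,\frac{nq(3-q)}{n(3-q)-2}\right);$$ and if $f\in B^\alpha_{p,\infty,loc}(\Omega)$, then - if $0<\alpha<\frac{q-1}{3-q}$, $\nabla u\in L^s_{loc}(\Omega)$ for all $s\in\left[1,\frac{nq}{n-\alpha-1}\right)$; - if $\frac{q-1}{3-q}\le\alpha<1$, $\nabla u\in L^s_{loc}(\Omega)$ for all $s\in\left[1,\frac{nq(3-q)}{n(3-q)-2}\right)$.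
   Context: $(\cdot)_+$ is the positive part. The vector field $(|\xi|-1)_+^{q-1}\xi/|\xi|$ is understood to be $0$ when $|\xi|\le1$ (in particular at $\xi=0$). Local weak solution: $u\in W^{1,q}_{loc}(\Omega)$ satisfies $\int_\Omega\langle(|\nabla u|-1)_+^{q-1}\frac{\nabla u}{|\nabla u|},\nabla\varphi\rangle\,dx=\int_\Omega f\varphi\,dx$ for every $\varphi\in W^{1,q}(\Omega)$ with compact support in $\Omega$. Besov spaces: for $0<\beta<1$, $1\le m<\infty$, $v\in B^\beta_{m,\infty}(\mathbb{R}^n)$ means $v\in L^m(\mathbb{R}^n)$ and $\sup_{h\in\mathbb{R}^n\setminus\{0\}}\left(\int_{\mathbb{R}^n}\frac{|v(x+h)-v(x)|^m}{|h|^{\beta m}}dx\right)^{1/m}<\infty$. $v\in B^\beta_{m,\infty,loc}(\Omega)$ means $\varphi v\in B^\beta_{m,\infty}(\mathbb{R}^n)$ for every $\varphi\in C_c^\infty(\Omega)$. *)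

theory Defs
  imports "HOL-Analysis.Analysis"
begin

text \<open>
  Functions on \<open>\<Omega>\<close> are total functions whose values outside \<open>\<Omega>\<close> are irrelevant; elements of
  Lebesgue and Sobolev spaces are functions rather than classes modulo null sets.
\<close>

definition Lp :: "real \<Rightarrow> 'a::euclidean_space set \<Rightarrow> ('a \<Rightarrow> 'b::euclidean_space) set" where
  "Lp p S = {f. f \<in> borel_measurable (lebesgue_on S) \<and>
                integrable (lebesgue_on S) (\<lambda>x. norm (f x) powr p)}"

definition Lp_loc :: "real \<Rightarrow> 'a::euclidean_space set \<Rightarrow> ('a \<Rightarrow> 'b::euclidean_space) set" where
  "Lp_loc p \<Omega> = {f. \<forall>K. compact K \<and> K \<subseteq> \<Omega> \<longrightarrow> f \<in> Lp p K}"

primrec cont_diff :: "nat \<Rightarrow> ('a::euclidean_space \<Rightarrow> real) \<Rightarrow> bool" where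
  "cont_diff 0 f \<longleftrightarrow> continuous_on UNIV f"
| "cont_diff (Suc k) f \<longleftrightarrow> (\<forall>x. f differentiable (at x)) \<and>
     (\<forall>b\<in>Basis. cont_diff k (\<lambda>x. frechet_derivative f (at x) b))"

definition test_fun :: "'a::euclidean_space set \<Rightarrow> ('a \<Rightarrow> real) set" where
  "test_fun \<Omega> = {\<phi>. (\<forall>k. cont_diff k \<phi>) \<and>
     compact (closure {x. \<phi> x \<noteq> 0}) \<and> closure {x. \<phi> x \<noteq> 0} \<subseteq> \<Omega>}"

definition has_weak_gradient ::
    "'a::euclidean_space set \<Rightarrow> ('a \<Rightarrow> real) \<Rightarrow> ('a \<Rightarrow> 'a) \<Rightarrow> bool" where
  "has_weak_gradient \<Omega> u G \<longleftrightarrow> u \<in> Lp_loc 1 \<Omega> \<and> G \<in> Lp_loc 1 \<Omega> \<and>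
     (\<forall>\<phi>\<in>test_fun \<Omega>. \<forall>b\<in>Basis.
        (LINT x|lebesgue_on \<Omega>. u x * frechet_derivative \<phi> (at x) b) =
        - (LINT x|lebesgue_on \<Omega>. (G x \<bullet> b) * \<phi> x))"

text \<open>A chosen representative; weak gradients on open sets are unique up to null sets.\<close>

definition weak_gradient :: "'a::euclidean_space set \<Rightarrow> ('a \<Rightarrow> real) \<Rightarrow> 'a \<Rightarrow> 'a" where
  "weak_gradient \<Omega> u = (SOME G. has_weak_gradient \<Omega> u G)"

definition W1 :: "real \<Rightarrow> 'a::euclidean_space set \<Rightarrow> ('a \<Rightarrow> real) set" where
  "W1 q \<Omega> = {u. u \<in> Lp q \<Omega> \<and> (\<exists>G. has_weak_gradient \<Omega> u G \<and> G \<in> Lp q \<Omega>)}"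

definition W1_loc :: "real \<Rightarrow> 'a::euclidean_space set \<Rightarrow> ('a \<Rightarrow> real) set" where
  "W1_loc q \<Omega> = {u. u \<in> Lp_loc q \<Omega> \<and> (\<exists>G. has_weak_gradient \<Omega> u G \<and> G \<in> Lp_loc q \<Omega>)}"

text \<open>Since elements are only determined up to null sets, support means essential support.\<close>

definition W1_compact :: "real \<Rightarrow> 'a::euclidean_space set \<Rightarrow> ('a \<Rightarrow> real) set" where
  "W1_compact q \<Omega> = {\<phi> \<in> W1 q \<Omega>.
     \<exists>K. compact K \<and> K \<subseteq> \<Omega> \<and> (AE x in lebesgue_on \<Omega>. x \<notin> K \<longrightarrow> \<phi> x = 0)}"

text \<open>For \<open>q > 1\<close> this vanishes when \<open>norm \<xi> \<le> 1\<close>, because \<open>0 powr a = 0\<close>.\<close>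

definition flux :: "real \<Rightarrow> 'a::euclidean_space \<Rightarrow> 'a" where
  "flux q \<xi> = (max (norm \<xi> - 1) 0 powr (q - 1)) *\<^sub>R ((1 / norm \<xi>) *\<^sub>R \<xi>)"

text \<open>
  Integrability of \<open>f \<phi>\<close> is required because the Bochner integral of a non-integrable function
  is \<open>0\<close>; it is automatic for \<open>f\<close> in \<open>Lp_loc (q / (q - 1)) \<Omega>\<close>, by Hoelder. The other
  integrand is always integrable: the flux of the weak gradient is in \<open>Lp_loc (q / (q - 1)) \<Omega>\<close>.
\<close>

definition local_weak_solution ::
    "real \<Rightarrow> 'a::euclidean_space set \<Rightarrow> ('a \<Rightarrow> real) \<Rightarrow> ('a \<Rightarrow> real) \<Rightarrow> bool" where
  "local_weak_solution q \<Omega> f u \<longleftrightarrow> u \<in> W1_loc q \<Omega> \<and>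
     (\<forall>\<phi>\<in>W1_compact q \<Omega>.
        integrable (lebesgue_on \<Omega>) (\<lambda>x. f x * \<phi> x) \<and>
        (LINT x|lebesgue_on \<Omega>. flux q (weak_gradient \<Omega> u x) \<bullet> weak_gradient \<Omega> \<phi> x) =
        (LINT x|lebesgue_on \<Omega>. f x * \<phi> x))"

text \<open>
  The Besov space with third index infinity. The integrals below are finite because
  \<open>v \<in> Lp m UNIV\<close>.
\<close>

definition besov_inf :: "real \<Rightarrow> real \<Rightarrow> ('a::euclidean_space \<Rightarrow> real) set" where
  "besov_inf \<beta> m = {v. v \<in> Lp m UNIV \<and>
     bdd_above ((\<lambda>h. (LINT x|lebesgue.
        \<bar>v (x + h) - v x\<bar> powr m / norm h powr (\<beta> * m)) powr (1 / m)) ` (UNIV - {0}))}"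

definition besov_inf_loc ::
    "real \<Rightarrow> real \<Rightarrow> 'a::euclidean_space set \<Rightarrow> ('a \<Rightarrow> real) set" where
  "besov_inf_loc \<beta> m \<Omega> = {v. \<forall>\<phi>\<in>test_fun \<Omega>. (\<lambda>x. \<phi> x * v x) \<in> besov_inf \<beta> m}"

end

theory Submission
  imports Defs
begin

text \<open>
  Write \<open>A = flux q (\<nabla>u)\<close> and \<open>p = q / (q - 1)\<close>, so that \<open>p > 2\<close>. The equation is degenerate: it
  says nothing about the gradient where \<open>|\<nabla>u| \<le> 1\<close>, and only \<open>A\<close> can be expected to have some
  regularity. Higher integrability of \<open>\<nabla>u\<close> is a property of \<open>A\<close>, though, since
  \<open>|\<nabla>u| \<le> 1 + |A| powr (1 / (q - 1))\<close>.

  The argument has two halves. In the first, the monotonicity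
  \<open>(flux q \<xi> - flux q \<zeta>) \<bullet> (\<xi> - \<zeta>) \<ge> c * |flux q \<xi> - flux q \<zeta>|\<^sup>p\<close> (\<open>flux_monotone\<close>) is
  combined with Nirenberg's method of difference quotients. Testing the equation with a backward
  difference of a localised forward difference of \<open>u\<close> gives
  \<open>\<integral>\<^sub>K |A(x + h) - A(x)|\<^sup>p dx \<le> C * (|h| powr (1 + \<theta>) + |h| powr q)\<close>
  (\<open>energy_estimate\<close>, \<open>flux_frac_diff\<close>), where \<open>\<theta>\<close> is the order of differentiability of \<open>f\<close>
  in \<open>L\<^sup>p\<close>: it is \<open>\<alpha>\<close> in the Besov case and \<open>1\<close> in the Sobolev case. The order \<open>|h| powr q\<close> of the
  second term comes from absorbing the increment of \<open>A\<close> in the cut-off term; bounding it by the norm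
  of \<open>A\<close> would give only \<open>|h|\<close>.

  In the second half, such a bound with \<open>|h| powr \<gamma>\<close> on the right implies that \<open>|A|\<close> is locally in
  \<open>L\<^sup>t\<close> for all \<open>t < p * n / (n - \<gamma>)\<close> (\<open>fractional_difference_embedding\<close>), which for the gradient
  means every exponent below \<open>q * n / (n - \<gamma>)\<close>. The proof of this embedding iterates a comparison of
  superlevel sets (\<open>superlevel_measure_le\<close>), each round improving the exponent.

  The choice \<open>\<gamma> = min (1 + \<theta>) (2 / (3 - q))\<close> gives the exponents of the theorem. It is admissible
  since \<open>2 / (3 - q) \<le> q\<close>, which amounts to \<open>(q - 1) * (2 - q) \<ge> 0\<close>.

  The remaining work is to make the difference quotients rigorous for weakly differentiable functions:
  the fundamental lemma of the calculus of variations, the uniqueness of weak gradients that follows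
  from it, and the passage from functions on \<open>\<Omega>\<close> to Borel functions on the whole space.
\<close>

section \<open>Smooth cut-off functions\<close>

lemma frechet_eqI:
  assumes "(f has_derivative D) (at x)"
  shows "frechet_derivative f (at x) = D"
  using assms frechet_derivative_at by metis

lemma cont_diff_SucI:
  fixes f :: "'a::euclidean_space \<Rightarrow> real"
  assumes "\<And>x. (f has_derivative D x) (at x)"
    and "\<And>b. b \<in> Basis \<Longrightarrow> cont_diff k (\<lambda>x. D x b)"
  shows "cont_diff (Suc k) f"
proof -
  have "frechet_derivative f (at x) = D x" for x
    using assms(1) by (rule frechet_eqI)
  then show ?thesis
    using assms by (auto simp: differentiable_def)
qed

lemma cont_diff_SucD:
  assumes "cont_diff (Suc k) f"
  shows "(f has_derivative frechet_derivative f (at x)) (at x)"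
    and "b \<in> Basis \<Longrightarrow> cont_diff k (\<lambda>x. frechet_derivative f (at x) b)"
  using assms by (auto simp: frechet_derivative_works)

lemma cont_diff_Suc_imp: "cont_diff (Suc k) f \<Longrightarrow> cont_diff k f"
proof (induction k arbitrary: f)
  case 0
  then show ?case
    by (auto intro!: continuous_at_imp_continuous_on differentiable_imp_continuous_within)
qed auto

lemma cont_diff_continuous: "cont_diff k f \<Longrightarrow> continuous_on UNIV f"
  by (induction k) (auto dest: cont_diff_Suc_imp simp del: cont_diff.simps(2))

lemma cont_diff_const: "cont_diff k (\<lambda>x. c)"
proof (induction k arbitrary: c)
  case (Suc k)
  show ?case by (rule cont_diff_SucI[OF has_derivative_const]) (rule Suc.IH)
qed auto

lemma cont_diff_add: "cont_diff k f \<Longrightarrow> cont_diff k g \<Longrightarrow> cont_diff k (\<lambda>x. f x + g x)"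
proof (induction k arbitrary: f g)
  case 0
  then show ?case by (auto intro: continuous_intros)
next
  case (Suc k)
  show ?case
    by (rule cont_diff_SucI[OF has_derivative_add[OF Suc.prems[THEN cont_diff_SucD(1)]]])
       (intro Suc.IH cont_diff_SucD(2)[OF Suc.prems(1)] cont_diff_SucD(2)[OF Suc.prems(2)])
qed

lemma cont_diff_mult: "cont_diff k f \<Longrightarrow> cont_diff k g \<Longrightarrow> cont_diff k (\<lambda>x. f x * g x)"
proof (induction k arbitrary: f g)
  case 0
  then show ?case by (auto intro: continuous_intros)
next
  case (Suc k)
  show ?case
    by (rule cont_diff_SucI[OF has_derivative_mult[OF Suc.prems[THEN cont_diff_SucD(1)]]])
       (intro Suc.IH cont_diff_add cont_diff_SucD(2)[OF Suc.prems(1)] cont_diff_SucD(2)[OF Suc.prems(2)]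
          cont_diff_Suc_imp[OF Suc.prems(1)] cont_diff_Suc_imp[OF Suc.prems(2)])
qed

lemma cont_diff_sum:
  "finite I \<Longrightarrow> (\<And>i. i \<in> I \<Longrightarrow> cont_diff k (f i)) \<Longrightarrow> cont_diff k (\<lambda>x. \<Sum>i\<in>I. f i x)"
  by (induction I rule: finite_induct) (auto intro: cont_diff_add cont_diff_const)

lemma cont_diff_inner: "cont_diff k (\<lambda>x. x \<bullet> c)"
proof (cases k)
  case (Suc j)
  have "((\<lambda>x. x \<bullet> c) has_derivative (\<lambda>h. h \<bullet> c)) (at x)" for x
    by (auto intro!: derivative_eq_intros)
  then show ?thesis
    unfolding Suc by (rule cont_diff_SucI) (rule cont_diff_const)
qed (auto intro: continuous_intros)

lemma has_derivative_at_shift: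
  fixes f :: "'a::real_normed_vector \<Rightarrow> 'b::real_normed_vector"
  assumes "(f has_derivative D) (at (x + c))"
  shows "((\<lambda>x. f (x + c)) has_derivative D) (at x)"
proof -
  have "((\<lambda>x. x + c) has_derivative (\<lambda>h. h)) (at x)"
    by (auto intro!: derivative_eq_intros)
  from has_derivative_compose[OF this assms] show ?thesis by simp
qed

lemma cont_diff_translate: "cont_diff k f \<Longrightarrow> cont_diff k (\<lambda>x. f (x + c))"
proof (induction k arbitrary: f)
  case 0
  then show ?case by (auto intro!: continuous_on_compose2[of UNIV f] continuous_intros)
next
  case (Suc k)
  have "((\<lambda>x. f (x + c)) has_derivative frechet_derivative f (at (x + c))) (at x)" for x
    by (rule has_derivative_at_shift[OF cont_diff_SucD(1)[OF Suc.prems]])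
  then show ?case
    by (rule cont_diff_SucI) (rule Suc.IH[OF cont_diff_SucD(2)[OF Suc.prems]])
qed

lemma cont_diff_inverse:
  "cont_diff k f \<Longrightarrow> (\<And>x. f x \<noteq> 0) \<Longrightarrow> cont_diff k (\<lambda>x. inverse (f x))"
proof (induction k arbitrary: f)
  case 0
  then show ?case by (auto intro!: continuous_intros)
next
  case (Suc k)
  note IH = Suc.IH[OF cont_diff_Suc_imp[OF Suc.prems(1)] Suc.prems(2)]
  have "((\<lambda>x. inverse (f x)) has_derivative
      (\<lambda>h. -1 * (inverse (f x) * (frechet_derivative f (at x) h * inverse (f x))))) (at x)" for x
    using Deriv.has_derivative_inverse[OF Suc.prems(2) cont_diff_SucD(1)[OF Suc.prems(1)]]
    by (simp add: mult.assoc)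
  then show ?case
    by (rule cont_diff_SucI)
       (intro cont_diff_mult cont_diff_const IH cont_diff_SucD(2)[OF Suc.prems(1)])
qed

text \<open>
  The functions \<open>exp (-1/t) / t ^ m\<close>, extended by zero. They are treated as one family
  because it is closed under differentiation, up to linear combinations: smoothness of the whole
  family, also after composition, then follows by a single induction on the order.
\<close>

definition flat :: "nat \<Rightarrow> real \<Rightarrow> real" where
  "flat m t = (if t > 0 then inverse t ^ m * exp (- inverse t) else 0)"

lemma flat_tendsto_0: "(flat m \<longlongrightarrow> 0) (at 0)"
proof -
  have "((\<lambda>s. s ^ m / exp s) \<longlongrightarrow> (0::real)) at_top"
    by (rule tendsto_power_div_exp_0)
  then have "((\<lambda>t. inverse t ^ m / exp (inverse t)) \<longlongrightarrow> (0::real)) (at_right 0)"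
    by (rule filterlim_compose[OF _ filterlim_inverse_at_top_right])
  then have "(flat m \<longlongrightarrow> 0) (at_right 0)"
    by (rule Lim_transform_eventually)
       (auto simp: flat_def exp_minus divide_inverse eventually_at_filter)
  moreover have "(flat m \<longlongrightarrow> 0) (at_left 0)"
    by (rule Lim_transform_eventually[of "\<lambda>_. 0"]) (auto simp: flat_def eventually_at_filter)
  ultimately show ?thesis
    by (simp add: filterlim_at_split)
qed

text \<open>
  At the origin the difference quotient of the \<open>m\<close>-th function is exactly the \<open>(m + 1)\<close>-st
  function, so differentiability there is the decay of the latter.
\<close>

lemma flat_deriv: "(flat m has_real_derivative flat (m + 2) t - real m * flat (m + 1) t) (at t)"
proof -
  consider "t > 0" | "t < 0" | "t = 0" by linarith
  then show ?thesis
  proof cases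
    case 1
    have "((\<lambda>t. inverse t ^ m * exp (- inverse t)) has_real_derivative
        real m * (- (inverse t ^ 2) * inverse t ^ (m - Suc 0)) * exp (- inverse t)
          + (exp (- inverse t) * inverse t ^ 2) * inverse t ^ m) (at t)"
      using 1 by (auto intro!: derivative_eq_intros simp: power2_eq_square)
    moreover have "real m * (- (inverse t ^ 2) * inverse t ^ (m - Suc 0)) * exp (- inverse t)
          + (exp (- inverse t) * inverse t ^ 2) * inverse t ^ m = flat (m + 2) t - real m * flat (m + 1) t"
      using 1 by (cases m) (simp_all add: flat_def power2_eq_square algebra_simps)
    ultimately have "((\<lambda>t. inverse t ^ m * exp (- inverse t)) has_real_derivative
        flat (m + 2) t - real m * flat (m + 1) t) (at t)"
      by simp
    then show ?thesis
      by (rule DERIV_cong_ev[THEN iffD1, rotated -1])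
         (use 1 in \<open>auto intro!: eventually_nhds_in_open[of "{0<..}", THEN eventually_mono] simp: flat_def\<close>)
  next
    case 2
    have "((\<lambda>t. 0) has_real_derivative 0) (at t)" by simp
    then show ?thesis
      by (rule DERIV_cong_ev[THEN iffD1, rotated -1])
         (use 2 in \<open>auto intro!: eventually_nhds_in_open[of "{..<0}", THEN eventually_mono] simp: flat_def\<close>)
  next
    case 3
    have "(\<lambda>h. (flat m (0 + h) - flat m 0) / h) = flat (m + 1)"
      by (auto simp: fun_eq_iff flat_def divide_inverse algebra_simps)
    then show ?thesis
      using 3 flat_tendsto_0[of "m + 1"] by (simp add: DERIV_def) (simp add: flat_def)
  qed
qed

text \<open>
  The induction must run over all \<open>m\<close> at once, since the derivative involves \<open>m + 1\<close> and
  \<open>m + 2\<close>.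
\<close>

lemma cont_diff_flat: "cont_diff k \<phi> \<Longrightarrow> cont_diff k (\<lambda>x. flat m (\<phi> x))"
proof (induction k arbitrary: \<phi> m)
  case 0
  have "continuous_on UNIV (flat m)"
    using DERIV_continuous[OF flat_deriv] by (auto intro: continuous_at_imp_continuous_on)
  then show ?case using 0 by (auto intro!: continuous_on_compose2[of UNIV "flat m"])
next
  case (Suc k)
  note IH = Suc.IH[OF cont_diff_Suc_imp[OF Suc.prems]]
  have "((\<lambda>x. flat m (\<phi> x)) has_derivative
      (\<lambda>h. (flat (m + 2) (\<phi> x) + (- real m) * flat (m + 1) (\<phi> x)) * frechet_derivative \<phi> (at x) h)) (at x)" for x
    using has_derivative_compose[OF cont_diff_SucD(1)[OF Suc.prems] flat_deriv[of m "\<phi> x", THEN has_field_derivative_imp_has_derivative]]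
    by simp
  then show ?case
    by (rule cont_diff_SucI)
       (intro cont_diff_mult cont_diff_add cont_diff_const IH cont_diff_SucD(2)[OF Suc.prems])
qed

lemma flat_nonneg: "flat m t \<ge> 0" and flat_pos_iff: "flat m t > 0 \<longleftrightarrow> t > 0"
  by (auto simp: flat_def)

lemma test_funI:
  assumes "\<And>k. cont_diff k \<phi>" "compact K" "K \<subseteq> U" "\<And>x. x \<notin> K \<Longrightarrow> \<phi> x = 0"
  shows "\<phi> \<in> test_fun U"
proof -
  have *: "{x. \<phi> x \<noteq> 0} \<subseteq> K" using assms(4) by blast
  then have "closure {x. \<phi> x \<noteq> 0} \<subseteq> K"
    by (intro closure_minimal compact_imp_closed assms(2))
  moreover have "compact (closure {x. \<phi> x \<noteq> 0})"
    unfolding compact_closure by (rule bounded_subset[OF compact_imp_bounded[OF assms(2)] *])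
  ultimately show ?thesis
    using assms(1,3) by (auto simp: test_fun_def)
qed

text \<open>
  By compactness finitely many bumps \<open>exp (-1 / (r\<^sup>2 - |x - a|\<^sup>2))\<close> have a sum \<open>\<rho>\<close> that is at least
  some \<open>c > 0\<close> on \<open>K\<close> and is supported in \<open>U\<close>. A smooth step that vanishes where \<open>\<rho> = 0\<close> and is
  one where \<open>\<rho> \<ge> c\<close> then turns \<open>\<rho>\<close> into a cut-off.
\<close>

lemma ex_cutoff:
  fixes K U :: "'a::euclidean_space set"
  assumes "compact K" "open U" "K \<subseteq> U"
  obtains \<eta> where "\<eta> \<in> test_fun U" "\<And>x. x \<in> K \<Longrightarrow> \<eta> x = 1" "\<And>x. 0 \<le> \<eta> x" "\<And>x. \<eta> x \<le> 1"
proof -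
  have "\<exists>r. 0 < r \<and> cball a r \<subseteq> U" if "a \<in> K" for a
    using assms that open_contains_cball by blast
  then obtain r where r: "\<And>a. a \<in> K \<Longrightarrow> 0 < r a \<and> cball a (r a) \<subseteq> U" by metis
  have "K \<subseteq> (\<Union>a\<in>K. ball a (r a))" using r by (auto intro!: bexI)
  then obtain C where C: "C \<subseteq> K" "finite C" "K \<subseteq> (\<Union>a\<in>C. ball a (r a))"
    using compactE_image[OF \<open>compact K\<close>, of K "\<lambda>a. ball a (r a)"] by (metis open_ball)
  define \<rho> where "\<rho> x = (\<Sum>a\<in>C. flat 0 ((r a)\<^sup>2 - (dist x a)\<^sup>2))" for x
  have dist_sq: "(dist y a)\<^sup>2 = (\<Sum>b\<in>Basis. ((y + (- a)) \<bullet> b) * ((y + (- a)) \<bullet> b))" for y a :: 'a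
    unfolding dist_norm power2_norm_eq_inner by (subst euclidean_inner) simp
  have "cont_diff k (\<lambda>x. (r a)\<^sup>2 + (-1) * (dist x a)\<^sup>2)" for k a
    unfolding dist_sq
    by (intro cont_diff_add cont_diff_const cont_diff_mult cont_diff_sum finite_Basis
        cont_diff_translate[OF cont_diff_inner])
  then have sm\<rho>: "cont_diff k \<rho>" for k
    unfolding \<rho>_def[abs_def] by (intro cont_diff_sum C cont_diff_flat) simp
  have \<rho>_nonneg: "\<rho> x \<ge> 0" for x
    by (simp add: \<rho>_def sum_nonneg flat_nonneg)
  have \<rho>_pos: "\<rho> x > 0" if x: "x \<in> K" for x
  proof -
    obtain a where a: "a \<in> C" "dist x a < r a" using C x by (auto simp: dist_commute)
    then have "flat 0 ((r a)\<^sup>2 - (dist x a)\<^sup>2) > 0"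
      by (simp add: flat_pos_iff power_strict_mono)
    then show ?thesis unfolding \<rho>_def
      using a C by (intro sum_pos2[of _ a]) (auto simp: flat_nonneg)
  qed
  have \<rho>_supp: "{x. \<rho> x \<noteq> 0} \<subseteq> (\<Union>a\<in>C. cball a (r a))"
  proof
    fix x assume "x \<in> {x. \<rho> x \<noteq> 0}"
    then obtain a where a: "a \<in> C" "flat 0 ((r a)\<^sup>2 - (dist x a)\<^sup>2) \<noteq> 0"
      unfolding \<rho>_def by (auto elim: sum.not_neutral_contains_not_neutral)
    then have "(dist x a)\<^sup>2 < (r a)\<^sup>2"
      by (auto simp: flat_def split: if_splits)
    moreover have "0 < r a" using a C r by auto
    ultimately have "dist x a < r a" by (auto dest: power_less_imp_less_base)
    then show "x \<in> (\<Union>a\<in>C. cball a (r a))" using a by (auto simp: dist_commute intro: less_imp_le)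
  qed
  have cU: "compact (\<Union>a\<in>C. cball a (r a))" "(\<Union>a\<in>C. cball a (r a)) \<subseteq> U"
    using C r by (auto intro!: compact_UN)
  obtain c where c: "c > 0" "\<And>x. x \<in> K \<Longrightarrow> c \<le> \<rho> x"
  proof (cases "K = {}")
    case False
    have "continuous_on K \<rho>" using cont_diff_continuous[OF sm\<rho>] continuous_on_subset by blast
    then obtain x where "x \<in> K" "\<And>y. y \<in> K \<Longrightarrow> \<rho> x \<le> \<rho> y"
      using continuous_attains_inf[OF \<open>compact K\<close> False] by blast
    then show ?thesis using that \<rho>_pos by blast
  qed (use that[of 1] in auto)
  define \<eta> where "\<eta> x = flat 0 (\<rho> x) * inverse (flat 0 (\<rho> x) + flat 0 (c + (-1) * \<rho> x))" for x
  have den: "flat 0 (\<rho> x) + flat 0 (c + (-1) * \<rho> x) > 0" for x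
  proof (cases "\<rho> x > 0")
    case False
    then show ?thesis using c \<rho>_nonneg[of x]
      by (intro add_nonneg_pos) (auto simp: flat_nonneg flat_pos_iff)
  qed (intro add_pos_nonneg, auto simp: flat_nonneg flat_pos_iff)
  show thesis
  proof
    have "cont_diff k \<eta>" for k
      unfolding \<eta>_def[abs_def]
      by (intro cont_diff_mult cont_diff_inverse cont_diff_add cont_diff_flat sm\<rho> cont_diff_const
          less_imp_neq[OF den, symmetric])
    moreover have "\<eta> x = 0" if "x \<notin> (\<Union>a\<in>C. cball a (r a))" for x
    proof -
      have "\<rho> x = 0" using \<rho>_supp that by blast
      then show ?thesis by (simp add: \<eta>_def flat_def)
    qed
    ultimately show "\<eta> \<in> test_fun U" by (intro test_funI[OF _ cU])
    show "\<eta> x = 1" if "x \<in> K" for x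
      using c(2)[OF that] \<rho>_pos[OF that] by (simp add: \<eta>_def flat_def)
    show "0 \<le> \<eta> x" for x using den[of x] by (auto simp: \<eta>_def flat_nonneg)
    show "\<eta> x \<le> 1" for x using den[of x] flat_nonneg[of 0 "c + (-1) * \<rho> x"]
      by (simp add: \<eta>_def field_simps)
  qed
qed

lemma test_fun_cont_diff: "\<phi> \<in> test_fun U \<Longrightarrow> cont_diff k \<phi>"
  by (auto simp: test_fun_def)

lemma test_fun_derivative:
  assumes "\<phi> \<in> test_fun U"
  shows "(\<phi> has_derivative frechet_derivative \<phi> (at x)) (at x)"
  using cont_diff_SucD(1)[OF test_fun_cont_diff[OF assms]] .

lemma test_fun_support:
  assumes "\<phi> \<in> test_fun U"
  obtains K where "compact K" "K \<subseteq> U" "\<And>x. x \<notin> K \<Longrightarrow> \<phi> x = 0"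
    "\<And>x. x \<notin> K \<Longrightarrow> frechet_derivative \<phi> (at x) = (\<lambda>_. 0)"
proof
  let ?K = "closure {x. \<phi> x \<noteq> 0}"
  show "compact ?K" "?K \<subseteq> U" using assms by (auto simp: test_fun_def)
  show *: "\<phi> x = 0" if "x \<notin> ?K" for x using that closure_subset[of "{x. \<phi> x \<noteq> 0}"] by blast
  show "frechet_derivative \<phi> (at x) = (\<lambda>_. 0)" if x: "x \<notin> ?K" for x
  proof (rule frechet_eqI)
    show "(\<phi> has_derivative (\<lambda>_. 0)) (at x)"
    proof (rule has_derivative_transform_within_open[of "\<lambda>_. 0" _ _ _ "- ?K"])
      show "0 = \<phi> y" if "y \<in> - ?K" for y
        using *[of y] that by (metis ComplD)
    qed (use x in \<open>simp_all only: has_derivative_const open_Compl closed_closure Compl_iff not_False_eq_True\<close>)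
  qed
qed

lemma test_fun_mono: "\<phi> \<in> test_fun U \<Longrightarrow> U \<subseteq> V \<Longrightarrow> \<phi> \<in> test_fun V"
  by (auto simp: test_fun_def)

lemma test_fun_mult: 
  assumes "\<phi> \<in> test_fun U" "\<psi> \<in> test_fun V"
  shows "(\<lambda>x. \<phi> x * \<psi> x) \<in> test_fun U" "(\<lambda>x. \<psi> x * \<phi> x) \<in> test_fun U"
proof -
  obtain K where K: "compact K" "K \<subseteq> U" "\<And>x. x \<notin> K \<Longrightarrow> \<phi> x = 0"
    by (rule test_fun_support[OF assms(1)], rule that; assumption)
  note cd = test_fun_cont_diff[OF assms(1)] test_fun_cont_diff[OF assms(2)]
  show "(\<lambda>x. \<phi> x * \<psi> x) \<in> test_fun U"
    by (rule test_funI[OF cont_diff_mult[OF cd] K(1,2)]) (simp add: K(3))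
  show "(\<lambda>x. \<psi> x * \<phi> x) \<in> test_fun U"
    by (rule test_funI[OF cont_diff_mult[OF cd(2,1)] K(1,2)]) (simp add: K(3))
qed

lemma test_fun_translate:
  fixes c :: "'a::euclidean_space"
  assumes "\<phi> \<in> test_fun U" "(\<lambda>x. x - c) ` U \<subseteq> V"
  shows "(\<lambda>x. \<phi> (x + c)) \<in> test_fun V"
proof -
  obtain K where K: "compact K" "K \<subseteq> U" "\<And>x. x \<notin> K \<Longrightarrow> \<phi> x = 0"
    by (rule test_fun_support[OF assms(1)], rule that; assumption)
  show ?thesis
  proof (rule test_funI)
    show "cont_diff k (\<lambda>x. \<phi> (x + c))" for k
      by (intro cont_diff_translate test_fun_cont_diff[OF assms(1)])
    show "compact ((\<lambda>x. x - c) ` K)"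
      by (intro compact_continuous_image K continuous_intros)
    show "(\<lambda>x. x - c) ` K \<subseteq> V" using K assms by auto
    show "\<phi> (x + c) = 0" if "x \<notin> (\<lambda>x. x - c) ` K" for x
    proof (rule K(3), rule notI)
      assume "x + c \<in> K"
      then have "(x + c) - c \<in> (\<lambda>x. x - c) ` K" by (rule imageI)
      then show False using that by simp
    qed
  qed
qed

lemma frechet_derivative_translate:
  assumes "\<phi> \<in> test_fun U"
  shows "frechet_derivative (\<lambda>x. \<phi> (x + c)) (at x) = frechet_derivative \<phi> (at (x + c))"
proof (rule frechet_eqI)
  show "((\<lambda>x. \<phi> (x + c)) has_derivative frechet_derivative \<phi> (at (x + c))) (at x)"
    by (rule has_derivative_at_shift[OF test_fun_derivative[OF assms]])
qed

lemma test_fun_bounded: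
  assumes "\<phi> \<in> test_fun U"
  shows "continuous_on UNIV \<phi>" "\<phi> \<in> borel_measurable borel" "\<exists>B. \<forall>x. \<bar>\<phi> x\<bar> \<le> B"
proof -
  show c: "continuous_on UNIV \<phi>" using cont_diff_continuous test_fun_cont_diff[OF assms] by blast
  then show "\<phi> \<in> borel_measurable borel" by (rule borel_measurable_continuous_onI)
  obtain K where K: "compact K" "K \<subseteq> U" "\<And>x. x \<notin> K \<Longrightarrow> \<phi> x = 0"
    by (rule test_fun_support[OF assms(1)], rule that; assumption)
  have "bounded (\<phi> ` K)" 
    by (intro compact_imp_bounded compact_continuous_image continuous_on_subset[OF c] K subset_UNIV)
  then obtain B where B: "\<And>x. x \<in> K \<Longrightarrow> \<bar>\<phi> x\<bar> \<le> B" unfolding bounded_iff by auto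
  then have "\<bar>\<phi> x\<bar> \<le> max B 0" for x using K(3)[of x] by (cases "x \<in> K") (auto simp: le_max_iff_disj)
  then show "\<exists>B. \<forall>x. \<bar>\<phi> x\<bar> \<le> B" by blast
qed

lemma test_fun_partial:
  assumes "\<phi> \<in> test_fun U" "b \<in> Basis"
  shows "(\<lambda>x. frechet_derivative \<phi> (at x) b) \<in> test_fun U"
proof -
  obtain K where K: "compact K" "K \<subseteq> U" 
    "\<And>x. x \<notin> K \<Longrightarrow> frechet_derivative \<phi> (at x) = (\<lambda>_. 0)"
    by (rule test_fun_support[OF assms(1)], rule that; assumption)
  show ?thesis
    by (rule test_funI[OF cont_diff_SucD(2)[OF test_fun_cont_diff[OF assms(1)] assms(2)] K(1,2)])
       (simp add: K(3))
qed

text \<open>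
  Test functions are paired with vector fields below, so their partial derivatives are collected
  in the gradient.
\<close>

definition grad :: "('a::euclidean_space \<Rightarrow> real) \<Rightarrow> 'a \<Rightarrow> 'a" where
  "grad \<phi> x = (\<Sum>b\<in>Basis. frechet_derivative \<phi> (at x) b *\<^sub>R b)"

lemma grad_inner:
  assumes "\<phi> \<in> test_fun U"
  shows "grad \<phi> x \<bullet> h = frechet_derivative \<phi> (at x) h"
proof -
  interpret bounded_linear "frechet_derivative \<phi> (at x)"
    using test_fun_derivative[OF assms] has_derivative_bounded_linear by blast
  have "frechet_derivative \<phi> (at x) h = frechet_derivative \<phi> (at x) (\<Sum>b\<in>Basis. (h \<bullet> b) *\<^sub>R b)"
    by (simp add: euclidean_representation)
  also have "\<dots> = (\<Sum>b\<in>Basis. (h \<bullet> b) * frechet_derivative \<phi> (at x) b)"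
    by (simp add: sum scaleR)
  finally show ?thesis
    by (simp add: grad_def inner_sum_left inner_commute[of h] mult.commute)
qed

lemma grad_bounded:
  assumes "\<phi> \<in> test_fun U"
  shows "continuous_on UNIV (grad \<phi>)" "grad \<phi> \<in> borel_measurable borel" "\<exists>B. \<forall>x. norm (grad \<phi> x) \<le> B"
proof -
  note t = test_fun_bounded[OF test_fun_partial[OF assms]]
  show c: "continuous_on UNIV (grad \<phi>)"
    unfolding grad_def by (intro continuous_on_sum continuous_on_scaleR t continuous_on_const)
  then show "grad \<phi> \<in> borel_measurable borel" by (rule borel_measurable_continuous_onI)
  have "\<forall>b\<in>Basis. \<exists>B. \<forall>x. \<bar>frechet_derivative \<phi> (at x) b\<bar> \<le> B"
    using t(3) by blast
  then obtain B where B: "\<forall>b\<in>Basis. \<forall>x. \<bar>frechet_derivative \<phi> (at x) b\<bar> \<le> B b"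
    by (rule bchoice[THEN exE])
  have "norm (grad \<phi> x) \<le> (\<Sum>b\<in>Basis. B b)" for x
    unfolding grad_def by (rule sum_norm_le) (use B in auto)
  then show "\<exists>B. \<forall>x. norm (grad \<phi> x) \<le> B" by blast
qed

lemma frechet_derivative_test_mult:
  assumes "\<phi> \<in> test_fun U" "\<psi> \<in> test_fun V"
  shows "frechet_derivative (\<lambda>x. \<phi> x * \<psi> x) (at x) b
     = \<phi> x * frechet_derivative \<psi> (at x) b + frechet_derivative \<phi> (at x) b * \<psi> x"
  using frechet_eqI[OF has_derivative_mult[OF assms[THEN test_fun_derivative], of x]]
  by simp

section \<open>The fundamental lemma of the calculus of variations\<close>

text \<open>
  The indicator of a compact set is the pointwise limit of cut-offs between 0 and 1 that are
  supported in shrinking neighbourhoods of the set, and dominated convergence applies.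
\<close>

lemma integral_compact_eq_0_if_orthogonal_test_fun:
  fixes g :: "'a::euclidean_space \<Rightarrow> real"
  assumes U: "open U" and g: "integrable lborel g"
    and orth: "\<And>\<phi>. \<phi> \<in> test_fun U \<Longrightarrow> (LINT x|lborel. g x * \<phi> x) = 0"
    and K: "compact K" "K \<subseteq> U"
  shows "(LINT x|lborel. g x * indicator K x) = 0"
proof (cases "K = {}")
  case False
  define V where "V k = {x \<in> U. infdist x K < inverse (real (Suc k))}" for k
  have V: "open (V k)" "K \<subseteq> V k" "V k \<subseteq> U" for k
  proof -
    have "open {x. infdist x K < inverse (real (Suc k))}"
      by (intro open_Collect_less continuous_intros)
    then show "open (V k)" using U unfolding V_def Collect_conj_eq by auto
  qed (use K in \<open>auto simp: V_def\<close>)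
  have "\<exists>\<eta>. \<eta> \<in> test_fun (V k) \<and> (\<forall>x\<in>K. \<eta> x = 1) \<and> (\<forall>x. 0 \<le> \<eta> x \<and> \<eta> x \<le> 1)" for k
    by (rule ex_cutoff[OF K(1) V(1,2)]) blast
  then obtain \<eta> where \<eta>: "\<And>k. \<eta> k \<in> test_fun (V k)" "\<And>k x. x \<in> K \<Longrightarrow> \<eta> k x = 1"
    "\<And>k x. 0 \<le> \<eta> k x" "\<And>k x. \<eta> k x \<le> (1::real)" by metis
  have 0: "(LINT x|lborel. g x * \<eta> k x) = 0" for k
    by (rule orth[OF test_fun_mono[OF \<eta>(1) V(3)]])
  have lim: "(\<lambda>k. g x * \<eta> k x) \<longlonglongrightarrow> g x * indicator K x" for x
  proof (cases "x \<in> K")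
    case True
    then show ?thesis by (simp add: \<eta>)
  next
    case x: False
    have "infdist x K > 0"
      using x K False by (metis compact_imp_closed in_closed_iff_infdist_zero infdist_nonneg less_eq_real_def)
    then obtain N where N: "inverse (real (Suc N)) < infdist x K" using reals_Archimedean by blast
    have "\<eta> k x = 0" if "k \<ge> N" for k
    proof -
      have "inverse (real (Suc k)) \<le> inverse (real (Suc N))" using that by (intro le_imp_inverse_le) auto
      then have "inverse (real (Suc k)) \<le> infdist x K" using N by linarith
      then have "x \<notin> V k" unfolding V_def by simp
      then show ?thesis using test_fun_support[OF \<eta>(1)[of k]] by (metis subsetD)
    qed
    then have "\<forall>\<^sub>F k in sequentially. g x * \<eta> k x = g x * indicator K x"
      using x by (auto intro: eventually_sequentiallyI[of N])
    then show ?thesis by (rule tendsto_eventually)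
  qed
  have "(\<lambda>k. LINT x|lborel. g x * \<eta> k x) \<longlonglongrightarrow> (LINT x|lborel. g x * indicator K x)"
  proof (rule integral_dominated_convergence[where w = "\<lambda>x. \<bar>g x\<bar>"])
    have [measurable]: "K \<in> sets borel" using K by (simp add: compact_imp_closed)
    show "(\<lambda>x. g x * indicator K x) \<in> borel_measurable lborel"
      using g by measurable
    show "(\<lambda>x. g x * \<eta> k x) \<in> borel_measurable lborel" for k
      using g test_fun_bounded(2)[OF \<eta>(1)[of k]] by measurable
    show "AE x in lborel. norm (g x * \<eta> k x) \<le> \<bar>g x\<bar>" for k
      using \<eta>(3,4) by (auto simp: abs_mult intro!: mult_left_le)
  qed (use g lim in auto)
  then show ?thesis unfolding 0 by (simp add: LIMSEQ_const_iff)
qed simp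

text \<open>
  By inner regularity \<open>{g > 0}\<close> is, up to a null set, a countable union of compact sets. On each of
  them the integral of the positive function \<open>g\<close> vanishes, so that each of them is a null set.
\<close>

lemma AE_le_0_if_orthogonal_test_fun:
  fixes g :: "'a::euclidean_space \<Rightarrow> real"
  assumes U: "open U" and g: "integrable lborel g"
    and orth: "\<And>\<phi>. \<phi> \<in> test_fun U \<Longrightarrow> (LINT x|lborel. g x * \<phi> x) = 0"
  shows "AE x in lborel. x \<in> U \<longrightarrow> g x \<le> 0"
proof -
  have [measurable]: "g \<in> borel_measurable borel" using g by auto
  define S where "S = {x. x \<in> U \<and> 0 < g x}"
  have "S \<in> sets borel" using U unfolding S_def by measurable
  then have "S \<in> sets lebesgue" by auto
  from lebesgue_regular_inner[OF this] obtain T F where F: "negligible T" "\<And>n::nat. compact (F n)" "S = (\<Union>n. F n) \<union> T"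
    by metis
  have "negligible (F n)" for n
  proof -
    have sub: "F n \<subseteq> S" using F by auto
    have [measurable]: "F n \<in> sets borel" using F by (simp add: compact_imp_closed)
    have "(LINT x|lborel. g x * indicator (F n) x) = 0"
      by (rule integral_compact_eq_0_if_orthogonal_test_fun[OF U g orth F(2)])
         (use sub in \<open>auto simp: S_def\<close>)
    moreover have "integrable lborel (\<lambda>x. g x * indicator (F n) x)"
      by (rule Bochner_Integration.integrable_bound[OF g]) (auto simp: indicator_def)
    moreover have "AE x in lborel. 0 \<le> g x * indicator (F n) x"
      using sub by (auto simp: S_def indicator_def intro: less_imp_le)
    ultimately have "AE x in lborel. g x * indicator (F n) x = 0"
      by (subst integral_nonneg_eq_0_iff_AE[symmetric])
    then have "AE x in lborel. x \<notin> F n"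
      by eventually_elim (use sub in \<open>auto simp: S_def indicator_def\<close>)
    then have "F n \<in> null_sets lborel" by (subst AE_iff_null_sets) auto
    then show ?thesis by (simp add: negligible_iff_null_sets null_sets_completionI)
  qed
  then have "negligible S"
    unfolding F(3) by (intro negligible_Un F(1) negligible_Union_nat)
  then have "S \<in> null_sets lborel"
    using \<open>S \<in> sets borel\<close> by (simp add: negligible_iff_null_sets null_sets_completion_iff)
  then have "AE x in lborel. x \<notin> S" by (rule AE_not_in)
  then show ?thesis by eventually_elim (auto simp: S_def)
qed

lemma AE_eq_0_if_orthogonal_test_fun:
  fixes g :: "'a::euclidean_space \<Rightarrow> real"
  assumes U: "open U" and g: "integrable lborel g"
    and orth: "\<And>\<phi>. \<phi> \<in> test_fun U \<Longrightarrow> (LINT x|lborel. g x * \<phi> x) = 0"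
  shows "AE x in lborel. x \<in> U \<longrightarrow> g x = 0"
proof -
  have "AE x in lborel. x \<in> U \<longrightarrow> g x \<le> 0"
    by (rule AE_le_0_if_orthogonal_test_fun[OF assms])
  moreover have "AE x in lborel. x \<in> U \<longrightarrow> - g x \<le> 0"
    by (rule AE_le_0_if_orthogonal_test_fun[OF U]) (use g orth in auto)
  ultimately show ?thesis by eventually_elim auto
qed

section \<open>Weak derivatives on the whole space\<close>

text \<open>
  The variant of a weak gradient used in all estimates: the functions live on the whole space, are
  integrable for \<open>lborel\<close>, and the identity is required only for test functions supported in \<open>U\<close>.
  Since \<open>lborel\<close> is translation invariant and does not refer to \<open>U\<close>, this notion behaves well under
  translations, differences and cut-offs.
\<close>

definition weak_deriv :: "'a::euclidean_space set \<Rightarrow> ('a \<Rightarrow> real) \<Rightarrow> ('a \<Rightarrow> 'a) \<Rightarrow> bool" where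
  "weak_deriv U v H \<longleftrightarrow> integrable lborel v \<and> integrable lborel H \<and>
     (\<forall>\<psi>\<in>test_fun U. (LINT x|lborel. v x *\<^sub>R grad \<psi> x) = - (LINT x|lborel. \<psi> x *\<^sub>R H x))"

lemma integrable_bounded_mult:
  fixes f :: "'a::euclidean_space \<Rightarrow> 'b::euclidean_space"
  assumes "integrable lborel f" "g \<in> borel_measurable borel" "\<exists>B. \<forall>x. \<bar>g x\<bar> \<le> B"
  shows "integrable lborel (\<lambda>x. g x *\<^sub>R f x)"
proof -
  obtain B where B: "\<And>x. \<bar>g x\<bar> \<le> B" using assms by blast
  have [measurable]: "f \<in> borel_measurable borel" using assms(1) by auto
  note assms(2)[measurable]
  show ?thesis
  proof (rule Bochner_Integration.integrable_bound)
    show "integrable lborel (\<lambda>x. B * norm (f x))" using assms by auto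
    show "AE x in lborel. norm (g x *\<^sub>R f x) \<le> norm (B * norm (f x))"
      using B by (auto simp: abs_mult intro!: mult_right_mono order_trans[OF B])
  qed auto
qed

lemma integrable_mult_bounded_vec:
  fixes g :: "'a::euclidean_space \<Rightarrow> 'b::euclidean_space" and v :: "'a \<Rightarrow> real"
  assumes "integrable lborel v" "g \<in> borel_measurable borel" "\<exists>B. \<forall>x. norm (g x) \<le> B"
  shows "integrable lborel (\<lambda>x. v x *\<^sub>R g x)"
proof -
  obtain B where B: "\<And>x. norm (g x) \<le> B" using assms by blast
  have [measurable]: "v \<in> borel_measurable borel" using assms(1) by auto
  note assms(2)[measurable]
  show ?thesis
  proof (rule Bochner_Integration.integrable_bound)
    show "integrable lborel (\<lambda>x. B * norm (v x))" using assms by auto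
    have "norm (g x) \<le> \<bar>B\<bar>" for x using B[of x] by linarith
    then show "AE x in lborel. norm (v x *\<^sub>R g x) \<le> norm (B * norm (v x))"
      by (intro AE_I2) (simp add: abs_mult mult.commute[of "\<bar>B\<bar>"] mult_left_mono)
  qed auto
qed

lemma integral_translate:
  fixes f :: "'a::euclidean_space \<Rightarrow> 'b::euclidean_space"
  assumes [measurable]: "f \<in> borel_measurable borel"
  shows "(LINT x|lborel. f (x + c)) = (LINT x|lborel. f x)"
    and "integrable lborel (\<lambda>x. f (x + c)) \<longleftrightarrow> integrable lborel f"
proof -
  show "(LINT x|lborel. f (x + c)) = (LINT x|lborel. f x)"
    by (subst (2) lborel_distr_plus[of c, symmetric]) (subst integral_distr, auto simp: add.commute)
  show "integrable lborel (\<lambda>x. f (x + c)) \<longleftrightarrow> integrable lborel f"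
    by (subst (2) lborel_distr_plus[of c, symmetric]) (subst integrable_distr_eq, auto simp: add.commute)
qed

lemma nn_integral_translate:
  fixes f :: "'a::euclidean_space \<Rightarrow> ennreal"
  assumes [measurable]: "f \<in> borel_measurable borel"
  shows "(\<integral>\<^sup>+x. f (x + c) \<partial>lborel) = (\<integral>\<^sup>+x. f x \<partial>lborel)"
  by (subst (2) lborel_distr_plus[of c, symmetric]) (subst nn_integral_distr, auto simp: add.commute)

lemma weak_derivD:
  assumes "weak_deriv U v H"
  shows "integrable lborel v" "integrable lborel H" "v \<in> borel_measurable borel" "H \<in> borel_measurable borel"
    "\<psi> \<in> test_fun U \<Longrightarrow> (LINT x|lborel. v x *\<^sub>R grad \<psi> x) = - (LINT x|lborel. \<psi> x *\<^sub>R H x)"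
  using assms by (auto simp: weak_deriv_def)

lemma grad_translate:
  "\<phi> \<in> test_fun U \<Longrightarrow> grad (\<lambda>x. \<phi> (x + c)) x = grad \<phi> (x + c)"
  by (simp add: grad_def frechet_derivative_translate)

lemma weak_deriv_translate:
  assumes "weak_deriv U v H" and V: "\<And>x. x \<in> V \<Longrightarrow> x + h \<in> U"
  shows "weak_deriv V (\<lambda>x. v (x + h)) (\<lambda>x. H (x + h))"
proof -
  note W = weak_derivD[OF assms(1)]
  note [measurable] = W(3,4)
  have "(LINT x|lborel. v (x + h) *\<^sub>R grad \<psi> x) = - (LINT x|lborel. \<psi> x *\<^sub>R H (x + h))"
    if \<psi>: "\<psi> \<in> test_fun V" for \<psi>
  proof -
    \<comment> \<open>translate the test function instead of \<open>v\<close>\<close>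
    define \<psi>' where "\<psi>' = (\<lambda>x. \<psi> (x + - h))"
    have \<psi>': "\<psi>' \<in> test_fun U" 
      unfolding \<psi>'_def by (rule test_fun_translate[OF \<psi>]) (auto dest: V)
    note [measurable] = grad_bounded(2)[OF \<psi>] grad_bounded(2)[OF \<psi>'] test_fun_bounded(2)[OF \<psi>] test_fun_bounded(2)[OF \<psi>']
    have "(LINT x|lborel. v (x + h) *\<^sub>R grad \<psi> x) = (LINT x|lborel. v (x + h) *\<^sub>R grad \<psi>' (x + h))"
      unfolding \<psi>'_def grad_translate[OF \<psi>] by simp
    also have "\<dots> = (LINT x|lborel. v x *\<^sub>R grad \<psi>' x)"
      by (rule integral_translate(1)[of "\<lambda>x. v x *\<^sub>R grad \<psi>' x"]) measurable
    also have "\<dots> = - (LINT x|lborel. \<psi>' x *\<^sub>R H x)" by (rule W(5)[OF \<psi>'])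
    also have "\<dots> = - (LINT x|lborel. \<psi>' (x + h) *\<^sub>R H (x + h))"
      by (subst integral_translate(1)[of "\<lambda>x. \<psi>' x *\<^sub>R H x" h]) auto
    finally show ?thesis by (simp add: \<psi>'_def)
  qed
  then show ?thesis
    using W(1,2) by (auto simp: weak_deriv_def integral_translate(2))
qed

lemma weak_deriv_diff:
  assumes "weak_deriv U v1 H1" "weak_deriv U v2 H2"
  shows "weak_deriv U (\<lambda>x. v1 x - v2 x) (\<lambda>x. H1 x - H2 x)"
proof -
  note W = weak_derivD[OF assms(1)] weak_derivD[OF assms(2)]
  have "(LINT x|lborel. (v1 x - v2 x) *\<^sub>R grad \<psi> x) = - (LINT x|lborel. \<psi> x *\<^sub>R (H1 x - H2 x))"
    if \<psi>: "\<psi> \<in> test_fun U" for \<psi>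
    using W(5,10)[OF \<psi>]
      integrable_mult_bounded_vec[OF W(1) grad_bounded(2,3)[OF \<psi>]]
      integrable_mult_bounded_vec[OF W(6) grad_bounded(2,3)[OF \<psi>]]
      integrable_bounded_mult[OF W(2) test_fun_bounded(2,3)[OF \<psi>]]
      integrable_bounded_mult[OF W(7) test_fun_bounded(2,3)[OF \<psi>]]
    by (simp add: scaleR_diff_left scaleR_diff_right)
  then show ?thesis using W by (auto simp: weak_deriv_def)
qed

lemma weak_deriv_subset: "weak_deriv U v H \<Longrightarrow> V \<subseteq> U \<Longrightarrow> weak_deriv V v H"
  using test_fun_mono unfolding weak_deriv_def by blast

lemma grad_test_mult:
  assumes "\<phi> \<in> test_fun U" "\<psi> \<in> test_fun V"
  shows "grad (\<lambda>x. \<phi> x * \<psi> x) x = \<phi> x *\<^sub>R grad \<psi> x + \<psi> x *\<^sub>R grad \<phi> x"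
  by (simp add: grad_def frechet_derivative_test_mult[OF assms] scaleR_sum_right sum.distrib algebra_simps)

text \<open>
  After multiplication with a test function supported in \<open>U\<close> the product rule holds on the whole
  space. This is how admissible functions for the weak equation are produced.
\<close>

lemma weak_deriv_mult:
  assumes "weak_deriv U v H" and \<zeta>: "\<zeta> \<in> test_fun U"
  shows "weak_deriv UNIV (\<lambda>x. \<zeta> x * v x) (\<lambda>x. \<zeta> x *\<^sub>R H x + v x *\<^sub>R grad \<zeta> x)"
proof -
  note W = weak_derivD[OF assms(1)]
  note i1 = integrable_bounded_mult[OF _ test_fun_bounded(2) test_fun_bounded(3)]
  note i2 = integrable_mult_bounded_vec[OF _ grad_bounded(2) grad_bounded(3)]
  have i\<zeta>: "integrable lborel (\<lambda>x. \<zeta> x * v x)"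
    using i1[OF W(1) \<zeta> \<zeta>] unfolding real_scaleR_def .
  have "(LINT x|lborel. (\<zeta> x * v x) *\<^sub>R grad \<psi> x) = - (LINT x|lborel. \<psi> x *\<^sub>R (\<zeta> x *\<^sub>R H x + v x *\<^sub>R grad \<zeta> x))"
    if \<psi>: "\<psi> \<in> test_fun UNIV" for \<psi>
  proof -
    let ?\<phi> = "\<lambda>x. \<zeta> x * \<psi> x"
    have \<phi>: "?\<phi> \<in> test_fun U" by (rule test_fun_mult[OF \<zeta> \<psi>])
    have j: "integrable lborel (\<lambda>x. v x *\<^sub>R grad ?\<phi> x)"
      "integrable lborel (\<lambda>x. \<psi> x *\<^sub>R v x *\<^sub>R grad \<zeta> x)"
      "integrable lborel (\<lambda>x. \<psi> x *\<^sub>R \<zeta> x *\<^sub>R H x)"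
      using i2[OF W(1) \<phi> \<phi>] i1[OF i2[OF W(1) \<zeta> \<zeta>] \<psi> \<psi>] i1[OF i1[OF W(2) \<zeta> \<zeta>] \<psi> \<psi>]
      by auto
    have "(LINT x|lborel. (\<zeta> x * v x) *\<^sub>R grad \<psi> x) = (LINT x|lborel. v x *\<^sub>R grad ?\<phi> x - \<psi> x *\<^sub>R v x *\<^sub>R grad \<zeta> x)"
      unfolding grad_test_mult[OF \<zeta> \<psi>] by (simp add: algebra_simps)
    also have "\<dots> = - (LINT x|lborel. ?\<phi> x *\<^sub>R H x) - (LINT x|lborel. \<psi> x *\<^sub>R v x *\<^sub>R grad \<zeta> x)"
      using j W(5)[OF \<phi>] by simp
    also have "\<dots> = - (LINT x|lborel. \<psi> x *\<^sub>R (\<zeta> x *\<^sub>R H x + v x *\<^sub>R grad \<zeta> x))"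
      using j by (simp add: scaleR_add_right mult.commute)
    finally show ?thesis .
  qed
  then show ?thesis
    using i\<zeta> i1[OF W(2) \<zeta> \<zeta>] i2[OF W(1) \<zeta> \<zeta>] by (auto simp: weak_deriv_def)
qed

section \<open>Difference quotients of weakly differentiable functions\<close>

text \<open>
  Integrability on a product space for functions that live on the slab \<open>0 \<le> t \<le> 1\<close>, with sections
  that are bounded in \<open>L\<^sup>1\<close> uniformly in \<open>t\<close>. It justifies the exchanges of integrals below.
\<close>

lemma integrable_slab:
  fixes k :: "real \<times> 'a::euclidean_space \<Rightarrow> real"
  assumes [measurable]: "k \<in> borel_measurable (lborel \<Otimes>\<^sub>M lborel)"
    and int: "\<And>t. integrable lborel (\<lambda>x. k (t, x))"
    and bound: "\<And>t. (LINT x|lborel. \<bar>k (t, x)\<bar>) \<le> C * indicator {0..1} t"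
  shows "integrable (lborel \<Otimes>\<^sub>M lborel) k"
proof (rule lborel_pair.Fubini_integrable)
  show "integrable lborel (\<lambda>t. LINT x|lborel. norm (k (t, x)))"
  proof (rule Bochner_Integration.integrable_bound)
    show "integrable lborel (\<lambda>t. C * indicator {0..1::real} t)"
      by (intro integrable_mult_right integrable_real_indicator) auto
    show "(\<lambda>t. LINT x|lborel. norm (k (t, x))) \<in> borel_measurable lborel" by measurable
    have nn: "0 \<le> (LINT x|lborel. norm (k (t, x)))" for t by (rule integral_nonneg_AE) simp
    show "AE t in lborel. norm (LINT x|lborel. norm (k (t, x))) \<le> norm (C * indicator {0..1} t)"
    proof (rule AE_I2)
      fix t
      show "norm (LINT x|lborel. norm (k (t, x))) \<le> norm (C * indicator {0..1} t)"
        using nn[of t] bound[of t] by (simp only: real_norm_def)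
    qed
  qed
qed (use int in auto)

text \<open>
  The fundamental theorem of calculus for weak derivatives, by duality. Against a test function \<open>\<psi>\<close>,
  the left-hand side is \<open>\<integral> v(x) (\<psi>(x - h) - \<psi>(x)) dx\<close>; writing the difference as an integral of
  \<open>- grad \<psi>(x - t h) \<bullet> h\<close> over \<open>t\<close>, exchanging the integrals and using the definition of the weak
  derivative for the translate by \<open>t h\<close> produces the right-hand side. The fundamental lemma turns this
  into an identity almost everywhere.
\<close>

lemma weak_deriv_difference:
  fixes h :: "'a::euclidean_space"
  assumes W: "weak_deriv U v H" and V: "open V"
    and seg: "\<And>x t. x \<in> V \<Longrightarrow> 0 \<le> t \<Longrightarrow> t \<le> 1 \<Longrightarrow> x + t *\<^sub>R h \<in> U"
  shows "AE x in lborel. x \<in> V \<longrightarrow>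
    v (x + h) - v x = (LINT t|lborel. indicator {0..1} t * (H (x + t *\<^sub>R h) \<bullet> h))"
proof -
  note WD = weak_derivD[OF W]
  note [measurable] = WD(3,4)
  have int_Hh: "integrable lborel (\<lambda>x. H x \<bullet> h)" using WD(2) by simp
  define F where "F x = (LINT t|lborel. indicator {0..1} t * (H (x + t *\<^sub>R h) \<bullet> h))" for x
  have int_Ht: "integrable lborel (\<lambda>x. H (x + t *\<^sub>R h) \<bullet> h)"
    and Ht: "(LINT x|lborel. \<bar>H (x + t *\<^sub>R h) \<bullet> h\<bar>) = (LINT x|lborel. \<bar>H x \<bullet> h\<bar>)" for t
    using integral_translate(2)[of "\<lambda>x. H x \<bullet> h" "t *\<^sub>R h"] int_Hh
      integral_translate(1)[of "\<lambda>x. \<bar>H x \<bullet> h\<bar>" "t *\<^sub>R h"] by simp_all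
  have int_slab: "integrable (lborel \<Otimes>\<^sub>M lborel) (\<lambda>(t, x). indicator {0..1} t * (H (x + t *\<^sub>R h) \<bullet> h))"
    by (rule integrable_slab[of _ "LINT x|lborel. \<bar>H x \<bullet> h\<bar>"])
       (use int_Ht Ht in \<open>auto simp: abs_mult\<close>)
  have int_F: "integrable lborel F"
    unfolding F_def by (rule lborel_pair.integrable_snd[OF int_slab])
  have int_v: "integrable lborel (\<lambda>x. v (x + h))" using WD(1) by (simp add: integral_translate(2))
  have "(LINT x|lborel. (v (x + h) - v x - F x) * \<psi> x) = 0" if \<psi>: "\<psi> \<in> test_fun V" for \<psi>
  proof -
    note m\<psi>[measurable] = test_fun_bounded(2)[OF \<psi>] grad_bounded(2)[OF \<psi>]
    obtain B where B: "\<And>x. \<bar>\<psi> x\<bar> \<le> B" using test_fun_bounded(3)[OF \<psi>] by blast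
    obtain B' where B': "\<And>x. norm (grad \<psi> x) \<le> B'" using grad_bounded(3)[OF \<psi>] by blast
    have "B \<ge> 0" using B[of 0] by linarith
    note int_mult\<psi> = integrable_bounded_mult[OF _ test_fun_bounded(2,3)[OF \<psi>]]
    have i1: "integrable lborel (\<lambda>x. \<psi> x * (H (x + t *\<^sub>R h) \<bullet> h))" for t
      using int_mult\<psi>[OF int_Ht[of t]] by simp
    have "(LINT x|lborel. \<bar>\<psi> x * (H (x + t *\<^sub>R h) \<bullet> h)\<bar>) \<le> B * (LINT x|lborel. \<bar>H x \<bullet> h\<bar>)" for t
    proof -
      have "(LINT x|lborel. \<bar>\<psi> x * (H (x + t *\<^sub>R h) \<bullet> h)\<bar>) \<le> (LINT x|lborel. B * \<bar>H (x + t *\<^sub>R h) \<bullet> h\<bar>)"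
        by (rule integral_mono)
           (use integrable_abs[OF i1] integrable_mult_right[OF integrable_abs[OF int_Ht]] B
             in \<open>auto simp only: abs_mult intro!: mult_right_mono abs_ge_zero\<close>)
      then show ?thesis by (simp add: Ht)
    qed
    then have slab1: "integrable (lborel \<Otimes>\<^sub>M lborel) (\<lambda>(t, x). indicator {0..1} t * (\<psi> x * (H (x + t *\<^sub>R h) \<bullet> h)))"
      by (intro integrable_slab[of _ "B * (LINT x|lborel. \<bar>H x \<bullet> h\<bar>)"])
         (use i1 in \<open>auto simp: abs_mult indicator_def\<close>)
    have bnd2: "\<bar>grad \<psi> x \<bullet> h\<bar> \<le> B' * norm h" for x
      using Cauchy_Schwarz_ineq2[of "grad \<psi> x" h] mult_right_mono[OF B'[of x], of "norm h"] by simp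
    have i2: "integrable lborel (\<lambda>x. v x * (grad \<psi> (x + - (t *\<^sub>R h)) \<bullet> h))" for t
      using integrable_bounded_mult[OF WD(1), of "\<lambda>x. grad \<psi> (x + - (t *\<^sub>R h)) \<bullet> h"] bnd2
      by (auto simp: mult.commute)
    have "(LINT x|lborel. \<bar>v x * (grad \<psi> (x + - (t *\<^sub>R h)) \<bullet> h)\<bar>) \<le> (LINT x|lborel. \<bar>v x\<bar>) * (B' * norm h)" for t
    proof -
      have "(LINT x|lborel. \<bar>v x * (grad \<psi> (x + - (t *\<^sub>R h)) \<bullet> h)\<bar>) \<le> (LINT x|lborel. \<bar>v x\<bar> * (B' * norm h))"
        by (rule integral_mono)
           (use integrable_abs[OF i2] integrable_mult_left[OF integrable_abs[OF WD(1)]] bnd2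
             in \<open>auto simp only: abs_mult intro!: mult_left_mono abs_ge_zero\<close>)
      then show ?thesis by simp
    qed
    then have slab2: "integrable (lborel \<Otimes>\<^sub>M lborel) (\<lambda>(t, x). indicator {0..1} t * (v x * (grad \<psi> (x + - (t *\<^sub>R h)) \<bullet> h)))"
      by (intro integrable_slab[of _ "(LINT x|lborel. \<bar>v x\<bar>) * (B' * norm h)"])
         (use i2 in \<open>auto simp: abs_mult indicator_def\<close>)
    have mid: "(LINT x|lborel. \<psi> x * (H (x + t *\<^sub>R h) \<bullet> h))
        = - (LINT x|lborel. v x * (grad \<psi> (x + - (t *\<^sub>R h)) \<bullet> h))" if t: "0 \<le> t" "t \<le> 1" for t
    proof -
      have W': "weak_deriv V (\<lambda>x. v (x + t *\<^sub>R h)) (\<lambda>x. H (x + t *\<^sub>R h))"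
        by (rule weak_deriv_translate[OF W seg]) (use t in auto)
      note WD' = weak_derivD[OF W']
      have "(LINT x|lborel. \<psi> x * (H (x + t *\<^sub>R h) \<bullet> h)) = (LINT x|lborel. \<psi> x *\<^sub>R H (x + t *\<^sub>R h)) \<bullet> h"
        using integral_inner_left[OF int_mult\<psi>[OF WD'(2)], of h] by simp
      also have "(LINT x|lborel. \<psi> x *\<^sub>R H (x + t *\<^sub>R h)) = - (LINT x|lborel. v (x + t *\<^sub>R h) *\<^sub>R grad \<psi> x)"
        using WD'(5)[OF \<psi>] by simp
      also have "(\<dots>) \<bullet> h = - (LINT x|lborel. v (x + t *\<^sub>R h) * (grad \<psi> x \<bullet> h))"
        using integral_inner_left[OF integrable_mult_bounded_vec[OF WD'(1) grad_bounded(2,3)[OF \<psi>]], of h]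
        by (simp add: inner_minus_left)
      also have "(LINT x|lborel. v (x + t *\<^sub>R h) * (grad \<psi> x \<bullet> h)) = (LINT x|lborel. v x * (grad \<psi> (x + - (t *\<^sub>R h)) \<bullet> h))"
        using integral_translate(1)[of "\<lambda>x. v x * (grad \<psi> (x + - (t *\<^sub>R h)) \<bullet> h)" "t *\<^sub>R h"] by simp
      finally show ?thesis .
    qed
    \<comment> \<open>the fundamental theorem of calculus along the segment from \<open>x\<close> to \<open>x - h\<close>\<close>
    have ftc: "(LINT t|lborel. indicator {0..1} t * (v x * (grad \<psi> (x + - (t *\<^sub>R h)) \<bullet> h)))
        = v x * (\<psi> x - \<psi> (x + - h))" for x
    proof -
      have der: "((\<lambda>t. - \<psi> (x + - (t *\<^sub>R h))) has_real_derivative grad \<psi> (x + - (t *\<^sub>R h)) \<bullet> h) (at t)" for t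
      proof -
        have "((\<lambda>t. x + - (t *\<^sub>R h)) has_derivative (\<lambda>s. - (s *\<^sub>R h))) (at t)"
          by (auto intro!: derivative_eq_intros)
        from has_derivative_compose[OF this test_fun_derivative[OF \<psi>]]
        have "((\<lambda>t. \<psi> (x + - (t *\<^sub>R h))) has_derivative (\<lambda>s. grad \<psi> (x + - (t *\<^sub>R h)) \<bullet> (- (s *\<^sub>R h)))) (at t)"
          by (simp only: grad_inner[OF \<psi>])
        from has_derivative_minus[OF this] show ?thesis
          by (simp add: has_field_derivative_def mult_commute_abs)
      qed
      have cont: "isCont (\<lambda>t. grad \<psi> (x + - (t *\<^sub>R h)) \<bullet> h) t" for t
        by (intro continuous_intros continuous_on_interior[of UNIV "grad \<psi>", THEN isCont_o2[rotated]])
           (use grad_bounded(1)[OF \<psi>] in auto)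
      have "(LINT t|lborel. (grad \<psi> (x + - (t *\<^sub>R h)) \<bullet> h) * indicator {0..1} t)
         = - \<psi> (x + - (1 *\<^sub>R h)) - - \<psi> (x + - (0 *\<^sub>R h))"
        by (rule integral_FTC_Icc_real[OF _ der cont]) simp
      then have "v x * (LINT t|lborel. (grad \<psi> (x + - (t *\<^sub>R h)) \<bullet> h) * indicator {0..1} t) = v x * (\<psi> x - \<psi> (x + - h))"
        by simp
      then show ?thesis
        by (subst (asm) integral_mult_right_zero[symmetric]) (simp add: ac_simps)
    qed
    have "(LINT x|lborel. F x * \<psi> x) = (LINT x|lborel. LINT t|lborel. indicator {0..1} t * (\<psi> x * (H (x + t *\<^sub>R h) \<bullet> h)))"
      unfolding F_def by (subst integral_mult_left_zero[symmetric]) (simp add: ac_simps)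
    also have "\<dots> = (LINT t|lborel. LINT x|lborel. indicator {0..1} t * (\<psi> x * (H (x + t *\<^sub>R h) \<bullet> h)))"
      by (rule lborel_pair.Fubini_integral[OF slab1])
    also have "\<dots> = (LINT t|lborel. - (LINT x|lborel. indicator {0..1} t * (v x * (grad \<psi> (x + - (t *\<^sub>R h)) \<bullet> h))))"
      by (rule Bochner_Integration.integral_cong) (use mid in \<open>auto simp: indicator_def\<close>)
    also have "\<dots> = - (LINT x|lborel. LINT t|lborel. indicator {0..1} t * (v x * (grad \<psi> (x + - (t *\<^sub>R h)) \<bullet> h)))"
      by (simp only: integral_minus lborel_pair.Fubini_integral[OF slab2])
    also have "\<dots> = - (LINT x|lborel. \<psi> x * v x - \<psi> (x + - h) * v x)"
      unfolding ftc by (simp add: algebra_simps)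
    also have "\<dots> = (LINT x|lborel. \<psi> (x + - h) * v x) - (LINT x|lborel. \<psi> x * v x)"
    proof -
      have "integrable lborel (\<lambda>x. \<psi> x * v x)" using int_mult\<psi>[OF WD(1)] by simp
      moreover have "integrable lborel (\<lambda>x. \<psi> (x + - h) * v x)"
        using integrable_bounded_mult[OF WD(1), of "\<lambda>x. \<psi> (x + - h)"] B by auto
      ultimately show ?thesis by simp
    qed
    also have "(LINT x|lborel. \<psi> (x + - h) * v x) = (LINT x|lborel. \<psi> x * v (x + h))"
      using integral_translate(1)[of "\<lambda>x. \<psi> (x + - h) * v x" h] by simp
    finally have eq: "(LINT x|lborel. \<psi> x * F x) = (LINT x|lborel. \<psi> x * v (x + h)) - (LINT x|lborel. \<psi> x * v x)"
      by (simp add: mult.commute)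
    have "(LINT x|lborel. (v (x + h) - v x - F x) * \<psi> x)
        = (LINT x|lborel. \<psi> x * v (x + h) - \<psi> x * v x - \<psi> x * F x)"
      by (simp add: algebra_simps)
    also have "\<dots> = (LINT x|lborel. \<psi> x * v (x + h)) - (LINT x|lborel. \<psi> x * v x) - (LINT x|lborel. \<psi> x * F x)"
      using int_mult\<psi>[OF WD(1)] int_mult\<psi>[OF int_v] int_mult\<psi>[OF int_F] by simp
    finally show ?thesis using eq by simp
  qed
  then have "AE x in lborel. x \<in> V \<longrightarrow> v (x + h) - v x - F x = 0"
    by (intro AE_eq_0_if_orthogonal_test_fun V)
       (use int_v int_F WD(1) in auto)
  then show ?thesis by eventually_elim (auto simp: F_def)
qed

text \<open>
  For \<open>y = |\<integral> F|\<close> the Young inequality gives \<open>|F(t)| * y powr (r - 1) \<le> |F(t)|\<^sup>r / r + y\<^sup>r / s\<close> with the conjugate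
  exponent \<open>s\<close>; integrating over the unit interval, the term \<open>y\<^sup>r / s\<close> can be absorbed on the left.
\<close>

lemma unit_interval_jensen:
  fixes F :: "real \<Rightarrow> real"
  assumes [measurable]: "F \<in> borel_measurable borel" and r: "1 < r"
  shows "ennreal (\<bar>LINT t|lborel. indicator {0..1} t * F t\<bar> powr r)
      \<le> (\<integral>\<^sup>+t. indicator {0..1} t * ennreal (\<bar>F t\<bar> powr r) \<partial>lborel)" (is "_ \<le> ?R")
proof -
  define y where "y = \<bar>LINT t|lborel. indicator {0..1} t * F t\<bar>"
  define s where "s = r / (r - 1)"
  have s: "s > 1" "1 / r + 1 / s = 1" using r by (auto simp: s_def field_simps)
  show ?thesis
  proof (cases "?R = \<infinity> \<or> y = 0")
    case False
    then have y: "y > 0" by (simp add: y_def)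
    have R: "?R = (\<integral>\<^sup>+t. ennreal (indicator {0..1} t * \<bar>F t\<bar> powr r) \<partial>lborel)"
      by (intro nn_integral_cong) (auto simp: indicator_def)
    have int: "integrable lborel (\<lambda>t. indicator {0..1} t * \<bar>F t\<bar> powr r)"
      by (rule integrableI_bounded) (use False R in \<open>auto simp: top.not_eq_extremum\<close>)
    have "integrable lborel (\<lambda>t. indicator {0..1} t * F t)"
      using y not_integrable_integral_eq unfolding y_def by fastforce
    then have intF: "integrable lborel (\<lambda>t. indicator {0..1} t * \<bar>F t\<bar>)"
      by (drule_tac integrable_abs) (simp add: abs_mult)
    have "y \<le> (LINT t|lborel. indicator {0..1} t * \<bar>F t\<bar>)"
      unfolding y_def by (rule order_trans[OF integral_abs_bound]) (simp add: abs_mult)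
    then have "y powr r \<le> (LINT t|lborel. indicator {0..1} t * \<bar>F t\<bar>) * y powr (r - 1)"
      using y mult_right_mono[of y _ "y powr (r - 1)"] by (simp add: powr_mult_base)
    also have "\<dots> = (LINT t|lborel. indicator {0..1} t * (\<bar>F t\<bar> * y powr (r - 1)))"
      by (subst integral_mult_left_zero[symmetric]) (simp add: mult.assoc)
    also have "\<dots> \<le> (LINT t|lborel. (indicator {0..1} t * \<bar>F t\<bar> powr r) / r + indicator {0..1} t * (y powr r / s))"
    proof (rule integral_mono)
      show "integrable lborel (\<lambda>t. indicator {0..1} t * (\<bar>F t\<bar> * y powr (r - 1)))"
        using integrable_mult_left[OF intF, of "y powr (r - 1)"] by (simp add: mult.assoc)
      show "integrable lborel (\<lambda>t. (indicator {0..1} t * \<bar>F t\<bar> powr r) / r + indicator {0..1} t * (y powr r / s))"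
        using int by (intro Bochner_Integration.integrable_add integrable_divide integrable_mult_left integrable_real_indicator) auto
      fix t
      have "(y powr (r - 1)) powr s = y powr r" using r by (simp add: powr_powr s_def)
      then have "\<bar>F t\<bar> * y powr (r - 1) \<le> \<bar>F t\<bar> powr r / r + y powr r / s"
        using Youngs_inequality[OF r s, of "\<bar>F t\<bar>" "y powr (r - 1)"] by simp
      then show "indicator {0..1} t * (\<bar>F t\<bar> * y powr (r - 1))
         \<le> (indicator {0..1} t * \<bar>F t\<bar> powr r) / r + indicator {0..1} t * (y powr r / s)"
        by (auto simp: indicator_def)
    qed
    also have "\<dots> = (LINT t|lborel. indicator {0..1} t * \<bar>F t\<bar> powr r) / r + y powr r / s"
      using int by (subst Bochner_Integration.integral_add) (auto intro!: integrable_mult_left integrable_real_indicator)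
    finally have "y powr r * (1 - 1 / s) \<le> (LINT t|lborel. indicator {0..1} t * \<bar>F t\<bar> powr r) / r"
      by (simp add: algebra_simps)
    moreover have "1 - 1 / s = 1 / r" using s by linarith
    ultimately have "y powr r \<le> (LINT t|lborel. indicator {0..1} t * \<bar>F t\<bar> powr r)"
      using r by (simp add: field_simps)
    then show ?thesis
      unfolding R y_def[symmetric] using int
      by (subst nn_integral_eq_integral) (auto intro: ennreal_leI)
  qed (auto simp: y_def)
qed

text \<open>
  A difference quotient of \<open>v\<close> in direction \<open>h\<close> is an average of translates of the weak derivative, hence
  no larger in \<open>L\<^sup>r\<close>.
\<close>

lemma weak_deriv_difference_bound:
  fixes h :: "'a::euclidean_space"
  assumes W: "weak_deriv U v H" and V: "open V"
    and seg: "\<And>x t. x \<in> V \<Longrightarrow> 0 \<le> t \<Longrightarrow> t \<le> 1 \<Longrightarrow> x + t *\<^sub>R h \<in> U" and r: "1 < r"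
  shows "(\<integral>\<^sup>+x\<in>V. ennreal (\<bar>v (x + h) - v x\<bar> powr r) \<partial>lborel)
     \<le> ennreal (norm h powr r) * (\<integral>\<^sup>+x. ennreal (norm (H x) powr r) \<partial>lborel)"
proof -
  note WD = weak_derivD[OF W]
  note [measurable] = WD(3,4)
  have [measurable]: "V \<in> sets borel" using V by auto
  have ae: "AE x in lborel. x \<in> V \<longrightarrow>
      v (x + h) - v x = (LINT t|lborel. indicator {0..1} t * (H (x + t *\<^sub>R h) \<bullet> h))"
    by (rule weak_deriv_difference[OF W V seg])
  have "(\<integral>\<^sup>+x\<in>V. ennreal (\<bar>v (x + h) - v x\<bar> powr r) \<partial>lborel)
     \<le> (\<integral>\<^sup>+x. (\<integral>\<^sup>+t. indicator {0..1} t * (ennreal (norm h powr r) * ennreal (norm (H (x + t *\<^sub>R h)) powr r)) \<partial>lborel) \<partial>lborel)"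
  proof (rule nn_integral_mono_AE)
    show "AE x in lborel. ennreal (\<bar>v (x + h) - v x\<bar> powr r) * indicator V x
       \<le> (\<integral>\<^sup>+t. indicator {0..1} t * (ennreal (norm h powr r) * ennreal (norm (H (x + t *\<^sub>R h)) powr r)) \<partial>lborel)"
      using ae
    proof eventually_elim
      case (elim x)
      show ?case
      proof (cases "x \<in> V")
        case True
        have "ennreal (\<bar>v (x + h) - v x\<bar> powr r)
            \<le> (\<integral>\<^sup>+t. indicator {0..1} t * ennreal (\<bar>H (x + t *\<^sub>R h) \<bullet> h\<bar> powr r) \<partial>lborel)"
          using elim True unit_interval_jensen[OF _ r, of "\<lambda>t. H (x + t *\<^sub>R h) \<bullet> h"] by simp
        also have "\<dots> \<le> (\<integral>\<^sup>+t. indicator {0..1} t * (ennreal (norm h powr r) * ennreal (norm (H (x + t *\<^sub>R h)) powr r)) \<partial>lborel)"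
        proof (intro nn_integral_mono mult_left_mono)
          fix t
          have "\<bar>H (x + t *\<^sub>R h) \<bullet> h\<bar> powr r \<le> (norm (H (x + t *\<^sub>R h)) * norm h) powr r"
            using r Cauchy_Schwarz_ineq2 by (intro powr_mono2) auto
          also have "\<dots> = norm h powr r * norm (H (x + t *\<^sub>R h)) powr r"
            by (simp add: powr_mult mult.commute)
          finally show "ennreal (\<bar>H (x + t *\<^sub>R h) \<bullet> h\<bar> powr r)
              \<le> ennreal (norm h powr r) * ennreal (norm (H (x + t *\<^sub>R h)) powr r)"
            by (simp flip: ennreal_mult add: ennreal_leI)
        qed simp
        finally show ?thesis using True by simp
      qed simp
    qed
  qed
  also have "\<dots> = (\<integral>\<^sup>+t. (\<integral>\<^sup>+x. indicator {0..1} t * (ennreal (norm h powr r) * ennreal (norm (H (x + t *\<^sub>R h)) powr r)) \<partial>lborel) \<partial>lborel)"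
    by (rule lborel_pair.Fubini'[symmetric]) measurable
  also have "\<dots> = (\<integral>\<^sup>+t. indicator {0..1::real} t * (ennreal (norm h powr r) * (\<integral>\<^sup>+x. ennreal (norm (H x) powr r) \<partial>lborel)) \<partial>lborel)"
    by (intro nn_integral_cong)
       (simp add: nn_integral_cmult nn_integral_translate[of "\<lambda>x. ennreal (norm (H x) powr r)"])
  also have "\<dots> = ennreal (norm h powr r) * (\<integral>\<^sup>+x. ennreal (norm (H x) powr r) \<partial>lborel)"
    by (subst nn_integral_multc) (auto simp: nn_integral_indicator)
  finally show ?thesis .
qed

section \<open>Monotonicity of the flux\<close>

lemma norm_flux: "norm (flux q \<xi>) = max (norm \<xi> - 1) 0 powr (q - 1)"
  by (cases "\<xi> = 0") (auto simp: flux_def)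

lemma flux_measurable[measurable]: "flux q \<in> borel_measurable borel"
  unfolding flux_def[abs_def] by measurable

text \<open>
  The nearest-point projection onto the closed unit ball.
\<close>

definition ball_proj :: "'a::euclidean_space \<Rightarrow> 'a" where
  "ball_proj \<xi> = (1 / max 1 (norm \<xi>)) *\<^sub>R \<xi>"

lemma norm_ball_proj: "norm (ball_proj \<xi>) \<le> 1"
  by (auto simp: ball_proj_def max_def)

lemma flux_ball_proj: "flux q \<xi> \<bullet> ball_proj \<xi> = norm (flux q \<xi>)"
proof (cases "norm \<xi> \<le> 1")
  case False
  then have "\<xi> \<noteq> 0" by auto
  with False show ?thesis
    by (simp add: norm_flux) (simp add: flux_def ball_proj_def max_def dot_square_norm power2_eq_square)
qed (simp add: flux_def max_def)

text \<open>
  The flux vanishes on the unit ball and outside of it points in the direction of the projection,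
  so \<open>ball_proj x\<close> maximises the inner product with \<open>flux q x\<close> over the unit ball.
\<close>

lemma flux_ball_proj_monotone:
  "(flux q x - flux q y) \<bullet> (ball_proj x - ball_proj y) \<ge> 0"
proof -
  have *: "flux q x \<bullet> ball_proj y \<le> norm (flux q x)" for x y :: 'a
    using norm_cauchy_schwarz[of "flux q x" "ball_proj y"]
      mult_left_mono[OF norm_ball_proj[of y], of "norm (flux q x)"] by simp
  show ?thesis
    using *[of x y] *[of y x] by (simp add: inner_diff_left inner_diff_right flux_ball_proj)
qed

text \<open>
  The flux is inverted by the map \<open>a \<mapsto> |a| powr (p - 2) *\<^sub>R a\<close> up to the part of the argument in the unit ball,
  which the degenerate equation does not see.
\<close>

lemma flux_decomposition:
  assumes q: "1 < q" and p: "p = q / (q - 1)"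
  shows "\<xi> = norm (flux q \<xi>) powr (p - 2) *\<^sub>R flux q \<xi> + ball_proj \<xi>"
proof (cases "norm \<xi> \<le> 1")
  case False
  define m where "m = norm \<xi> - 1"
  have m: "m > 0" "norm \<xi> = m + 1" using False by (auto simp: m_def)
  have "(q - 1) * (p - 2) + (q - 1) = 1" using q by (simp add: p field_simps)
  then have "(m powr (q - 1)) powr (p - 2) * m powr (q - 1) = m powr 1"
    by (simp only: powr_powr powr_add[symmetric])
  then have e: "(m powr (q - 1)) powr (p - 2) * m powr (q - 1) = m" using m by simp
  have "norm (flux q \<xi>) powr (p - 2) *\<^sub>R flux q \<xi> + ball_proj \<xi> = (m / (m + 1) + 1 / (m + 1)) *\<^sub>R \<xi>"
    using m e by (simp add: norm_flux) (simp add: flux_def ball_proj_def scaleR_add_left)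
  also have "m / (m + 1) + 1 / (m + 1) = 1" using m by (simp add: field_simps)
  finally show ?thesis by simp
qed (simp add: flux_def ball_proj_def max_def)

text \<open>
  Expanding the inner product shows that twice the right-hand side equals
  \<open>(|a| powr (p - 2) + |b| powr (p - 2)) * |a - b|\<^sup>2\<close> plus a product of two differences of equal sign, and
  \<open>|a - b| \<le> 2 max |a| |b|\<close>.
\<close>

lemma power_map_monotone:
  fixes a b :: "'a::real_inner"
  assumes p: "2 \<le> p"
  shows "2 powr (1 - p) * norm (a - b) powr p
     \<le> (a - b) \<bullet> (norm a powr (p - 2) *\<^sub>R a - norm b powr (p - 2) *\<^sub>R b)"
proof -
  define \<alpha> \<beta> where "\<alpha> = norm a powr (p - 2)" and "\<beta> = norm b powr (p - 2)"
  define M where "M = max (norm a) (norm b)"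
  have "0 \<le> (\<alpha> - \<beta>) * ((norm a)\<^sup>2 - (norm b)\<^sup>2)"
  proof (cases "norm a \<le> norm b")
    case True
    then have "\<alpha> \<le> \<beta>" "(norm a)\<^sup>2 \<le> (norm b)\<^sup>2"
      using p unfolding \<alpha>_def \<beta>_def by (auto intro!: powr_mono2 power_mono)
    then show ?thesis by (intro mult_nonpos_nonpos) auto
  next
    case False
    then have "\<beta> \<le> \<alpha>" "(norm b)\<^sup>2 \<le> (norm a)\<^sup>2"
      using p unfolding \<alpha>_def \<beta>_def by (auto intro!: powr_mono2 power_mono)
    then show ?thesis by (intro mult_nonneg_nonneg) auto
  qed
  moreover have "2 * ((a - b) \<bullet> (\<alpha> *\<^sub>R a - \<beta> *\<^sub>R b))
     = (\<alpha> + \<beta>) * (norm (a - b))\<^sup>2 + (\<alpha> - \<beta>) * ((norm a)\<^sup>2 - (norm b)\<^sup>2)"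
    by (simp add: power2_norm_eq_inner inner_diff inner_commute algebra_simps)
  ultimately have 1: "(\<alpha> + \<beta>) * (norm (a - b))\<^sup>2 \<le> 2 * ((a - b) \<bullet> (\<alpha> *\<^sub>R a - \<beta> *\<^sub>R b))" by simp
  have "norm (a - b) \<le> 2 * M"
    using norm_triangle_ineq4[of a b] by (auto simp: M_def)
  then have "norm (a - b) powr (p - 2) \<le> (2 * M) powr (p - 2)" using p by (intro powr_mono2) auto
  also have "\<dots> = 2 powr (p - 2) * M powr (p - 2)"
    by (simp add: powr_mult)
  also have "M powr (p - 2) \<le> \<alpha> + \<beta>" by (auto simp: M_def \<alpha>_def \<beta>_def max_def)
  finally have 0: "norm (a - b) powr (p - 2) \<le> 2 powr (p - 2) * (\<alpha> + \<beta>)" by simp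
  have 2: "norm (a - b) powr (p - 2) * (norm (a - b))\<^sup>2 \<le> 2 powr (p - 2) * ((\<alpha> + \<beta>) * (norm (a - b))\<^sup>2)"
    using mult_right_mono[OF 0, of "(norm (a - b))\<^sup>2"] by (simp add: mult.assoc)
  have 3: "norm (a - b) powr (p - 2) * (norm (a - b))\<^sup>2 = norm (a - b) powr p"
  proof (cases "a = b")
    case False
    then show ?thesis by (simp add: powr_diff powr_realpow)
  qed simp
  have "2 powr (1 - p) * norm (a - b) powr p \<le> 2 powr (1 - p) * (2 powr (p - 2) * ((\<alpha> + \<beta>) * (norm (a - b))\<^sup>2))"
    using 2 unfolding 3 by (intro mult_left_mono) auto
  also have "\<dots> = (\<alpha> + \<beta>) * (norm (a - b))\<^sup>2 / 2"
    using powr_add[of 2 "1 - p" "p - 2"] by (simp add: powr_minus_divide)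
  also have "\<dots> \<le> (a - b) \<bullet> (\<alpha> *\<^sub>R a - \<beta> *\<^sub>R b)" using 1 by simp
  finally show ?thesis by (simp add: \<alpha>_def \<beta>_def)
qed

text \<open>
  The ellipticity that survives the degeneracy. It controls the increment of the flux itself, not that
  of the gradient, with the power \<open>p > 2\<close>: expressing the arguments through
  \<open>flux_decomposition\<close>, the ball parts contribute a nonnegative term and the rest is
  \<open>power_map_monotone\<close> applied to the values of the flux.
\<close>

lemma flux_monotone:
  assumes q: "1 < q" "q < 2" and p: "p = q / (q - 1)"
  shows "2 powr (1 - p) * norm (flux q x - flux q y) powr p \<le> (flux q x - flux q y) \<bullet> (x - y)"
proof -
  have p2: "2 \<le> p" using q by (simp add: p field_simps)
  let ?J = "\<lambda>x. norm (flux q x) powr (p - 2) *\<^sub>R flux q x"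
  have "x - y = (?J x - ?J y) + (ball_proj x - ball_proj y)"
    using flux_decomposition[OF q(1) p, of x] flux_decomposition[OF q(1) p, of y]
    by (metis add_diff_add)
  then have "(flux q x - flux q y) \<bullet> (x - y)
     = (flux q x - flux q y) \<bullet> (?J x - ?J y) + (flux q x - flux q y) \<bullet> (ball_proj x - ball_proj y)"
    by (metis inner_add_right)
  then show ?thesis
    using power_map_monotone[OF p2, of "flux q x" "flux q y"] flux_ball_proj_monotone[of q x y] by linarith
qed

section \<open>Integrability from fractional difference quotients\<close>

text \<open>
  Local difference quotients of fractional order \<open>\<gamma> / p\<close> in \<open>L\<^sup>p\<close>. The exponent \<open>\<gamma>\<close> is that of the
  \<open>p\<close>-th power of the norm because \<open>\<gamma>\<close>, and not \<open>\<gamma> / p\<close>, enters the embedding exponent.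
\<close>

definition frac_diff :: "real \<Rightarrow> real \<Rightarrow> 'a::euclidean_space set \<Rightarrow> ('a \<Rightarrow> real) \<Rightarrow> bool" where
  "frac_diff p \<gamma> \<Omega> w \<longleftrightarrow> (\<forall>K. compact K \<longrightarrow> K \<subseteq> \<Omega> \<longrightarrow> (\<exists>C\<ge>0. \<exists>d>0. \<forall>h. norm h < d \<longrightarrow>
      (\<integral>\<^sup>+x\<in>K. ennreal (\<bar>w (x + h) - w x\<bar> powr p) \<partial>lborel) \<le> ennreal (C * norm h powr \<gamma>)))"

text \<open>
  A local weak-type bound. Only large levels matter, as superlevel sets in compact sets have
  finite measure.
\<close>

definition weak_Lp_loc :: "real \<Rightarrow> 'a::euclidean_space set \<Rightarrow> ('a \<Rightarrow> real) \<Rightarrow> bool" where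
  "weak_Lp_loc t \<Omega> w \<longleftrightarrow> (\<forall>K. compact K \<and> K \<subseteq> \<Omega> \<longrightarrow>
     (\<exists>C\<ge>0. \<forall>\<^sub>F l in at_top. emeasure lborel {x\<in>K. l < w x} \<le> ennreal (C * l powr (- t))))"

text \<open>
  If \<open>w(x) > l\<close> while \<open>w \<le> l/2\<close> on at least half of the ball of radius \<open>\<rho>\<close> around \<open>x\<close>, then the
  increments of \<open>w\<close> at \<open>x\<close> exceed \<open>l/2\<close> on half of that ball. Integrating over all such \<open>x\<close> and
  exchanging the integrals bounds the measure of the superlevel set by the integrated increments.
\<close>

lemma superlevel_measure_le:
  fixes w :: "'a::euclidean_space \<Rightarrow> real"
  assumes [measurable]: "w \<in> borel_measurable borel"
    and K: "compact K" and K': "compact K'" and nbhd: "\<And>x y. x \<in> K \<Longrightarrow> norm y < \<rho> \<Longrightarrow> x + y \<in> K'"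
    and \<rho>: "0 < \<rho>" and l: "0 < l" and p: "0 < p"
    and diff: "\<And>h. norm h < \<rho> \<Longrightarrow> (\<integral>\<^sup>+x\<in>K. ennreal (\<bar>w (x + h) - w x\<bar> powr p) \<partial>lborel) \<le> ennreal D"
    and D: "D \<ge> 0"
    and half: "2 * emeasure lborel {x\<in>K'. l / 2 < w x} \<le> emeasure lborel (ball (0::'a) \<rho>)"
  shows "emeasure lborel {x\<in>K. l < w x} \<le> ennreal (2 * D * (l / 2) powr (- p))"
proof -
  have [measurable]: "K \<in> sets borel" "K' \<in> sets borel" using K K' by (simp_all add: compact_imp_closed)
  let ?B = "ball (0::'a) \<rho>"
  have B: "?B \<in> sets borel" by simp
  have [measurable]: "(indicator ?B :: 'a \<Rightarrow> ennreal) \<in> borel_measurable borel"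
    "(indicator K :: 'a \<Rightarrow> ennreal) \<in> borel_measurable borel"
    by (rule borel_measurable_indicator, simp)+
  define E where "E = {x\<in>K. l < w x}"
  have [measurable]: "E \<in> sets borel" unfolding E_def by measurable
  define b where "b = unit_ball_vol (real DIM('a)) * \<rho> ^ DIM('a)"
  have b: "emeasure lborel ?B = ennreal b" "b > 0"
    using \<rho> by (auto simp: emeasure_ball b_def)
  define c where "c = (l / 2) powr p"
  have c: "c > 0" using l by (simp add: c_def)
  have inner: "ennreal (c * (b / 2)) \<le> (\<integral>\<^sup>+y\<in>?B. ennreal (\<bar>w (x + y) - w x\<bar> powr p) \<partial>lborel)" if x: "x \<in> E" for x
  proof -
    let ?S = "{y\<in>?B. l / 2 < w (x + y)}"
    have [measurable]: "?S \<in> sets borel" by measurable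
    have "emeasure lborel ?S = (\<integral>\<^sup>+y. indicator ?S y \<partial>lborel)" by simp
    also have "\<dots> \<le> (\<integral>\<^sup>+y. indicator {x\<in>K'. l / 2 < w x} (y + x) \<partial>lborel)"
      using x nbhd[of x] by (intro nn_integral_mono) (auto simp: indicator_def E_def add.commute[of _ x])
    also have "\<dots> = emeasure lborel {x\<in>K'. l / 2 < w x}"
      by (subst nn_integral_translate) auto
    finally have "2 * emeasure lborel ?S \<le> ennreal b" using half b(1)
      by (metis (no_types, lifting) mult_left_mono order_trans zero_le)
    then have S: "emeasure lborel ?S \<le> ennreal (b / 2)"
      using b(2) by (cases "emeasure lborel ?S" rule: ennreal_cases)
        (auto simp: ennreal_numeral[symmetric] ennreal_mult[symmetric] ennreal_mult_top top_unique simp del: ennreal_numeral)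
    have "ennreal (b / 2) \<le> emeasure lborel (?B - ?S)"
    proof -
      have "emeasure lborel (?B - ?S) = ennreal b - emeasure lborel ?S"
        using S by (subst emeasure_Diff) (auto simp: b(1) top_unique)
      moreover have "ennreal b - emeasure lborel ?S \<ge> ennreal b - ennreal (b / 2)"
        by (rule ennreal_mono_minus[OF S])
      moreover have "ennreal b - ennreal (b / 2) = ennreal (b / 2)"
        using b(2) by (subst ennreal_minus) auto
      ultimately show ?thesis by simp
    qed
    then have "ennreal c * ennreal (b / 2) \<le> ennreal c * emeasure lborel (?B - ?S)"
      by (intro mult_left_mono) auto
    also have "\<dots> = (\<integral>\<^sup>+y. ennreal c * indicator (?B - ?S) y \<partial>lborel)"
      by (subst nn_integral_cmult_indicator) auto
    also have "\<dots> \<le> (\<integral>\<^sup>+y\<in>?B. ennreal (\<bar>w (x + y) - w x\<bar> powr p) \<partial>lborel)"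
    proof (rule nn_integral_mono)
      fix y
      have "c \<le> \<bar>w (x + y) - w x\<bar> powr p" if "y \<in> ?B - ?S"
        unfolding c_def using that x l p by (intro powr_mono2) (auto simp: E_def)
      then show "ennreal c * indicator (?B - ?S) y \<le> ennreal (\<bar>w (x + y) - w x\<bar> powr p) * indicator ?B y"
        by (auto simp: indicator_def intro!: ennreal_leI)
    qed
    finally show ?thesis using c b by (simp add: ennreal_mult[symmetric])
  qed
  have "ennreal (c * (b / 2)) * emeasure lborel E = (\<integral>\<^sup>+x. ennreal (c * (b / 2)) * indicator E x \<partial>lborel)"
    by (subst nn_integral_cmult_indicator) auto
  also have "\<dots> \<le> (\<integral>\<^sup>+x. (\<integral>\<^sup>+y. ennreal (\<bar>w (x + y) - w x\<bar> powr p) * indicator ?B y * indicator K x \<partial>lborel) \<partial>lborel)"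
  proof (rule nn_integral_mono)
    fix x
    show "ennreal (c * (b / 2)) * indicator E x
      \<le> (\<integral>\<^sup>+y. ennreal (\<bar>w (x + y) - w x\<bar> powr p) * indicator ?B y * indicator K x \<partial>lborel)"
      using inner[of x] by (auto simp: indicator_def E_def)
  qed
  also have "\<dots> = (\<integral>\<^sup>+y. (\<integral>\<^sup>+x. ennreal (\<bar>w (x + y) - w x\<bar> powr p) * indicator ?B y * indicator K x \<partial>lborel) \<partial>lborel)"
    by (rule lborel_pair.Fubini'[symmetric]) measurable
  also have "\<dots> \<le> (\<integral>\<^sup>+y. ennreal D * indicator ?B y \<partial>lborel)"
  proof (rule nn_integral_mono)
    fix y :: 'a
    show "(\<integral>\<^sup>+x. ennreal (\<bar>w (x + y) - w x\<bar> powr p) * indicator ?B y * indicator K x \<partial>lborel) \<le> ennreal D * indicator ?B y"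
      using diff[of y] by (auto simp: indicator_def)
  qed
  also have "\<dots> = ennreal (D * b)"
    using D b by (subst nn_integral_cmult_indicator) (auto simp: ennreal_mult)
  finally have *: "ennreal (c * (b / 2)) * emeasure lborel E \<le> ennreal (D * b)" .
  have "emeasure lborel E \<le> ennreal (2 * D / c)"
  proof (cases "emeasure lborel E" rule: ennreal_cases)
    case (real r)
    then have "c * (b / 2) * r \<le> D * b" using * b c D by (simp flip: ennreal_mult)
    then have "r \<le> 2 * D / c" using b c by (simp add: field_simps)
    then show ?thesis using real by (simp add: ennreal_leI)
  next
    case top
    then show ?thesis using * b c by (simp add: ennreal_mult_top top_unique)
  qed
  also have "2 * D / c = 2 * D * (l / 2) powr (- p)" by (simp add: c_def powr_minus field_simps)
  finally show ?thesis by (simp add: E_def)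
qed

text \<open>
  A weak-type bound of exponent \<open>t\<close> makes the hypothesis of \<open>superlevel_measure_le\<close> true as soon as
  \<open>\<rho> ^ n\<close> is a large multiple of \<open>l powr (- t)\<close>. With this radius the increments are of size
  \<open>\<rho> powr \<gamma>\<close>, a multiple of \<open>l powr (- t * \<gamma> / n)\<close>, which is the gain in the exponent.
\<close>

lemma weak_Lp_loc_improve:
  fixes w :: "'a::euclidean_space \<Rightarrow> real"
  assumes \<Omega>: "open \<Omega>" and w: "w \<in> borel_measurable borel" and p: "0 < p" and \<gamma>: "0 < \<gamma>" and t: "0 < t"
    and diff: "frac_diff p \<gamma> \<Omega> w"
    and weak: "weak_Lp_loc t \<Omega> w"
  shows "weak_Lp_loc (p + t * \<gamma> / DIM('a)) \<Omega> w"
  unfolding weak_Lp_loc_def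
proof (intro allI impI, elim conjE)
  fix K assume K: "compact K" "K \<subseteq> \<Omega>"
  define n where "n = real DIM('a)"
  have n: "n > 0" by (simp add: n_def)
  show "\<exists>C\<ge>0. \<forall>\<^sub>F l in at_top. emeasure lborel {x\<in>K. l < w x} \<le> ennreal (C * l powr (- (p + t * \<gamma> / DIM('a))))"
  proof (cases "K = {}")
    case False
    obtain e where e: "e > 0" "{x. infdist x K \<le> e} \<subseteq> \<Omega>"
      by (rule compact_in_open_separated[OF False K(1) \<Omega> K(2)])
    define K' where "K' = {x. infdist x K \<le> e}"
    have K': "compact K'" "K' \<subseteq> \<Omega>"
      using compact_infdist_le[OF False K(1) e(1)] e by (auto simp: K'_def)
    obtain C d where C: "C \<ge> 0" "d > 0"
      and Cd: "\<And>h. norm h < d \<Longrightarrow> (\<integral>\<^sup>+x\<in>K. ennreal (\<bar>w (x + h) - w x\<bar> powr p) \<partial>lborel) \<le> ennreal (C * norm h powr \<gamma>)"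
      using diff[unfolded frac_diff_def, rule_format, OF K] by blast
    obtain C' where C': "C' \<ge> 0" "\<forall>\<^sub>F l in at_top. emeasure lborel {x\<in>K'. l < w x} \<le> ennreal (C' * l powr (- t))"
      using weak[unfolded weak_Lp_loc_def, rule_format, OF conjI[OF K']] by blast
    define b where "b = unit_ball_vol n"
    have b: "b > 0" by (simp add: b_def n_def)
    \<comment> \<open>\<open>A\<close> is chosen such that the ball of radius \<open>\<rho> l\<close> has at least twice the measure of
       \<open>{w > l / 2}\<close>; \<open>C' + 1\<close> instead of \<open>C'\<close> keeps the radius positive\<close>
    define A where "A = 2 * (C' + 1) * 2 powr t / b"
    have A: "A > 0" using C' b by (simp add: A_def)
    define \<rho> where "\<rho> l = A powr (1 / n) * l powr (- (t / n))" for l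
    have "((\<lambda>l. l powr (- (t / n))) \<longlongrightarrow> 0) at_top"
      using t n by (intro tendsto_neg_powr filterlim_ident) simp
    then have "(\<rho> \<longlongrightarrow> 0) at_top"
      unfolding \<rho>_def[abs_def] by (rule tendsto_mult_right_zero)
    then have ev1: "\<forall>\<^sub>F l in at_top. \<rho> l < min d e"
      by (rule order_tendstoD) (use C e in simp)
    obtain l0 where l0: "\<And>l. l \<ge> l0 \<Longrightarrow> emeasure lborel {x\<in>K'. l < w x} \<le> ennreal (C' * l powr (- t))"
      using C'(2) unfolding eventually_at_top_linorder by blast
    have ev2: "\<forall>\<^sub>F l in at_top. emeasure lborel {x\<in>K'. l / 2 < w x} \<le> ennreal (C' * (l / 2) powr (- t))"
      using eventually_ge_at_top[of "2 * l0"] by eventually_elim (rule l0, simp)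
    let ?C = "2 * C * A powr (\<gamma> / n) * 2 powr p"
    have "\<forall>\<^sub>F l in at_top. emeasure lborel {x\<in>K. l < w x} \<le> ennreal (?C * l powr (- (p + t * \<gamma> / DIM('a))))"
      using ev1 ev2 eventually_gt_at_top[of 0]
    proof eventually_elim
      case (elim l)
      have \<rho>: "\<rho> l > 0" using A elim by (simp add: \<rho>_def)
      have \<rho>n: "\<rho> l ^ DIM('a) = A * l powr (- t)"
        using A n powr_realpow[OF \<rho>, of "DIM('a)"] by (simp add: \<rho>_def powr_mult powr_powr n_def)
      have "emeasure lborel {x\<in>K. l < w x} \<le> ennreal (2 * (C * \<rho> l powr \<gamma>) * (l / 2) powr (- p))"
      proof (rule superlevel_measure_le[OF w K(1) K'(1) _ \<rho> elim(3) p])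
        show "x + y \<in> K'" if "x \<in> K" "norm y < \<rho> l" for x y
          using that elim(1) infdist_le[OF that(1), of "x + y"] by (simp add: K'_def dist_norm)
        show "(\<integral>\<^sup>+x\<in>K. ennreal (\<bar>w (x + h) - w x\<bar> powr p) \<partial>lborel) \<le> ennreal (C * \<rho> l powr \<gamma>)"
          if "norm h < \<rho> l" for h
        proof (rule order_trans[OF Cd])
          show "norm h < d" using that elim(1) by simp
          show "ennreal (C * norm h powr \<gamma>) \<le> ennreal (C * \<rho> l powr \<gamma>)"
            using that C \<gamma> by (intro ennreal_leI mult_left_mono powr_mono2) auto
        qed
        have "2 * emeasure lborel {x\<in>K'. l / 2 < w x} \<le> 2 * ennreal (C' * (l / 2) powr (- t))"
          using elim(2) by (rule mult_left_mono) simp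
        also have "\<dots> = ennreal (2 * (C' * (l / 2) powr (- t)))"
          using C' by (subst ennreal_mult) auto
        also have "\<dots> \<le> ennreal (b * (A * l powr (- t)))"
        proof (rule ennreal_leI)
          have "b * (A * l powr (- t)) = 2 * ((C' + 1) * (l / 2) powr (- t))"
            using b elim(3) by (simp add: A_def powr_divide powr_minus_divide)
          then show "2 * (C' * (l / 2) powr (- t)) \<le> b * (A * l powr (- t))"
            by (simp add: mult_right_mono)
        qed
        also have "\<dots> = emeasure lborel (ball (0::'a) (\<rho> l))"
          using \<rho> by (simp add: emeasure_ball \<rho>n b_def n_def)
        finally show "2 * emeasure lborel {x\<in>K'. l / 2 < w x} \<le> emeasure lborel (ball (0::'a) (\<rho> l))" .
      qed (use C in auto)
      also have "2 * (C * \<rho> l powr \<gamma>) * (l / 2) powr (- p) = ?C * l powr (- (p + t * \<gamma> / DIM('a)))"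
      proof -
        have "\<rho> l powr \<gamma> = A powr (\<gamma> / n) * l powr (- (t * \<gamma> / n))"
          using A elim(3) by (simp add: \<rho>_def powr_mult powr_powr)
        moreover have "(l / 2) powr (- p) = l powr (- p) * 2 powr p"
          using elim(3) by (simp add: powr_divide powr_minus field_simps)
        moreover have "l powr (- (p + t * \<gamma> / DIM('a))) = l powr (- p) * l powr (- (t * \<gamma> / n))"
          unfolding n_def powr_add[symmetric] by simp
        ultimately show ?thesis by simp
      qed
      finally show ?case .
    qed
    then show ?thesis using C by (intro exI[of _ ?C]) auto
  qed (auto intro!: exI[of _ 0])
qed

text \<open>
  A dyadic decomposition of the range of \<open>w\<close>: the contribution of the levels between \<open>a * 2 ^ k\<close> and
  \<open>a * 2 ^ (k + 1)\<close> is at most a multiple of \<open>2 powr (k * (s - t))\<close>.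
\<close>

lemma weak_Lp_loc_imp_nn_integral:
  fixes w :: "'a::euclidean_space \<Rightarrow> real"
  assumes w[measurable]: "w \<in> borel_measurable borel" and nn: "\<And>x. 0 \<le> w x"
    and weak: "weak_Lp_loc t \<Omega> w" and s: "0 < s" "s < t" and K: "compact K" "K \<subseteq> \<Omega>"
  shows "(\<integral>\<^sup>+x\<in>K. ennreal (w x powr s) \<partial>lborel) < \<infinity>"
proof -
  obtain C where C: "C \<ge> 0" "\<forall>\<^sub>F l in at_top. emeasure lborel {x\<in>K. l < w x} \<le> ennreal (C * l powr (- t))"
    using weak[unfolded weak_Lp_loc_def, rule_format, OF conjI[OF K]] by blast
  then obtain l0 where l0: "\<And>l. l \<ge> l0 \<Longrightarrow> emeasure lborel {x\<in>K. l < w x} \<le> ennreal (C * l powr (- t))"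
    unfolding eventually_at_top_linorder by blast
  define a where "a = max l0 1"
  have a: "a \<ge> 1" "a \<ge> l0" by (auto simp: a_def)
  have [measurable]: "K \<in> sets borel" using K by (simp add: compact_imp_closed)
  define E where "E k = {x\<in>K. a * 2 ^ k < w x}" for k :: nat
  have [measurable]: "E k \<in> sets borel" for k unfolding E_def by measurable
  define B where "B k = (a * 2 ^ (k + 1)) powr s" for k :: nat
  define r where "r = 2 powr (s - t)"
  have r: "0 < r" "r < 1" using s powr_less_mono[of "s - t" 0 2] by (auto simp: r_def)
  have pt: "ennreal (w x powr s) * indicator K x \<le> ennreal (a powr s) * indicator K x + (\<Sum>k. ennreal (B k) * indicator (E k) x)" for x
  proof (cases "x \<in> K \<and> a < w x")
    case True
    obtain m where "w x / a < 2 ^ m" using real_arch_pow[of 2 "w x / a"] by auto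
    then have ex: "\<exists>m. w x \<le> a * 2 ^ m" using a by (intro exI[of _ m]) (simp add: field_simps)
    \<comment> \<open>the dyadic level of \<open>w x\<close>; it is not \<open>0\<close> because \<open>w x > a\<close>\<close>
    define m where "m = (LEAST m. w x \<le> a * 2 ^ m)"
    have m: "w x \<le> a * 2 ^ m" unfolding m_def by (rule LeastI_ex[OF ex])
    have "m \<noteq> 0" using m True by (intro notI) simp
    then obtain k where k: "m = Suc k" using not0_implies_Suc by blast
    have "\<not> w x \<le> a * 2 ^ k" using not_less_Least[of k "\<lambda>m. w x \<le> a * 2 ^ m"] k by (simp add: m_def[symmetric])
    then have xE: "x \<in> E k" using True by (simp add: E_def)
    have "w x powr s \<le> B k" unfolding B_def using m k nn s by (intro powr_mono2) auto
    then have "ennreal (w x powr s) \<le> ennreal (B k) * indicator (E k) x" using xE by (simp add: ennreal_leI)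
    also have "\<dots> \<le> (\<Sum>k. ennreal (B k) * indicator (E k) x)"
    proof -
      have "sum f {k} \<le> suminf f" for f :: "nat \<Rightarrow> ennreal" by (rule sum_le_suminf) auto
      then have "f k \<le> suminf f" for f :: "nat \<Rightarrow> ennreal" by simp
      then show ?thesis .
    qed
    finally show ?thesis using True by (simp add: add_increasing)
  next
    case False
    then have "ennreal (w x powr s) * indicator K x \<le> ennreal (a powr s) * indicator K x"
      using nn s by (cases "x \<in> K") (auto intro!: ennreal_leI powr_mono2)
    then show ?thesis by (simp add: add_increasing2)
  qed
  have "(\<integral>\<^sup>+x\<in>K. ennreal (w x powr s) \<partial>lborel)
     \<le> (\<integral>\<^sup>+x. ennreal (a powr s) * indicator K x + (\<Sum>k. ennreal (B k) * indicator (E k) x) \<partial>lborel)"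
    by (rule nn_integral_mono) (rule pt)
  also have "\<dots> = ennreal (a powr s) * emeasure lborel K + (\<Sum>k. ennreal (B k) * emeasure lborel (E k))"
    by (subst nn_integral_add) (auto simp: nn_integral_suminf nn_integral_cmult_indicator)
  also have "\<dots> \<le> ennreal (a powr s) * emeasure lborel K + (\<Sum>k. ennreal (C * a powr (s - t) * 2 powr s * r ^ k))"
  proof (intro add_left_mono suminf_le)
    fix k
    have "a * 2 ^ k \<ge> a * 1" using a by (intro mult_left_mono) auto
    then have "l0 \<le> a * 2 ^ k" using a by linarith
    then have "emeasure lborel (E k) \<le> ennreal (C * (a * 2 ^ k) powr (- t))"
      unfolding E_def by (rule l0)
    then have "ennreal (B k) * emeasure lborel (E k) \<le> ennreal (B k) * ennreal (C * (a * 2 ^ k) powr (- t))"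
      by (rule mult_left_mono) simp
    also have "\<dots> = ennreal (B k * (C * (a * 2 ^ k) powr (- t)))"
      using C by (subst ennreal_mult) (auto simp: B_def)
    also have "B k * (C * (a * 2 ^ k) powr (- t)) = C * a powr (s - t) * 2 powr s * r ^ k"
    proof -
      have "(2 ^ k) powr x = (2 powr x) ^ k" for x :: real
        by (simp add: powr_realpow[symmetric] powr_powr mult.commute)
      then have "r ^ k = (2 ^ k) powr s * (2 ^ k) powr (- t)"
        by (simp add: r_def power_mult_distrib[symmetric] powr_add[symmetric])
      moreover have "a powr (s - t) = a powr s * a powr (- t)"
        using a by (simp add: powr_add[symmetric])
      ultimately show ?thesis using a
        by (simp add: B_def powr_mult)
    qed
    finally show "ennreal (B k) * emeasure lborel (E k) \<le> ennreal (C * a powr (s - t) * 2 powr s * r ^ k)" .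
  qed auto
  also have "\<dots> < \<infinity>"
  proof -
    have "summable (\<lambda>k. C * a powr (s - t) * 2 powr s * r ^ k)"
      using r by (intro summable_mult summable_geometric) auto
    then have "(\<Sum>k. ennreal (C * a powr (s - t) * 2 powr s * r ^ k)) \<noteq> top"
      using C r by (intro ennreal_suminf_neq_top) auto
    moreover have "emeasure lborel K < \<infinity>" using K(1) emeasure_compact_finite by blast
    ultimately show ?thesis by (auto simp: ennreal_mult_less_top top.not_eq_extremum)
  qed
  finally show ?thesis .
qed

text \<open>
  The Sobolev-type embedding for fractional differences, up to the end point. The improvement
  \<open>t \<mapsto> p + t \<gamma> / n\<close> is an affine contraction with fixed point \<open>T = p n / (n - \<gamma>)\<close>, so finitely many
  steps lead from \<open>p\<close> beyond any \<open>s < T\<close>.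
\<close>

lemma fractional_difference_embedding:
  fixes w :: "'a::euclidean_space \<Rightarrow> real" and p \<gamma> s :: real
  assumes \<Omega>: "open \<Omega>" and w[measurable]: "w \<in> borel_measurable borel" and nn: "\<And>x. 0 \<le> w x"
    and p: "0 < p" and \<gamma>: "0 < \<gamma>" "\<gamma> < DIM('a)"
    and Lp: "\<And>K. compact K \<Longrightarrow> K \<subseteq> \<Omega> \<Longrightarrow> (\<integral>\<^sup>+x\<in>K. ennreal (w x powr p) \<partial>lborel) < \<infinity>"
    and diff: "frac_diff p \<gamma> \<Omega> w"
    and s: "0 < s" "s < p * DIM('a) / (DIM('a) - \<gamma>)" and K: "compact K" "K \<subseteq> \<Omega>"
  shows "(\<integral>\<^sup>+x\<in>K. ennreal (w x powr s) \<partial>lborel) < \<infinity>"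
proof -
  define n where "n = real DIM('a)"
  define T where "T = p * n / (n - \<gamma>)"
  define \<theta> where "\<theta> = \<gamma> / n"
  have n: "n > 0" by (simp add: n_def)
  have \<theta>: "0 < \<theta>" "\<theta> < 1" using \<gamma> n by (auto simp: \<theta>_def n_def)
  have T: "T > 0" "p = T * (1 - \<theta>)" using p \<gamma> n by (auto simp: T_def \<theta>_def n_def field_simps)
  \<comment> \<open>the solution of the recursion \<open>t 0 = p\<close>, \<open>t (k + 1) = p + \<theta> * t k\<close>; the start is the Chebyshev inequality\<close>
  have it: "weak_Lp_loc (T * (1 - \<theta> ^ (k + 1))) \<Omega> w" for k
  proof (induction k)
    case 0
    have "weak_Lp_loc p \<Omega> w"
      unfolding weak_Lp_loc_def
    proof (intro allI impI, elim conjE)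
      fix K assume K: "compact K" "K \<subseteq> \<Omega>"
      have [measurable]: "K \<in> sets borel" using K by (simp add: compact_imp_closed)
      define C where "C = enn2real (\<integral>\<^sup>+x\<in>K. ennreal (w x powr p) \<partial>lborel)"
      have C: "C \<ge> 0" "(\<integral>\<^sup>+x\<in>K. ennreal (w x powr p) \<partial>lborel) = ennreal C"
        using Lp[OF K] by (auto simp: C_def less_top)
      have "\<forall>\<^sub>F l in at_top. emeasure lborel {x\<in>K. l < w x} \<le> ennreal (C * l powr (- p))"
        using eventually_gt_at_top[of 0]
      proof eventually_elim
        case (elim l)
        have [measurable]: "{x\<in>K. l < w x} \<in> sets borel" by measurable
        have "ennreal (l powr p) * emeasure lborel {x\<in>K. l < w x} = (\<integral>\<^sup>+x. ennreal (l powr p) * indicator {x\<in>K. l < w x} x \<partial>lborel)"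
          by (subst nn_integral_cmult_indicator) auto
        also have "\<dots> \<le> (\<integral>\<^sup>+x\<in>K. ennreal (w x powr p) \<partial>lborel)"
          using elim p by (intro nn_integral_mono) (auto simp: indicator_def intro!: ennreal_leI powr_mono2)
        finally have *: "ennreal (l powr p) * emeasure lborel {x\<in>K. l < w x} \<le> ennreal C" using C by simp
        show ?case
        proof (cases "emeasure lborel {x\<in>K. l < w x}" rule: ennreal_cases)
          case (real r)
          then have "l powr p * r \<le> C" using * C by (simp flip: ennreal_mult)
          then have "r \<le> C * l powr (- p)" using elim by (simp add: powr_minus field_simps)
          then show ?thesis using real by (simp add: ennreal_leI)
        next
          case top
          then show ?thesis using * elim by (simp add: ennreal_mult_top top_unique)
        qed
      qed
      then show "\<exists>C\<ge>0. \<forall>\<^sub>F l in at_top. emeasure lborel {x\<in>K. l < w x} \<le> ennreal (C * l powr (- p))"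
        using C(1) by blast
    qed
    then show ?case by (simp add: T(2)[symmetric])
  next
    case (Suc k)
    have "0 < T * (1 - \<theta> ^ (k + 1))" using T \<theta> power_Suc_less_one[of \<theta> k] by simp
    from weak_Lp_loc_improve[OF \<Omega> w p \<gamma>(1) this diff Suc]
    have "weak_Lp_loc (p + T * (1 - \<theta> ^ (k + 1)) * \<gamma> / DIM('a)) \<Omega> w" by blast
    moreover have gm: "T * (1 - \<theta> ^ (k + 1)) * \<gamma> / DIM('a) = T * (1 - \<theta> ^ (k + 1)) * \<theta>"
      by (simp add: \<theta>_def n_def)
    have "p + T * (1 - \<theta> ^ (k + 1)) * \<gamma> / DIM('a) = T * (1 - \<theta> ^ (Suc k + 1))"
      unfolding T(2) gm by (simp add: algebra_simps)
    ultimately show ?case by simp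
  qed
  have "(\<lambda>k. T * (1 - \<theta> ^ (k + 1))) \<longlonglongrightarrow> T * (1 - 0)"
    using \<theta> by (intro tendsto_intros LIMSEQ_ignore_initial_segment LIMSEQ_power_zero) auto
  then have "\<forall>\<^sub>F k in sequentially. s < T * (1 - \<theta> ^ (k + 1))"
    using s by (intro order_tendstoD) (auto simp: T_def n_def)
  then obtain k where "s < T * (1 - \<theta> ^ (k + 1))" by (auto simp: eventually_sequentially)
  then show ?thesis by (rule weak_Lp_loc_imp_nn_integral[OF w nn it s(1) _ K])
qed

section \<open>Lebesgue spaces of Borel functions\<close>

text \<open>
  Unlike the elements of \<open>Lp\<close>, these functions are Borel measurable, so that translates of them and
  compositions on product spaces stay measurable.
\<close>

definition borel_Lp :: "real \<Rightarrow> ('a::euclidean_space \<Rightarrow> 'b::euclidean_space) \<Rightarrow> bool" where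
  "borel_Lp q v \<longleftrightarrow> v \<in> borel_measurable borel \<and> integrable lborel (\<lambda>x. norm (v x) powr q)"

lemma borel_LpD: "borel_Lp q v \<Longrightarrow> v \<in> borel_measurable borel" "borel_Lp q v \<Longrightarrow> integrable lborel (\<lambda>x. norm (v x) powr q)"
  by (auto simp: borel_Lp_def)

lemma powr_sum_le:
  fixes a b q :: real
  assumes "0 \<le> a" "0 \<le> b" "0 < q"
  shows "(a + b) powr q \<le> 2 powr q * (a powr q + b powr q)"
proof -
  have "(a + b) powr q \<le> (2 * max a b) powr q"
    using assms by (intro powr_mono2) auto
  also have "\<dots> = 2 powr q * max a b powr q" using assms by (simp add: powr_mult)
  also have "max a b powr q \<le> a powr q + b powr q" by (simp add: max_def)
  finally show ?thesis by simp
qed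

lemma borel_Lp_dominated:
  assumes "borel_Lp q v" "w \<in> borel_measurable borel" "0 < q" "0 \<le> B" "\<And>x. norm (w x) \<le> B * norm (v x)"
  shows "borel_Lp q w"
proof -
  note [measurable] = borel_LpD(1)[OF assms(1)] assms(2)
  have "integrable lborel (\<lambda>x. norm (w x) powr q)"
  proof (rule Bochner_Integration.integrable_bound)
    show "integrable lborel (\<lambda>x. B powr q * norm (v x) powr q)" using borel_LpD(2)[OF assms(1)] by simp
    have "norm (w x) powr q \<le> B powr q * norm (v x) powr q" for x
      using powr_mono2[of q, OF _ _ assms(5)[of x]] assms(3,4) by (simp add: powr_mult)
    then show "AE x in lborel. norm (norm (w x) powr q) \<le> norm (B powr q * norm (v x) powr q)"
      by (simp add: abs_mult)
  qed measurable
  then show ?thesis using assms(2) by (simp add: borel_Lp_def)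
qed

lemma borel_Lp_add:
  assumes "borel_Lp q v" "borel_Lp q w" "0 < q"
  shows "borel_Lp q (\<lambda>x. v x + w x)"
proof -
  note [measurable] = borel_LpD(1)[OF assms(1)] borel_LpD(1)[OF assms(2)]
  have "integrable lborel (\<lambda>x. norm (v x + w x) powr q)"
  proof (rule Bochner_Integration.integrable_bound)
    show "integrable lborel (\<lambda>x. 2 powr q * (norm (v x) powr q + norm (w x) powr q))"
      using borel_LpD(2)[OF assms(1)] borel_LpD(2)[OF assms(2)] by simp
    have "norm (v x + w x) powr q \<le> 2 powr q * (norm (v x) powr q + norm (w x) powr q)" for x
    proof -
      have "norm (v x + w x) powr q \<le> (norm (v x) + norm (w x)) powr q"
        using assms(3) by (intro powr_mono2 norm_triangle_ineq) auto
      also have "\<dots> \<le> 2 powr q * (norm (v x) powr q + norm (w x) powr q)"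
        using assms(3) by (intro powr_sum_le) auto
      finally show ?thesis .
    qed
    then show "AE x in lborel. norm (norm (v x + w x) powr q) \<le> norm (2 powr q * (norm (v x) powr q + norm (w x) powr q))"
      by (simp add: abs_mult)
  qed measurable
  then show ?thesis by (simp add: borel_Lp_def)
qed

lemma borel_Lp_diff:
  assumes "borel_Lp q v" "borel_Lp q w" "0 < q"
  shows "borel_Lp q (\<lambda>x. v x - w x)"
proof -
  have "borel_Lp q (\<lambda>x. - w x)" using assms(2) by (simp add: borel_Lp_def)
  from borel_Lp_add[OF assms(1) this assms(3)] show ?thesis by simp
qed

lemma borel_Lp_translate: "borel_Lp q v \<Longrightarrow> borel_Lp q (\<lambda>x. v (x + c))"
  using integral_translate(2)[of "\<lambda>x. norm (v x) powr q" c] by (auto simp: borel_Lp_def)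

lemma borel_Lp_bounded_scale:
  assumes "borel_Lp q v" "g \<in> borel_measurable borel" "\<exists>B. \<forall>x. \<bar>g x\<bar> \<le> B" "0 < q"
  shows "borel_Lp q (\<lambda>x. g x *\<^sub>R v x)"
proof -
  obtain B where B: "\<And>x. \<bar>g x\<bar> \<le> B" using assms(3) by blast
  note [measurable] = borel_LpD(1)[OF assms(1)] assms(2)
  have "0 \<le> B" using B[of undefined] by linarith
  then show ?thesis using B by (intro borel_Lp_dominated[OF assms(1) _ assms(4)]) (auto intro: mult_right_mono)
qed

lemma borel_Lp_scale_bounded_vec:
  fixes v :: "'a::euclidean_space \<Rightarrow> real" and g :: "'a \<Rightarrow> 'b::euclidean_space"
  assumes "borel_Lp q v" "g \<in> borel_measurable borel" "\<exists>B. \<forall>x. norm (g x) \<le> B" "0 < q"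
  shows "borel_Lp q (\<lambda>x. v x *\<^sub>R g x)"
proof -
  obtain B where B: "\<And>x. norm (g x) \<le> B" using assms(3) by blast
  note [measurable] = borel_LpD(1)[OF assms(1)] assms(2)
  have "0 \<le> B" using B[of undefined] norm_ge_zero order_trans by blast
  moreover have "norm (v x *\<^sub>R g x) \<le> B * norm (v x)" for x
    using mult_left_mono[OF B[of x], of "\<bar>v x\<bar>"] by (simp add: mult.commute)
  ultimately show ?thesis by (intro borel_Lp_dominated[OF assms(1) _ assms(4)]) auto
qed

lemma young_le:
  fixes a b p q :: real
  assumes "p > 1" "q > 1" "1/p + 1/q = 1" "a \<ge> 0" "b \<ge> 0"
  shows "a * b \<le> a powr p + b powr q"
proof -
  have "a powr p / p \<le> a powr p" "b powr q / q \<le> b powr q"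
    using assms by (auto simp: divide_le_eq mult_le_cancel_left1)
  then show ?thesis using Youngs_inequality[OF assms] by linarith
qed

lemma integrable_inner_borel_Lp:
  assumes "p > 1" "q > 1" "1/p + 1/q = 1" "borel_Lp p f" "borel_Lp q g"
  shows "integrable lborel (\<lambda>x. f x \<bullet> g x)"
proof -
  note [measurable] = borel_LpD(1)[OF assms(4)] borel_LpD(1)[OF assms(5)]
  show ?thesis
  proof (rule Bochner_Integration.integrable_bound)
    show "integrable lborel (\<lambda>x. norm (f x) powr p + norm (g x) powr q)"
      using borel_LpD(2)[OF assms(4)] borel_LpD(2)[OF assms(5)] by simp
    have "\<bar>f x \<bullet> g x\<bar> \<le> norm (f x) powr p + norm (g x) powr q" for x
      using Cauchy_Schwarz_ineq2[of "f x" "g x"] young_le[OF assms(1-3), of "norm (f x)" "norm (g x)"] by simp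
    then show "AE x in lborel. norm (f x \<bullet> g x) \<le> norm (norm (f x) powr p + norm (g x) powr q)" by simp
  qed measurable
qed

lemma borel_Lp_flux:
  assumes q: "1 < q" and p: "p = q / (q - 1)" and G: "borel_Lp q G"
  shows "borel_Lp p (\<lambda>x. flux q (G x))"
proof -
  note [measurable] = borel_LpD(1)[OF G]
  have "(q - 1) * p = q" using q by (simp add: p)
  then have e: "norm (flux q (G x)) powr p = max (norm (G x) - 1) 0 powr q" for x
    by (simp add: norm_flux powr_powr)
  have "integrable lborel (\<lambda>x. norm (flux q (G x)) powr p)"
  proof (rule Bochner_Integration.integrable_bound[OF borel_LpD(2)[OF G]])
    show "AE x in lborel. norm (norm (flux q (G x)) powr p) \<le> norm (norm (G x) powr q)"
      unfolding e using q by (auto intro!: powr_mono2 simp: max_def)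
  qed measurable
  then show ?thesis by (simp add: borel_Lp_def)
qed

section \<open>The energy estimate\<close>

lemma integral_le_of_nn_integral_le:
  assumes "integrable M g" "\<And>x. 0 \<le> g x" "(\<integral>\<^sup>+x. ennreal (g x) \<partial>M) \<le> ennreal c" "0 \<le> c"
  shows "(LINT x|M. g x) \<le> c"
  using assms by (simp add: nn_integral_eq_integral)

text \<open>
  The difference quotient estimate for the flux. The equation is tested with
  \<open>v = \<psi>(\<cdot> - h) - \<psi>\<close>, where \<open>\<psi> = \<eta>\<^sup>2 (u(\<cdot> + h) - u)\<close>. Moving the translation to the
  other factor, this says that the increments \<open>dA\<close> of the flux and \<open>df\<close> of the datum satisfy
  \<open>\<integral> dA \<bullet> grad \<psi> = \<integral> df \<psi>\<close>. The part of \<open>grad \<psi>\<close> with the increment of the gradient controls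
  \<open>\<eta>\<^sup>2 |dA|\<^sup>p\<close> by \<open>flux_monotone\<close>. The part with \<open>grad (\<eta>\<^sup>2)\<close> carries only one power of \<open>|dA|\<close>
  and is split by the Young inequality: its \<open>p\<close>-th power is absorbed, and what remains is of order
  \<open>|h|\<^sup>q\<close>. The term \<open>\<integral> df \<psi>\<close> is of order \<open>|h| powr (1 + \<theta>)\<close>, with the exponent \<open>1\<close> coming from
  \<open>u\<close> and \<open>\<theta>\<close> from \<open>f\<close>. All inequalities are pointwise and are integrated once, at the end.
\<close>

lemma energy_estimate:
  fixes G :: "'a::euclidean_space \<Rightarrow> 'a" and u f \<eta> :: "'a \<Rightarrow> real" and h :: 'a
  assumes q: "1 < q" "q < 2" and p: "p = q / (q - 1)"
    and W: "weak_deriv U u G" and uq: "borel_Lp q u" and Gq: "borel_Lp q G" and fp: "borel_Lp p f"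
    and V: "open V" "V \<subseteq> U" "\<And>x. x \<in> V \<Longrightarrow> x + h \<in> U"
    and \<eta>: "\<eta> \<in> test_fun V" "\<And>x. 0 \<le> \<eta> x" "\<And>x. \<eta> x \<le> 1" and M: "M > 0" "\<And>x. norm (grad \<eta> x) \<le> M"
    and EQ: "\<And>v H. weak_deriv UNIV v H \<Longrightarrow> borel_Lp q v \<Longrightarrow> borel_Lp q H \<Longrightarrow>
        (\<And>x. x \<notin> V \<Longrightarrow> x - h \<notin> V \<Longrightarrow> v x = 0 \<and> H x = 0) \<Longrightarrow>
        (LINT x|lborel. flux q (G x) \<bullet> H x) = (LINT x|lborel. f x * v x)"
    and h: "h \<noteq> 0" and N: "0 \<le> Nu" "0 \<le> Nf"
    and Du: "(\<integral>\<^sup>+x\<in>V. ennreal (\<bar>u (x + h) - u x\<bar> powr q) \<partial>lborel) \<le> ennreal (Nu * norm h powr q)"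
    and Df: "(\<integral>\<^sup>+x\<in>V. ennreal (\<bar>f (x + h) - f x\<bar> powr p) \<partial>lborel) \<le> ennreal (Nf * norm h powr (\<theta> * p))"
    and c: "c = 2 powr (1 - p)" and \<kappa>: "\<kappa> = (c / 2) powr (1 / p)"
  shows "(\<integral>\<^sup>+x. ennreal ((\<eta> x)\<^sup>2 * norm (flux q (G (x + h)) - flux q (G x)) powr p) \<partial>lborel)
     \<le> ennreal (2 / c * ((Nf + Nu) * norm h powr (1 + \<theta>) + (2 * M / \<kappa>) powr q * Nu * norm h powr q))"
proof -
  define \<sigma> where "\<sigma> = norm h"
  have \<sigma>: "\<sigma> > 0" using h by (simp add: \<sigma>_def)
  have p2: "2 < p" using q by (simp add: p field_simps)
  have pq: "p > 1" "q > 1" "1/p + 1/q = 1" using q p2 by (auto simp: p field_simps)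
  have qp: "q > 0" "p > 0" using q p2 by auto
  have cpos: "c > 0" by (simp add: c)
  \<comment> \<open>\<open>\<kappa>\<close> is the weight in the Young inequality for which the absorbed term takes half of the
       coercivity constant \<open>c\<close>\<close>
  have \<kappa>pos: "\<kappa> > 0" "\<kappa> powr p = c / 2" using cpos qp by (auto simp: \<kappa> powr_powr)
  note [measurable] = borel_LpD(1)[OF uq] borel_LpD(1)[OF Gq] borel_LpD(1)[OF fp]
  have [measurable]: "V \<in> sets borel" using V by auto
  define \<zeta> where "\<zeta> = (\<lambda>x. \<eta> x * \<eta> x)"
  have \<zeta>: "\<zeta> \<in> test_fun V" unfolding \<zeta>_def by (rule test_fun_mult[OF \<eta>(1,1)])
  note \<eta>b[measurable] = test_fun_bounded(2)[OF \<eta>(1)] test_fun_bounded(2)[OF \<zeta>] grad_bounded(2)[OF \<eta>(1)] grad_bounded(2)[OF \<zeta>]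
  have grad\<zeta>: "grad \<zeta> x = (2 * \<eta> x) *\<^sub>R grad \<eta> x" for x
    unfolding \<zeta>_def grad_test_mult[OF \<eta>(1,1)] by (simp add: scaleR_add_left[symmetric])
  define A where "A x = flux q (G x)" for x
  define dA dG du df where "dA x = A (x + h) - A x" and "dG x = G (x + h) - G x"
    and "du x = u (x + h) - u x" and "df x = f (x + h) - f x" for x
  have Ap: "borel_Lp p A" unfolding A_def[abs_def] by (rule borel_Lp_flux[OF q(1) p Gq])
  note [measurable] = borel_LpD(1)[OF Ap]
  have L: "borel_Lp p dA" "borel_Lp q dG" "borel_Lp q du" "borel_Lp p df"
    unfolding dA_def[abs_def] dG_def[abs_def] du_def[abs_def] df_def[abs_def]
    by (intro borel_Lp_diff borel_Lp_translate Ap Gq uq fp qp)+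
  note [measurable] = L[THEN borel_LpD(1)]
  define \<psi> where "\<psi> x = \<zeta> x * du x" for x
  define \<Psi> where "\<Psi> x = \<zeta> x *\<^sub>R dG x + du x *\<^sub>R grad \<zeta> x" for x
  have "weak_deriv V (\<lambda>x. u (x + h) - u x) (\<lambda>x. G (x + h) - G x)"
    by (rule weak_deriv_diff[OF weak_deriv_translate[OF W V(3)] weak_deriv_subset[OF W V(2)]])
  from weak_deriv_mult[OF this \<zeta>] have W\<psi>: "weak_deriv UNIV \<psi> \<Psi>"
    unfolding \<psi>_def[abs_def] \<Psi>_def[abs_def] du_def dG_def .
  have "borel_Lp q (\<lambda>x. \<zeta> x *\<^sub>R du x)" "borel_Lp q (\<lambda>x. \<zeta> x *\<^sub>R dG x)" "borel_Lp q (\<lambda>x. du x *\<^sub>R grad \<zeta> x)"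
    by (intro borel_Lp_bounded_scale borel_Lp_scale_bounded_vec L qp \<eta>b test_fun_bounded(3)[OF \<zeta>] grad_bounded(3)[OF \<zeta>])+
  then have L\<psi>: "borel_Lp q \<psi>" "borel_Lp q \<Psi>"
    unfolding \<psi>_def[abs_def] \<Psi>_def[abs_def] by (auto intro!: borel_Lp_add qp)
  note [measurable] = L\<psi>[THEN borel_LpD(1)]
  obtain S where S: "compact S" "S \<subseteq> V" "\<And>x. x \<notin> S \<Longrightarrow> \<zeta> x = 0"
    "\<And>x. x \<notin> S \<Longrightarrow> frechet_derivative \<zeta> (at x) = (\<lambda>_. 0)"
    by (rule test_fun_support[OF \<zeta>], rule that; assumption)
  have off: "\<psi> x = 0" "\<Psi> x = 0" if "x \<notin> V" for x
  proof -
    have "x \<notin> S" using S(2) that by blast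
    then show "\<psi> x = 0" "\<Psi> x = 0" using S(3,4)[of x] by (simp_all add: \<psi>_def \<Psi>_def grad_def)
  qed
  define v H where "v x = \<psi> (x + - h) - \<psi> x" and "H x = \<Psi> (x + - h) - \<Psi> x" for x
  have eq: "(LINT x|lborel. A x \<bullet> H x) = (LINT x|lborel. f x * v x)"
    unfolding A_def
  proof (rule EQ)
    show "weak_deriv UNIV v H"
      unfolding v_def[abs_def] H_def[abs_def]
      by (intro weak_deriv_diff weak_deriv_translate[OF W\<psi>] W\<psi>) auto
    show "borel_Lp q v" "borel_Lp q H"
      unfolding v_def[abs_def] H_def[abs_def] by (intro borel_Lp_diff borel_Lp_translate L\<psi> qp)+
    show "v x = 0 \<and> H x = 0" if "x \<notin> V" "x - h \<notin> V" for x
      using off[OF that(1)] off[OF that(2)] by (simp add: v_def H_def)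
  qed
  note ii = integrable_inner_borel_Lp[OF pq]
  have i1: "integrable lborel (\<lambda>x. A x \<bullet> \<Psi> (x + - h))" "integrable lborel (\<lambda>x. A x \<bullet> \<Psi> x)"
     "integrable lborel (\<lambda>x. A (x + h) \<bullet> \<Psi> x)" "integrable lborel (\<lambda>x. f x \<bullet> \<psi> (x + - h))"
     "integrable lborel (\<lambda>x. f x \<bullet> \<psi> x)" "integrable lborel (\<lambda>x. f (x + h) \<bullet> \<psi> x)"
    by (intro ii borel_Lp_translate Ap L\<psi> fp)+
  have "(LINT x|lborel. A x \<bullet> H x) = (LINT x|lborel. A x \<bullet> \<Psi> (x + - h)) - (LINT x|lborel. A x \<bullet> \<Psi> x)"
    unfolding H_def inner_diff_right by (rule Bochner_Integration.integral_diff[OF i1(1,2)])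
  also have "(LINT x|lborel. A x \<bullet> \<Psi> (x + - h)) = (LINT x|lborel. A (x + h) \<bullet> \<Psi> x)"
    using integral_translate(1)[of "\<lambda>x. A x \<bullet> \<Psi> (x + - h)" h] by simp
  also have "(LINT x|lborel. A (x + h) \<bullet> \<Psi> x) - (LINT x|lborel. A x \<bullet> \<Psi> x) = (LINT x|lborel. dA x \<bullet> \<Psi> x)"
    unfolding dA_def inner_diff_left by (rule Bochner_Integration.integral_diff[OF i1(3,2), symmetric])
  finally have e1: "(LINT x|lborel. A x \<bullet> H x) = (LINT x|lborel. dA x \<bullet> \<Psi> x)" .
  have "(LINT x|lborel. f x * v x) = (LINT x|lborel. f x * \<psi> (x + - h)) - (LINT x|lborel. f x * \<psi> x)"
    unfolding v_def right_diff_distrib by (rule Bochner_Integration.integral_diff[OF i1(4,5)[unfolded inner_real_def]])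
  also have "(LINT x|lborel. f x * \<psi> (x + - h)) = (LINT x|lborel. f (x + h) * \<psi> x)"
    using integral_translate(1)[of "\<lambda>x. f x * \<psi> (x + - h)" h] by simp
  also have "(LINT x|lborel. f (x + h) * \<psi> x) - (LINT x|lborel. f x * \<psi> x) = (LINT x|lborel. df x * \<psi> x)"
    unfolding df_def left_diff_distrib by (rule Bochner_Integration.integral_diff[OF i1(6,5)[unfolded inner_real_def], symmetric])
  finally have e2: "(LINT x|lborel. f x * v x) = (LINT x|lborel. df x * \<psi> x)" .
  \<comment> \<open>by the equation \<open>R\<close> has integral zero, so it may be added to pointwise inequalities\<close>
  define R where "R x = dA x \<bullet> \<Psi> x - df x * \<psi> x" for x
  have iR0: "integrable lborel (\<lambda>x. dA x \<bullet> \<Psi> x)" "integrable lborel (\<lambda>x. df x * \<psi> x)"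
    using ii[OF L(1) L\<psi>(2)] ii[OF L(4) L\<psi>(1)] by (simp_all add: inner_real_def)
  then have iR: "integrable lborel R" unfolding R_def[abs_def] by simp
  have R0: "(LINT x|lborel. R x) = 0"
    unfolding R_def using iR0 eq e1 e2 by simp
  define X where "X x = \<zeta> x * norm (dA x) powr p" for x
  define b1 b2 where "b1 x = \<bar>df x\<bar> powr p * indicator V x" and "b2 x = \<bar>du x\<bar> powr q * indicator V x" for x
  have iX: "integrable lborel X"
    using integrable_bounded_mult[OF borel_LpD(2)[OF L(1)] test_fun_bounded(2,3)[OF \<zeta>]] by (simp add: X_def[abs_def])
  have ib: "integrable lborel b1" "integrable lborel b2"
    unfolding b1_def[abs_def] b2_def[abs_def]
    by (rule integrable_real_mult_indicator, simp, use borel_LpD(2)[OF L(4)] borel_LpD(2)[OF L(3)] in simp)+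
  have Ib1: "(LINT x|lborel. b1 x) \<le> Nf * \<sigma> powr (\<theta> * p)"
    using Df N by (intro integral_le_of_nn_integral_le ib) (simp_all add: b1_def df_def \<sigma>_def ennreal_mult'' ennreal_indicator)
  have Ib2: "(LINT x|lborel. b2 x) \<le> Nu * \<sigma> powr q"
    using Du N by (intro integral_le_of_nn_integral_le ib) (simp_all add: b2_def du_def \<sigma>_def ennreal_mult'' ennreal_indicator)
  have \<zeta>01: "0 \<le> \<zeta> x" "\<zeta> x \<le> 1" for x
    using \<eta>(2,3)[of x] by (auto simp: \<zeta>_def intro: mult_le_one)
  let ?L = "(2 * M / \<kappa>) powr q"
  let ?T = "\<lambda>x. \<sigma> powr (1 + \<theta>) * (\<sigma> powr (- (\<theta> * p)) * b1 x + \<sigma> powr (- q) * b2 x) + ?L * b2 x"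
  have pw: "c / 2 * X x \<le> R x + ?T x" for x
  proof (cases "x \<in> V")
    case x: True
    have mono: "c * X x \<le> \<zeta> x * (dA x \<bullet> dG x)"
      using mult_left_mono[OF flux_monotone[OF q p, of "G (x + h)" "G x"] \<zeta>01(1)[of x]]
      by (simp add: X_def dA_def dG_def A_def c mult.assoc mult.left_commute)
    have "df x * \<psi> x \<le> \<bar>df x\<bar> * \<bar>du x\<bar>"
    proof -
      have "df x * \<psi> x \<le> \<bar>df x * \<psi> x\<bar>" by simp
      also have "\<dots> = \<zeta> x * (\<bar>df x\<bar> * \<bar>du x\<bar>)" using \<zeta>01(1)[of x] by (simp add: \<psi>_def abs_mult mult.commute mult.left_commute)
      also have "\<dots> \<le> 1 * (\<bar>df x\<bar> * \<bar>du x\<bar>)" by (intro mult_right_mono \<zeta>01) simp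
      finally show ?thesis by simp
    qed
    also have "\<bar>df x\<bar> * \<bar>du x\<bar> = \<sigma> powr (1 + \<theta>) * ((\<sigma> powr (- \<theta>) * \<bar>df x\<bar>) * (\<sigma> powr (- 1) * \<bar>du x\<bar>))"
    proof -
      have "\<sigma> powr (1 + \<theta>) * \<sigma> powr (- \<theta>) * \<sigma> powr (- 1) = 1"
        using \<sigma> by (simp add: powr_add[symmetric])
      then have "(\<sigma> powr (1 + \<theta>) * \<sigma> powr (- \<theta>) * \<sigma> powr (- 1)) * (\<bar>df x\<bar> * \<bar>du x\<bar>) = \<bar>df x\<bar> * \<bar>du x\<bar>" by simp
      then show ?thesis by (simp only: ac_simps)
    qed
    also have "\<dots> \<le> \<sigma> powr (1 + \<theta>) * ((\<sigma> powr (- \<theta>) * \<bar>df x\<bar>) powr p + (\<sigma> powr (- 1) * \<bar>du x\<bar>) powr q)"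
      by (intro mult_left_mono young_le[OF pq]) auto
    also have "\<dots> = \<sigma> powr (1 + \<theta>) * (\<sigma> powr (- (\<theta> * p)) * b1 x + \<sigma> powr (- q) * b2 x)"
    proof -
      have "(\<sigma> powr s * a) powr r = \<sigma> powr (s * r) * a powr r" if "0 \<le> a" for s a r
        using \<sigma> that by (simp add: powr_mult powr_powr)
      from this[of "\<bar>df x\<bar>" "- \<theta>" p] this[of "\<bar>du x\<bar>" "- 1" q] show ?thesis
        using x by (simp only: b1_def b2_def indicator_simps abs_ge_zero mult_1_right mult_minus_left mult_1)
    qed
    finally have t1: "df x * \<psi> x \<le> \<sigma> powr (1 + \<theta>) * (\<sigma> powr (- (\<theta> * p)) * b1 x + \<sigma> powr (- q) * b2 x)" .
    have "- (du x * (dA x \<bullet> grad \<zeta> x)) \<le> \<bar>du x\<bar> * \<bar>dA x \<bullet> grad \<zeta> x\<bar>"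
      by (simp add: abs_mult[symmetric])
    also have "\<dots> \<le> \<bar>du x\<bar> * (norm (dA x) * (2 * \<eta> x * M))"
    proof (intro mult_left_mono)
      have "\<bar>dA x \<bullet> grad \<zeta> x\<bar> \<le> norm (dA x) * norm (grad \<zeta> x)" by (rule Cauchy_Schwarz_ineq2)
      also have "norm (grad \<zeta> x) \<le> 2 * \<eta> x * M"
        using \<eta>(2)[of x] M(2)[of x] by (simp add: grad\<zeta> mult_left_mono)
      finally show "\<bar>dA x \<bullet> grad \<zeta> x\<bar> \<le> norm (dA x) * (2 * \<eta> x * M)" by (simp add: mult_left_mono)
    qed simp
    also have "\<dots> = (\<kappa> * \<eta> x * norm (dA x)) * (2 * M / \<kappa> * \<bar>du x\<bar>)"
      using \<kappa>pos by (simp add: field_simps)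
    also have "\<dots> \<le> (\<kappa> * \<eta> x * norm (dA x)) powr p + (2 * M / \<kappa> * \<bar>du x\<bar>) powr q"
      using \<kappa>pos \<eta>(2) M(1) by (intro young_le[OF pq]) (auto intro!: mult_nonneg_nonneg)
    also have "(2 * M / \<kappa> * \<bar>du x\<bar>) powr q = ?L * b2 x"
      using x M(1) \<kappa>pos powr_mult[of "2 * M / \<kappa>" "\<bar>du x\<bar>" q] by (simp only: b2_def indicator_simps mult_1_right)
    also have "(\<kappa> * \<eta> x * norm (dA x)) powr p \<le> c / 2 * X x"
    proof -
      \<comment> \<open>as \<open>p \<ge> 2\<close> and \<open>0 \<le> \<eta> \<le> 1\<close>\<close>
      have "\<eta> x powr p \<le> \<zeta> x"
      proof (cases "\<eta> x = 0")
        case False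
        then have "\<eta> x powr p \<le> \<eta> x powr 2"
          using p2 \<eta>(2,3)[of x] by (intro powr_mono') auto
        also have "\<dots> = \<zeta> x" using False \<eta>(2)[of x] by (simp add: \<zeta>_def powr_numeral power2_eq_square)
        finally show ?thesis .
      qed (use \<zeta>01 in simp)
      then have "c / 2 * (\<eta> x powr p) * norm (dA x) powr p \<le> c / 2 * \<zeta> x * norm (dA x) powr p"
        using cpos by (intro mult_right_mono mult_left_mono) auto
      moreover have "(\<kappa> * \<eta> x * norm (dA x)) powr p = \<kappa> powr p * \<eta> x powr p * norm (dA x) powr p"
        using \<kappa>pos(1) \<eta>(2)[of x] by (simp add: powr_mult)
      ultimately show ?thesis by (simp only: X_def \<kappa>pos(2) mult.assoc)
    qed
    finally have t2: "- (du x * (dA x \<bullet> grad \<zeta> x)) \<le> c / 2 * X x + ?L * b2 x" by simp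
    have "R x = \<zeta> x * (dA x \<bullet> dG x) + du x * (dA x \<bullet> grad \<zeta> x) - df x * \<psi> x"
      by (simp add: R_def \<Psi>_def inner_add_right)
    then show ?thesis using mono t1 t2 by linarith
  next
    case False
    then have "\<zeta> x = 0" using S by auto
    then show ?thesis using off[OF False] False by (simp add: X_def R_def b1_def b2_def)
  qed
  have "c / 2 * (LINT x|lborel. X x) = (LINT x|lborel. c / 2 * X x)" by simp
  also have "\<dots> \<le> (LINT x|lborel. R x + ?T x)"
    using pw iX iR ib by (intro integral_mono) auto
  also have "\<dots> = \<sigma> powr (1 + \<theta>) * (\<sigma> powr (- (\<theta> * p)) * (LINT x|lborel. b1 x) + \<sigma> powr (- q) * (LINT x|lborel. b2 x)) + ?L * (LINT x|lborel. b2 x)"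
    using iR ib by (simp add: R0)
  also have "\<dots> \<le> \<sigma> powr (1 + \<theta>) * (\<sigma> powr (- (\<theta> * p)) * (Nf * \<sigma> powr (\<theta> * p)) + \<sigma> powr (- q) * (Nu * \<sigma> powr q)) + ?L * (Nu * \<sigma> powr q)"
    using Ib1 Ib2 by (intro add_mono mult_left_mono) auto
  also have "\<dots> = (Nf + Nu) * \<sigma> powr (1 + \<theta>) + ?L * Nu * \<sigma> powr q"
  proof -
    have "\<sigma> powr (- s) * (N * \<sigma> powr s) = N" for s N :: real
      using \<sigma> by (simp add: powr_minus field_simps)
    then show ?thesis by (simp only: mult.commute[of "\<sigma> powr (1 + \<theta>)"] mult.assoc)
  qed
  finally have "(LINT x|lborel. X x) \<le> 2 / c * ((Nf + Nu) * \<sigma> powr (1 + \<theta>) + ?L * Nu * \<sigma> powr q)"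
    using cpos by (simp add: field_simps)
  moreover have "(\<integral>\<^sup>+x. ennreal (X x) \<partial>lborel) = ennreal (LINT x|lborel. X x)"
    using \<zeta>01 by (intro nn_integral_eq_integral iX) (auto simp: X_def)
  ultimately show ?thesis
    by (simp add: X_def \<zeta>_def dA_def A_def \<sigma>_def power2_eq_square ennreal_leI)
qed

section \<open>Borel representatives and the weak equation\<close>

text \<open>
  Completeness of the Lebesgue measure.
\<close>

lemma borel_measurable_lebesgue_AE:
  fixes f g :: "'a::euclidean_space \<Rightarrow> 'b::euclidean_space"
  assumes g: "g \<in> borel_measurable borel" and ae: "AE x in lborel. f x = g x"
  shows "f \<in> borel_measurable lebesgue"
proof -
  obtain N where N: "N \<in> null_sets lborel" "{x. f x \<noteq> g x} \<subseteq> N"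
    using ae unfolding eventually_ae_filter by auto
  have N': "N \<in> null_sets lebesgue" using N(1) by (rule null_sets_completionI)
  have g': "g \<in> borel_measurable lebesgue" using g by (simp add: measurable_completion)
  show ?thesis
  proof (rule borel_measurableI)
    fix S :: "'b set" assume "open S"
    then have 1: "g -` S \<in> sets lebesgue" using measurable_sets[OF g', of S] by simp
    have "f -` S \<inter> N \<in> null_sets lebesgue" by (rule null_sets_completion_subset[OF _ N']) auto
    then have 2: "f -` S \<inter> N \<in> sets lebesgue" by auto
    have "f -` S = (g -` S - N) \<union> (f -` S \<inter> N)" using N(2) by auto
    moreover have "(g -` S - N) \<union> (f -` S \<inter> N) \<in> sets lebesgue" using 1 2 N' by auto
    ultimately show "f -` S \<inter> space lebesgue \<in> sets lebesgue" by simp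
  qed
qed

lemma integral_lebesgue_on_eq:
  fixes f g :: "'a::euclidean_space \<Rightarrow> 'b::euclidean_space"
  assumes \<Omega>: "\<Omega> \<in> sets borel" and g: "g \<in> borel_measurable borel"
    and ae: "AE x in lborel. indicator \<Omega> x *\<^sub>R f x = g x"
  shows "(LINT x|lebesgue_on \<Omega>. f x) = (LINT x|lborel. g x)"
    and "integrable (lebesgue_on \<Omega>) f \<longleftrightarrow> integrable lborel g"
proof -
  have m\<Omega>: "\<Omega> \<inter> space lebesgue \<in> sets lebesgue" using \<Omega> by auto
  have m: "(\<lambda>x. indicator \<Omega> x *\<^sub>R f x) \<in> borel_measurable lebesgue"
    by (rule borel_measurable_lebesgue_AE[OF g ae])
  have g': "g \<in> borel_measurable lebesgue" using g by (simp add: measurable_completion)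
  have ae': "AE x in lebesgue. indicator \<Omega> x *\<^sub>R f x = g x" using ae by (rule AE_completion)
  show "(LINT x|lebesgue_on \<Omega>. f x) = (LINT x|lborel. g x)"
    using integral_cong_AE[OF m g' ae'] g unfolding integral_restrict_space[OF m\<Omega>]
    by (simp add: integral_completion)
  show "integrable (lebesgue_on \<Omega>) f \<longleftrightarrow> integrable lborel g"
    using integrable_cong_AE[OF m g' ae'] g unfolding integrable_restrict_space[OF m\<Omega>]
    by (simp add: integrable_completion)
qed

lemma nn_integral_lebesgue_on_eq:
  assumes K: "K \<in> sets borel" "K \<subseteq> \<Omega>" and ae: "AE x in lborel. x \<in> \<Omega> \<longrightarrow> f x = g x"
  shows "(\<integral>\<^sup>+x. F (f x) \<partial>lebesgue_on K) = (\<integral>\<^sup>+x\<in>K. F (g x) \<partial>lborel)"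
proof -
  have "(\<integral>\<^sup>+x. F (f x) \<partial>lebesgue_on K) = (\<integral>\<^sup>+x. F (f x) * indicator K x \<partial>lebesgue)"
    using K by (subst nn_integral_restrict_space) auto
  also have "\<dots> = (\<integral>\<^sup>+x. F (g x) * indicator K x \<partial>lebesgue)"
    using AE_completion[OF ae] by (intro nn_integral_cong_AE, eventually_elim) (use K in \<open>auto simp: indicator_def\<close>)
  finally show ?thesis by (simp add: nn_integral_completion)
qed

lemma Lp_iff_nn_integral:
  fixes f g :: "'a::euclidean_space \<Rightarrow> 'b::euclidean_space"
  assumes K: "K \<in> sets borel" "K \<subseteq> \<Omega>" and ae: "AE x in lborel. x \<in> \<Omega> \<longrightarrow> f x = g x"
    and f: "f \<in> borel_measurable (lebesgue_on K)"
  shows "f \<in> Lp p K \<longleftrightarrow> (\<integral>\<^sup>+x\<in>K. ennreal (norm (g x) powr p) \<partial>lborel) < \<infinity>"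
proof -
  have "(\<lambda>x. norm (f x) powr p) \<in> borel_measurable (lebesgue_on K)" using f by measurable
  then show ?thesis
    using f unfolding Lp_def nn_integral_lebesgue_on_eq[OF K ae, of "\<lambda>y. ennreal (norm y powr p)", symmetric]
    by (auto simp: integrable_iff_bounded)
qed

lemma completion_ex_borel_measurable_euclidean:
  fixes f :: "'a::euclidean_space \<Rightarrow> 'b::euclidean_space"
  assumes f: "f \<in> borel_measurable lebesgue"
  shows "\<exists>g\<in>borel_measurable borel. AE x in lborel. f x = g x"
proof -
  have "\<exists>g. g \<in> borel_measurable lborel \<and> (AE x in lborel. f x \<bullet> b = g x)" for b
  proof -
    have "(\<lambda>x. f x \<bullet> b) \<in> borel_measurable lebesgue" using f by measurable
    from completion_ex_borel_measurable_real[OF this] show ?thesis unfolding Bex_def .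
  qed
  then have "\<exists>g. \<forall>b. g b \<in> borel_measurable lborel \<and> (AE x in lborel. f x \<bullet> b = g b x)"
    by (intro choice allI)
  then obtain g where g: "\<And>b. g b \<in> borel_measurable lborel"
      "\<And>b. AE x in lborel. f x \<bullet> b = g b x"
    by auto
  have "AE x in lborel. \<forall>b\<in>Basis. f x \<bullet> b = g b x"
    by (intro AE_finite_allI g finite_Basis)
  then have "AE x in lborel. f x = (\<Sum>b\<in>Basis. g b x *\<^sub>R b)"
  proof eventually_elim
    case (elim x)
    have "f x = (\<Sum>b\<in>Basis. (f x \<bullet> b) *\<^sub>R b)" by (rule euclidean_representation[symmetric])
    also have "\<dots> = (\<Sum>b\<in>Basis. g b x *\<^sub>R b)" using elim by (intro sum.cong) auto
    finally show ?case .
  qed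
  moreover have "(\<lambda>x. \<Sum>b\<in>Basis. g b x *\<^sub>R b) \<in> borel_measurable borel"
    using g(1) by (intro borel_measurable_sum borel_measurable_scaleR borel_measurable_const) simp
  ultimately show ?thesis by (rule_tac bexI)
qed

text \<open>
  Exhausting the open set by compact sets, the extension by zero is a pointwise limit of Lebesgue
  measurable functions.
\<close>

lemma ex_borel_version_on_open:
  fixes f :: "'a::euclidean_space \<Rightarrow> 'b::euclidean_space"
  assumes \<Omega>: "open \<Omega>" and f: "\<And>K. compact K \<Longrightarrow> K \<subseteq> \<Omega> \<Longrightarrow> f \<in> borel_measurable (lebesgue_on K)"
  obtains g where "g \<in> borel_measurable borel" "AE x in lborel. x \<in> \<Omega> \<longrightarrow> f x = g x"
proof -
  obtain C where C: "\<And>n. compact (C n)" "\<And>n. C n \<subseteq> \<Omega>" "\<And>n::nat. C n \<subseteq> interior (C (Suc n))" "\<Union>(range C) = \<Omega>"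
    by (rule open_Union_compact_subsets[OF \<Omega>], rule that; assumption)
  have Cm: "C m \<subseteq> C n" if "m \<le> n" for m n
  proof (rule lift_Suc_mono_le[of C, OF _ that])
    show "C k \<subseteq> C (Suc k)" for k using C(3)[of k] interior_subset[of "C (Suc k)"] by (rule order_trans)
  qed
  have "(\<lambda>x. indicator \<Omega> x *\<^sub>R f x) \<in> borel_measurable lebesgue"
  proof (rule borel_measurable_LIMSEQ_metric)
    show "(\<lambda>x. indicator (C n) x *\<^sub>R f x) \<in> borel_measurable lebesgue" for n
      using f[OF C(1,2)[of n]] C(1)[of n] by (subst (asm) borel_measurable_restrict_space_iff) (auto intro: lmeasurable_compact fmeasurableD)
    show "(\<lambda>n. indicator (C n) x *\<^sub>R f x) \<longlonglongrightarrow> indicator \<Omega> x *\<^sub>R f x" for x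
    proof (cases "x \<in> \<Omega>")
      case True
      then obtain m where "x \<in> C m" using C by auto
      then have "x \<in> C n" if "n \<ge> m" for n using Cm[OF that] by auto
      then have "\<forall>\<^sub>F n in sequentially. indicator (C n) x *\<^sub>R f x = indicator \<Omega> x *\<^sub>R f x"
        using True by (intro eventually_sequentiallyI[of m]) auto
      then show ?thesis by (rule tendsto_eventually)
    next
      case False
      then have "x \<notin> C n" for n using C by auto
      then show ?thesis using False by simp
    qed
  qed
  then obtain g where g: "g \<in> borel_measurable borel" "AE x in lborel. indicator \<Omega> x *\<^sub>R f x = g x"
    using completion_ex_borel_measurable_euclidean by blast
  show thesis
  proof (rule that[OF g(1)])
    show "AE x in lborel. x \<in> \<Omega> \<longrightarrow> f x = g x"
      using g(2) by eventually_elim auto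
  qed
qed

lemma Lp_loc_measurable: "f \<in> Lp_loc p \<Omega> \<Longrightarrow> compact K \<Longrightarrow> K \<subseteq> \<Omega> \<Longrightarrow> f \<in> borel_measurable (lebesgue_on K)"
  by (auto simp: Lp_loc_def Lp_def)

text \<open>
  All estimates are carried out for Borel representatives on the whole space; their values outside
  \<open>\<Omega>\<close> are irrelevant and are cut off before integrating.
\<close>

definition borel_rep :: "'a::euclidean_space set \<Rightarrow> ('a \<Rightarrow> 'b::euclidean_space) \<Rightarrow> ('a \<Rightarrow> 'b) \<Rightarrow> bool" where
  "borel_rep \<Omega> f g \<longleftrightarrow> g \<in> borel_measurable borel \<and> (AE x in lborel. x \<in> \<Omega> \<longrightarrow> f x = g x)"

lemma ex_borel_rep:
  assumes "open \<Omega>" "f \<in> Lp_loc p \<Omega>" obtains g where "borel_rep \<Omega> f g"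
  by (rule ex_borel_version_on_open[OF assms(1) Lp_loc_measurable[OF assms(2)]]) (auto simp: borel_rep_def intro: that)

lemma borel_rep_Lp_loc:
  fixes f g :: "'a::euclidean_space \<Rightarrow> 'b::euclidean_space"
  assumes "f \<in> Lp_loc p \<Omega>" "borel_rep \<Omega> f g" "compact K" "K \<subseteq> \<Omega>"
  shows "(\<integral>\<^sup>+x\<in>K. ennreal (norm (g x) powr p) \<partial>lborel) < \<infinity>" "borel_Lp p (\<lambda>x. indicator K x *\<^sub>R g x)"
proof -
  have K: "K \<in> sets borel" using assms by (simp add: compact_imp_closed)
  note [measurable] = assms(2)[unfolded borel_rep_def, THEN conjunct1] K
  show *: "(\<integral>\<^sup>+x\<in>K. ennreal (norm (g x) powr p) \<partial>lborel) < \<infinity>"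
    using Lp_iff_nn_integral[OF K assms(4) assms(2)[unfolded borel_rep_def, THEN conjunct2] Lp_loc_measurable[OF assms(1,3,4)]]
      assms by (auto simp: Lp_loc_def)
  have "integrable lborel (\<lambda>x. norm (indicator K x *\<^sub>R g x) powr p)"
  proof (rule integrableI_bounded)
    have "(\<integral>\<^sup>+x. ennreal (norm (norm (indicator K x *\<^sub>R g x) powr p)) \<partial>lborel) = (\<integral>\<^sup>+x\<in>K. ennreal (norm (g x) powr p) \<partial>lborel)"
      by (intro nn_integral_cong) (auto simp: indicator_def)
    then show "(\<integral>\<^sup>+x. ennreal (norm (norm (indicator K x *\<^sub>R g x) powr p)) \<partial>lborel) < \<infinity>" using * by simp
  qed measurable
  then show "borel_Lp p (\<lambda>x. indicator K x *\<^sub>R g x)" by (simp add: borel_Lp_def)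
qed

lemma borel_Lp_1_iff: "borel_Lp 1 v \<longleftrightarrow> integrable lborel v"
  by (auto simp: borel_Lp_def intro: integrable_norm_cancel)

lemma weak_deriv_of_weak_gradient:
  fixes u :: "'a::euclidean_space \<Rightarrow> real"
  assumes W: "has_weak_gradient \<Omega> u G" and \<Omega>: "open \<Omega>" and r: "borel_rep \<Omega> u u'" "borel_rep \<Omega> G G'"
    and Q: "compact Q" "Q \<subseteq> \<Omega>"
  shows "weak_deriv (interior Q) (\<lambda>x. indicator Q x *\<^sub>R u' x) (\<lambda>x. indicator Q x *\<^sub>R G' x)"
proof -
  let ?u = "\<lambda>x. indicator Q x *\<^sub>R u' x" and ?G = "\<lambda>x. indicator Q x *\<^sub>R G' x"
  have [measurable]: "Q \<in> sets borel" using Q by (simp add: compact_imp_closed)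
  have \<Omega>b: "\<Omega> \<in> sets borel" using \<Omega> by auto
  note [measurable] = r[unfolded borel_rep_def, THEN conjunct1]
  note ae = r[unfolded borel_rep_def, THEN conjunct2]
  have L: "u \<in> Lp_loc 1 \<Omega>" "G \<in> Lp_loc 1 \<Omega>" using W by (simp_all add: has_weak_gradient_def)
  have int: "integrable lborel ?u" "integrable lborel ?G"
    by (rule borel_rep_Lp_loc(2)[OF L(1) r(1) Q, unfolded borel_Lp_1_iff]
        borel_rep_Lp_loc(2)[OF L(2) r(2) Q, unfolded borel_Lp_1_iff])+
  have "(LINT x|lborel. ?u x *\<^sub>R grad \<psi> x) = - (LINT x|lborel. \<psi> x *\<^sub>R ?G x)" if \<psi>: "\<psi> \<in> test_fun (interior Q)" for \<psi>
  proof (rule euclidean_eqI)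
    fix b :: 'a assume b: "b \<in> Basis"
    have \<psi>\<Omega>: "\<psi> \<in> test_fun \<Omega>" using test_fun_mono[OF \<psi>] Q interior_subset by blast
    note [measurable] = test_fun_bounded(2)[OF \<psi>] grad_bounded(2)[OF \<psi>]
    obtain S where S: "compact S" "S \<subseteq> interior Q" "\<And>x. x \<notin> S \<Longrightarrow> \<psi> x = 0"
      "\<And>x. x \<notin> S \<Longrightarrow> frechet_derivative \<psi> (at x) = (\<lambda>_. 0)"
      by (rule test_fun_support[OF \<psi>], rule that; assumption)
    have SQ: "S \<subseteq> Q" using S interior_subset by blast
    have "(LINT x|lborel. ?u x *\<^sub>R grad \<psi> x) \<bullet> b = (LINT x|lborel. ?u x * (grad \<psi> x \<bullet> b))"
      using integral_inner_left[OF integrable_mult_bounded_vec[OF int(1) grad_bounded(2,3)[OF \<psi>]], of b] by simp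
    also have "\<dots> = (LINT x|lebesgue_on \<Omega>. u x * frechet_derivative \<psi> (at x) b)"
    proof (rule integral_lebesgue_on_eq(1)[OF \<Omega>b, symmetric])
      show "AE x in lborel. indicator \<Omega> x *\<^sub>R (u x * frechet_derivative \<psi> (at x) b) = ?u x * (grad \<psi> x \<bullet> b)"
        using ae(1)
      proof eventually_elim
        case (elim x)
        have "x \<in> Q" "x \<in> \<Omega>" if "x \<in> S" using that SQ Q by blast+
        then show ?case using S(4)[of x] elim by (cases "x \<in> S") (auto simp: grad_inner[OF \<psi>])
      qed
    qed measurable
    also have "\<dots> = - (LINT x|lebesgue_on \<Omega>. (G x \<bullet> b) * \<psi> x)"
      using W \<psi>\<Omega> b unfolding has_weak_gradient_def by blast
    also have "(LINT x|lebesgue_on \<Omega>. (G x \<bullet> b) * \<psi> x) = (LINT x|lborel. \<psi> x * (?G x \<bullet> b))"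
    proof (rule integral_lebesgue_on_eq(1)[OF \<Omega>b])
      show "AE x in lborel. indicator \<Omega> x *\<^sub>R ((G x \<bullet> b) * \<psi> x) = \<psi> x * (?G x \<bullet> b)"
        using ae(2)
      proof eventually_elim
        case (elim x)
        have "x \<in> Q" "x \<in> \<Omega>" if "x \<in> S" using that SQ Q by blast+
        then show ?case using S(3)[of x] elim by (cases "x \<in> S") auto
      qed
    qed measurable
    also have "\<dots> = (LINT x|lborel. \<psi> x *\<^sub>R ?G x) \<bullet> b"
      using integral_inner_left[OF integrable_bounded_mult[OF int(2) test_fun_bounded(2,3)[OF \<psi>]], of b] by (simp add: mult.assoc)
    finally show "(LINT x|lborel. ?u x *\<^sub>R grad \<psi> x) \<bullet> b = (- (LINT x|lborel. \<psi> x *\<^sub>R ?G x)) \<bullet> b"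
      by (simp add: inner_minus_left)
  qed
  then show ?thesis using int by (simp add: weak_deriv_def)
qed

text \<open>
  On the interior of each set of a compact exhaustion the difference of the two gradients is a weak
  derivative of zero, and the fundamental lemma applies to each of its components. This is what makes
  the chosen representative \<open>weak_gradient\<close> usable: every property of one weak gradient
  transfers to it.
\<close>

lemma weak_gradient_unique:
  fixes u :: "'a::euclidean_space \<Rightarrow> real"
  assumes W: "has_weak_gradient \<Omega> u G1" "has_weak_gradient \<Omega> u G2" and \<Omega>: "open \<Omega>"
  shows "AE x in lborel. x \<in> \<Omega> \<longrightarrow> G1 x = G2 x"
proof -
  have L: "u \<in> Lp_loc 1 \<Omega>" "G1 \<in> Lp_loc 1 \<Omega>" "G2 \<in> Lp_loc 1 \<Omega>"
    using W by (auto simp: has_weak_gradient_def)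
  obtain u' where u': "borel_rep \<Omega> u u'" by (rule ex_borel_rep[OF \<Omega> L(1)])
  obtain G1' where G1': "borel_rep \<Omega> G1 G1'" by (rule ex_borel_rep[OF \<Omega> L(2)])
  obtain G2' where G2': "borel_rep \<Omega> G2 G2'" by (rule ex_borel_rep[OF \<Omega> L(3)])
  note r = u' G1' G2'
  obtain C where C: "\<And>n. compact (C n)" "\<And>n. C n \<subseteq> \<Omega>" "\<And>n::nat. C n \<subseteq> interior (C (Suc n))" "\<Union>(range C) = \<Omega>"
    by (rule open_Union_compact_subsets[OF \<Omega>], rule that; assumption)
  have "AE x in lborel. x \<in> interior (C n) \<longrightarrow> G1' x = G2' x" for n
  proof -
    define D where "D x = indicator (C n) x *\<^sub>R G1' x - indicator (C n) x *\<^sub>R G2' x" for x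
    have W0: "weak_deriv (interior (C n)) (\<lambda>x. indicator (C n) x *\<^sub>R u' x - indicator (C n) x *\<^sub>R u' x) D"
      unfolding D_def[abs_def]
      by (rule weak_deriv_diff[OF weak_deriv_of_weak_gradient[OF W(1) \<Omega> r(1,2) C(1,2)]
            weak_deriv_of_weak_gradient[OF W(2) \<Omega> r(1,3) C(1,2)]])
    note WD = weak_derivD[OF W0]
    have "AE x in lborel. x \<in> interior (C n) \<longrightarrow> D x \<bullet> b = 0" for b
    proof (rule AE_eq_0_if_orthogonal_test_fun)
      show "integrable lborel (\<lambda>x. D x \<bullet> b)" using WD(2) by (rule integrable_inner_left)
      fix \<phi> assume \<phi>: "\<phi> \<in> test_fun (interior (C n))"
      have "(LINT x|lborel. \<phi> x *\<^sub>R D x) = 0" using WD(5)[OF \<phi>] by simp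
      moreover have "(LINT x|lborel. (\<phi> x *\<^sub>R D x) \<bullet> b) = (LINT x|lborel. \<phi> x *\<^sub>R D x) \<bullet> b"
        by (rule integral_inner_left[OF integrable_bounded_mult[OF WD(2) test_fun_bounded(2,3)[OF \<phi>]]])
      ultimately show "(LINT x|lborel. (D x \<bullet> b) * \<phi> x) = 0" by (simp add: mult.commute)
    qed simp
    then have "AE x in lborel. \<forall>b\<in>Basis. x \<in> interior (C n) \<longrightarrow> D x \<bullet> b = 0"
      by (intro AE_finite_allI finite_Basis)
    then show ?thesis
    proof eventually_elim
      case (elim x)
      show ?case
      proof
        assume x: "x \<in> interior (C n)"
        have "x \<in> C n" by (rule subsetD[OF interior_subset x])
        moreover have "D x = 0"
        proof (rule euclidean_eqI)
          show "D x \<bullet> b = 0 \<bullet> b" if "b \<in> Basis" for b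
            using elim[rule_format, OF that x] by simp
        qed
        ultimately show "G1' x = G2' x" by (simp add: D_def)
      qed
    qed
  qed
  then have "AE x in lborel. \<forall>n. x \<in> interior (C n) \<longrightarrow> G1' x = G2' x"
    unfolding AE_all_countable by blast
  moreover note r(2,3)[unfolded borel_rep_def, THEN conjunct2]
  ultimately show ?thesis
  proof eventually_elim
    case (elim x)
    show ?case
    proof
      assume x: "x \<in> \<Omega>"
      then obtain n where "x \<in> C n" unfolding C(4)[symmetric] by (rule UN_E)
      then have "x \<in> interior (C (Suc n))" using C(3)[of n] by (rule rev_subsetD)
      then have "G1' x = G2' x" using elim(1) by blast
      then show "G1 x = G2 x" using elim x by simp
    qed
  qed
qed

lemma has_weak_gradient_weak_gradient: "has_weak_gradient \<Omega> u G \<Longrightarrow> has_weak_gradient \<Omega> u (weak_gradient \<Omega> u)"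
  unfolding weak_gradient_def by (rule someI[where P = "has_weak_gradient \<Omega> u"])

lemma borel_Lp_imp_Lp:
  fixes v :: "'a::euclidean_space \<Rightarrow> 'b::euclidean_space"
  assumes "borel_Lp p v" "S \<in> sets borel" shows "v \<in> Lp p S"
proof -
  note [measurable] = borel_LpD(1)[OF assms(1)]
  have m: "v \<in> borel_measurable (lebesgue_on S)"
    by (rule measurable_restrict_space1, rule measurable_completion) simp
  have "(\<integral>\<^sup>+x\<in>S. ennreal (norm (v x) powr p) \<partial>lborel) \<le> (\<integral>\<^sup>+x. ennreal (norm (v x) powr p) \<partial>lborel)"
    by (intro nn_integral_mono) (auto simp: indicator_def)
  also have "\<dots> < \<infinity>" using borel_LpD(2)[OF assms(1)] by (simp add: integrable_iff_bounded)
  finally show ?thesis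
    by (subst Lp_iff_nn_integral[OF assms(2) subset_refl _ m]) auto
qed

lemma has_weak_gradient_of_weak_deriv:
  fixes v :: "'a::euclidean_space \<Rightarrow> real"
  assumes W: "weak_deriv UNIV v H" and \<Omega>: "open \<Omega>" and K: "K \<subseteq> \<Omega>" "\<And>x. x \<notin> K \<Longrightarrow> v x = 0 \<and> H x = 0"
  shows "has_weak_gradient \<Omega> v H"
proof -
  note WD = weak_derivD[OF W]
  note [measurable] = WD(3,4)
  have off: "v x = 0 \<and> H x = 0" if "x \<notin> \<Omega>" for x using K that by blast
  have \<Omega>b: "\<Omega> \<in> sets borel" using \<Omega> by auto
  have "(LINT x|lebesgue_on \<Omega>. v x * frechet_derivative \<phi> (at x) b) = - (LINT x|lebesgue_on \<Omega>. (H x \<bullet> b) * \<phi> x)"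
    if \<phi>: "\<phi> \<in> test_fun \<Omega>" and b: "b \<in> Basis" for \<phi> b
  proof -
    note [measurable] = test_fun_bounded(2)[OF \<phi>] grad_bounded(2)[OF \<phi>]
    have "(LINT x|lebesgue_on \<Omega>. v x * frechet_derivative \<phi> (at x) b) = (LINT x|lborel. v x * (grad \<phi> x \<bullet> b))"
      by (rule integral_lebesgue_on_eq(1)[OF \<Omega>b])
         (use off in \<open>auto simp: grad_inner[OF \<phi>, symmetric] indicator_def intro!: AE_I2\<close>)
    also have "\<dots> = (LINT x|lborel. v x *\<^sub>R grad \<phi> x) \<bullet> b"
      using integral_inner_left[OF integrable_mult_bounded_vec[OF WD(1) grad_bounded(2,3)[OF \<phi>]], of b] by simp
    also have "\<dots> = - ((LINT x|lborel. \<phi> x *\<^sub>R H x) \<bullet> b)"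
      using WD(5)[OF test_fun_mono[OF \<phi>]] by simp
    also have "(LINT x|lborel. \<phi> x *\<^sub>R H x) \<bullet> b = (LINT x|lborel. (H x \<bullet> b) * \<phi> x)"
      using integral_inner_left[OF integrable_bounded_mult[OF WD(2) test_fun_bounded(2,3)[OF \<phi>]], of b] by (simp add: mult.commute)
    also have "\<dots> = (LINT x|lebesgue_on \<Omega>. (H x \<bullet> b) * \<phi> x)"
      by (rule integral_lebesgue_on_eq(1)[OF \<Omega>b, symmetric])
         (use off in \<open>auto simp: indicator_def intro!: AE_I2\<close>)
    finally show ?thesis .
  qed
  moreover have "v \<in> Lp_loc 1 \<Omega>" "H \<in> Lp_loc 1 \<Omega>"
    using WD(1,2) unfolding Lp_loc_def
    by (auto intro!: borel_Lp_imp_Lp simp: borel_Lp_1_iff compact_imp_closed)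
  ultimately show ?thesis by (simp add: has_weak_gradient_def)
qed

text \<open>
  The weak equation for test functions that are given with a weak derivative on the whole space. Their
  chosen weak gradient on \<open>\<Omega>\<close> agrees with that derivative by uniqueness.
\<close>

lemma weak_formulation:
  fixes v :: "'a::euclidean_space \<Rightarrow> real"
  assumes sol: "local_weak_solution q \<Omega> f u" and \<Omega>: "open \<Omega>"
    and r: "borel_rep \<Omega> f f'" "borel_rep \<Omega> (weak_gradient \<Omega> u) G'"
    and W: "weak_deriv UNIV v H" and borel_Lp: "borel_Lp q v" "borel_Lp q H" and K: "compact K" "K \<subseteq> \<Omega>" "\<And>x. x \<notin> K \<Longrightarrow> v x = 0 \<and> H x = 0"
  shows "(LINT x|lborel. flux q (G' x) \<bullet> H x) = (LINT x|lborel. f' x * v x)"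
proof -
  have \<Omega>b: "\<Omega> \<in> sets borel" using \<Omega> by auto
  note [measurable] = borel_LpD(1)[OF borel_Lp(1)] borel_LpD(1)[OF borel_Lp(2)] r[unfolded borel_rep_def, THEN conjunct1]
  have off: "v x = 0 \<and> H x = 0" if "x \<notin> \<Omega>" for x using K that by blast
  have hw: "has_weak_gradient \<Omega> v H" by (rule has_weak_gradient_of_weak_deriv[OF W \<Omega> K(2,3)])
  have "v \<in> W1_compact q \<Omega>"
    unfolding W1_compact_def W1_def using hw borel_Lp_imp_Lp[OF borel_Lp(1) \<Omega>b] borel_Lp_imp_Lp[OF borel_Lp(2) \<Omega>b] K
    by (auto intro!: exI[of _ H] exI[of _ K] AE_I2)
  then have eq: "(LINT x|lebesgue_on \<Omega>. flux q (weak_gradient \<Omega> u x) \<bullet> weak_gradient \<Omega> v x) = (LINT x|lebesgue_on \<Omega>. f x * v x)"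
    using sol unfolding local_weak_solution_def by blast
  have ae: "AE x in lborel. x \<in> \<Omega> \<longrightarrow> weak_gradient \<Omega> v x = H x"
    by (rule weak_gradient_unique[OF has_weak_gradient_weak_gradient[OF hw] hw \<Omega>])
  have "(LINT x|lebesgue_on \<Omega>. flux q (weak_gradient \<Omega> u x) \<bullet> weak_gradient \<Omega> v x) = (LINT x|lborel. flux q (G' x) \<bullet> H x)"
  proof (rule integral_lebesgue_on_eq(1)[OF \<Omega>b])
    show "AE x in lborel. indicator \<Omega> x *\<^sub>R (flux q (weak_gradient \<Omega> u x) \<bullet> weak_gradient \<Omega> v x) = flux q (G' x) \<bullet> H x"
      using ae r(2)[unfolded borel_rep_def, THEN conjunct2]
    proof eventually_elim
      case (elim x)
      then show ?case using off[of x] by (cases "x \<in> \<Omega>") auto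
    qed
  qed measurable
  moreover have "(LINT x|lebesgue_on \<Omega>. f x * v x) = (LINT x|lborel. f' x * v x)"
  proof (rule integral_lebesgue_on_eq(1)[OF \<Omega>b])
    show "AE x in lborel. indicator \<Omega> x *\<^sub>R (f x * v x) = f' x * v x"
      using r(1)[unfolded borel_rep_def, THEN conjunct2]
    proof eventually_elim
      case (elim x)
      then show ?case using off[of x] by (cases "x \<in> \<Omega>") auto
    qed
  qed measurable
  ultimately show ?thesis using eq by simp
qed

section \<open>Fractional differentiability of the flux and of the datum\<close>

lemma AE_translate:
  fixes h :: "'a::euclidean_space"
  assumes "AE x in lborel. P x" shows "AE x in lborel. P (x + h)"
proof -
  have "AE x in distr lborel borel ((+) h). P x" unfolding lborel_distr_plus by (rule assms)
  then have "AE x in lborel. P (h + x)" by (rule AE_distrD[rotated]) simp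
  then show ?thesis by (simp add: add.commute)
qed

lemma weak_gradient_Lp_loc:
  assumes sol: "local_weak_solution q \<Omega> f u" and \<Omega>: "open \<Omega>"
  shows "has_weak_gradient \<Omega> u (weak_gradient \<Omega> u)" "weak_gradient \<Omega> u \<in> Lp_loc q \<Omega>"
proof -
  obtain G where G: "has_weak_gradient \<Omega> u G" "G \<in> Lp_loc q \<Omega>"
    using sol unfolding local_weak_solution_def W1_loc_def by blast
  show hw: "has_weak_gradient \<Omega> u (weak_gradient \<Omega> u)"
    by (rule has_weak_gradient_weak_gradient[OF G(1)])
  then have L1: "weak_gradient \<Omega> u \<in> Lp_loc 1 \<Omega>" by (simp add: has_weak_gradient_def)
  obtain g where g: "borel_rep \<Omega> G g" by (rule ex_borel_rep[OF \<Omega> G(2)])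
  have ae: "AE x in lborel. x \<in> \<Omega> \<longrightarrow> weak_gradient \<Omega> u x = g x"
    using weak_gradient_unique[OF hw G(1) \<Omega>] g[unfolded borel_rep_def, THEN conjunct2]
    by eventually_elim simp
  have "weak_gradient \<Omega> u \<in> Lp q K" if K: "compact K" "K \<subseteq> \<Omega>" for K
    by (subst Lp_iff_nn_integral[OF _ K(2) ae Lp_loc_measurable[OF L1 K]])
       (use borel_rep_Lp_loc(1)[OF G(2) g K] K in \<open>auto simp: compact_imp_closed\<close>)
  then show "weak_gradient \<Omega> u \<in> Lp_loc q \<Omega>" by (simp add: Lp_loc_def)
qed

lemma infdist_shift: "infdist (x + y) K \<le> infdist x K + norm y"
  using infdist_triangle[of "x + y" K x] by (simp add: dist_norm)

text \<open>
  The energy estimate is applied to the restrictions of the representatives to a compact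
  neighbourhood of \<open>K\<close>, on which they are globally integrable.
\<close>

lemma flux_frac_diff:
  fixes u f :: "'a::euclidean_space \<Rightarrow> real"
  assumes q: "1 < q" "q < 2" and p: "p = q / (q - 1)" and \<Omega>: "open \<Omega>"
    and sol: "local_weak_solution q \<Omega> f u"
    and rep: "borel_rep \<Omega> f f'" "borel_rep \<Omega> (weak_gradient \<Omega> u) G'"
    and f: "f \<in> Lp_loc p \<Omega>" "frac_diff p (\<theta> * p) \<Omega> f'"
    and \<gamma>: "\<gamma> \<le> 1 + \<theta>" "\<gamma> \<le> q"
  shows "frac_diff p \<gamma> \<Omega> (\<lambda>x. norm (flux q (G' x)))"
  unfolding frac_diff_def
proof (intro allI impI)
  fix K assume K: "compact K" "K \<subseteq> \<Omega>"
  let ?w = "\<lambda>x. norm (flux q (G' x))"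
  show "\<exists>C\<ge>0. \<exists>d>0. \<forall>h. norm h < d \<longrightarrow>
      (\<integral>\<^sup>+x\<in>K. ennreal (\<bar>?w (x + h) - ?w x\<bar> powr p) \<partial>lborel) \<le> ennreal (C * norm h powr \<gamma>)"
  proof (cases "K = {}")
    case False
    have p2: "2 < p" using q by (simp add: p field_simps)
    obtain e where e: "e > 0" "{x. infdist x K \<le> e} \<subseteq> \<Omega>"
      by (rule compact_in_open_separated[OF False K(1) \<Omega> K(2)])
    \<comment> \<open>three layers: \<open>\<eta>\<close> lives in distance \<open>r\<close> of \<open>K\<close>, the function inserted into the equation in
       distance \<open>2 r\<close>, and all its arguments stay within \<open>3 r\<close>\<close>
    define r where "r = e / 3"
    have r: "r > 0" "3 * r = e" using e by (auto simp: r_def)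
    define N where "N s = {x. infdist x K \<le> s}" for s
    have Nc: "compact (N s)" if "s > 0" for s
      unfolding N_def by (rule compact_infdist_le[OF False K(1) that])
    have N\<Omega>: "N s \<subseteq> \<Omega>" if "s \<le> e" for s using e(2) that by (auto simp: N_def)
    define Q where "Q = N e"
    have Q: "compact Q" "Q \<subseteq> \<Omega>" using Nc[OF e(1)] N\<Omega>[of e] by (auto simp: Q_def)
    have op: "open {x. infdist x K < s}" for s by (intro open_Collect_less continuous_intros)
    define V where "V = {x. infdist x K < r}"
    have V: "open V" using op by (simp add: V_def)
    have "{x. infdist x K < e} \<subseteq> interior Q"
      by (rule interior_maximal[OF _ op]) (auto simp: Q_def N_def)
    then have intQ: "x \<in> interior Q" if "infdist x K < e" for x using that by auto
    have KV: "K \<subseteq> V" using r by (auto simp: V_def)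
    have VQ: "V \<subseteq> interior Q" using intQ r e by (auto simp: V_def)
    obtain \<eta> where \<eta>: "\<eta> \<in> test_fun V" "\<And>x. x \<in> K \<Longrightarrow> \<eta> x = 1" "\<And>x. 0 \<le> \<eta> x" "\<And>x. \<eta> x \<le> 1"
      by (rule ex_cutoff[OF K(1) V KV], rule that; assumption)
    obtain B where B: "\<And>x. norm (grad \<eta> x) \<le> B" using grad_bounded(3)[OF \<eta>(1)] by auto
    define M where "M = max B 1"
    have M: "M > 0" "\<And>x. norm (grad \<eta> x) \<le> M" using B by (auto simp: M_def le_max_iff_disj)
    define c \<kappa> where "c = 2 powr (1 - p)" and "\<kappa> = (c / 2) powr (1 / p)"
    have c: "c > 0" "\<kappa> > 0" by (auto simp: c_def \<kappa>_def)
    note hw = weak_gradient_Lp_loc[OF sol \<Omega>]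
    have uL: "u \<in> Lp_loc q \<Omega>" using sol by (auto simp: local_weak_solution_def W1_loc_def)
    obtain u' where u': "borel_rep \<Omega> u u'" by (rule ex_borel_rep[OF \<Omega> uL])
    define uQ GQ fQ where "uQ x = indicator Q x *\<^sub>R u' x" and "GQ x = indicator Q x *\<^sub>R G' x"
      and "fQ x = indicator Q x *\<^sub>R f' x" for x
    have W: "weak_deriv (interior Q) uQ GQ"
      unfolding uQ_def[abs_def] GQ_def[abs_def] by (rule weak_deriv_of_weak_gradient[OF hw(1) \<Omega> u' rep(2) Q])
    have L: "borel_Lp q uQ" "borel_Lp q GQ" "borel_Lp p fQ"
      unfolding uQ_def[abs_def] GQ_def[abs_def] fQ_def[abs_def]
      by (rule borel_rep_Lp_loc(2)[OF uL u' Q] borel_rep_Lp_loc(2)[OF hw(2) rep(2) Q] borel_rep_Lp_loc(2)[OF f(1) rep(1) Q])+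
    define Nu where "Nu = (LINT x|lborel. norm (GQ x) powr q)"
    have Nu: "0 \<le> Nu" "(\<integral>\<^sup>+x. ennreal (norm (GQ x) powr q) \<partial>lborel) = ennreal Nu"
      unfolding Nu_def by (auto intro!: nn_integral_eq_integral borel_LpD(2)[OF L(2)])
    obtain Nf df where Nf: "Nf \<ge> 0" "df > 0"
      and Nfh: "\<And>h. norm h < df \<Longrightarrow> (\<integral>\<^sup>+x\<in>N r. ennreal (\<bar>f' (x + h) - f' x\<bar> powr p) \<partial>lborel) \<le> ennreal (Nf * norm h powr (\<theta> * p))"
      using f(2)[unfolded frac_diff_def, rule_format, OF Nc[OF r(1)] N\<Omega>[of r]] r e(1) by auto
    \<comment> \<open>\<open>|h| < 1\<close> lets the exponents \<open>1 + \<theta>\<close> and \<open>q\<close> be replaced by the smaller \<open>\<gamma>\<close>\<close>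
    define d where "d = min (min r df) 1"
    have d: "d > 0" using r Nf by (simp add: d_def)
    let ?C = "2 / c * ((Nf + Nu) + (2 * M / \<kappa>) powr q * Nu)"
    have "(\<integral>\<^sup>+x\<in>K. ennreal (\<bar>?w (x + h) - ?w x\<bar> powr p) \<partial>lborel) \<le> ennreal (?C * norm h powr \<gamma>)"
      if hd: "norm h < d" for h
    proof (cases "h = 0")
      case True
      then show ?thesis by simp
    next
      case h0: False
      have hr: "norm h < r" "norm h < df" "norm h < 1" using hd by (auto simp: d_def)
      have shift: "infdist (x + t *\<^sub>R h) K < e" if "x \<in> V" "0 \<le> t" "t \<le> 1" for x t
      proof -
        have "norm (t *\<^sub>R h) \<le> norm h" using that by (simp add: mult_left_le_one_le)
        then show ?thesis using infdist_shift[of x "t *\<^sub>R h" K] that hr r by (simp add: V_def)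
      qed
      have seg: "x + t *\<^sub>R h \<in> interior Q" if "x \<in> V" "0 \<le> t" "t \<le> 1" for x t
        by (rule intQ[OF shift[OF that]])
      have VQ': "x \<in> Q" "x + h \<in> Q" if "x \<in> V" for x
        using subsetD[OF VQ that] seg[OF that, of 1] interior_subset[of Q] by auto
      have main: "(\<integral>\<^sup>+x. ennreal ((\<eta> x)\<^sup>2 * norm (flux q (GQ (x + h)) - flux q (GQ x)) powr p) \<partial>lborel)
        \<le> ennreal (2 / c * ((Nf + Nu) * norm h powr (1 + \<theta>) + (2 * M / \<kappa>) powr q * Nu * norm h powr q))"
      proof (rule energy_estimate[OF q p W L V VQ _ \<eta>(1,3,4) M _ h0 Nu(1) Nf(1) _ _ c_def \<kappa>_def])
        show "x + h \<in> interior Q" if "x \<in> V" for x using seg[OF that, of 1] by simp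
        have "(\<integral>\<^sup>+x\<in>V. ennreal (\<bar>uQ (x + h) - uQ x\<bar> powr q) \<partial>lborel) \<le> ennreal (norm h powr q) * ennreal Nu"
          using weak_deriv_difference_bound[OF W V seg q(1)] unfolding Nu(2) .
        then show "(\<integral>\<^sup>+x\<in>V. ennreal (\<bar>uQ (x + h) - uQ x\<bar> powr q) \<partial>lborel) \<le> ennreal (Nu * norm h powr q)"
          using Nu(1) by (simp add: ennreal_mult mult.commute)
        have "(\<integral>\<^sup>+x\<in>V. ennreal (\<bar>fQ (x + h) - fQ x\<bar> powr p) \<partial>lborel) \<le> (\<integral>\<^sup>+x\<in>N r. ennreal (\<bar>f' (x + h) - f' x\<bar> powr p) \<partial>lborel)"
        proof (rule nn_integral_mono)
          fix x
          have "x \<in> N r" if "x \<in> V" using that by (simp add: V_def N_def)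
          then show "ennreal (\<bar>fQ (x + h) - fQ x\<bar> powr p) * indicator V x \<le> ennreal (\<bar>f' (x + h) - f' x\<bar> powr p) * indicator (N r) x"
            using VQ'[of x] by (cases "x \<in> V") (simp_all add: fQ_def)
        qed
        also have "\<dots> \<le> ennreal (Nf * norm h powr (\<theta> * p))" by (rule Nfh[OF hr(2)])
        finally show "(\<integral>\<^sup>+x\<in>V. ennreal (\<bar>fQ (x + h) - fQ x\<bar> powr p) \<partial>lborel) \<le> ennreal (Nf * norm h powr (\<theta> * p))" .
      next
        fix v :: "'a \<Rightarrow> real" and H :: "'a \<Rightarrow> 'a"
        assume vH: "weak_deriv UNIV v H" "borel_Lp q v" "borel_Lp q H" "\<And>x. x \<notin> V \<Longrightarrow> x - h \<notin> V \<Longrightarrow> v x = 0 \<and> H x = 0"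
        have off: "v x = 0 \<and> H x = 0" if "x \<notin> N (2 * r)" for x
        proof (rule vH(4))
          have "infdist x K > 2 * r" using that by (simp add: N_def)
          moreover have "infdist x K \<le> infdist (x - h) K + norm h" using infdist_shift[of "x - h" h K] by simp
          ultimately show "x \<notin> V" "x - h \<notin> V" using hr r by (auto simp: V_def)
        qed
        have NQ: "x \<in> Q" if "x \<in> N (2 * r)" for x using that r by (simp add: Q_def N_def)
        have "(LINT x|lborel. flux q (G' x) \<bullet> H x) = (LINT x|lborel. f' x * v x)"
          by (rule weak_formulation[OF sol \<Omega> rep vH(1-3) Nc N\<Omega> off]) (use r in auto)
        moreover have "flux q (G' x) \<bullet> H x = flux q (GQ x) \<bullet> H x" "f' x * v x = fQ x * v x" for x
          using off[of x] NQ[of x] by (cases "x \<in> N (2 * r)"; simp add: GQ_def fQ_def)+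
        ultimately show "(LINT x|lborel. flux q (GQ x) \<bullet> H x) = (LINT x|lborel. fQ x * v x)" by simp
      qed
      have "(\<integral>\<^sup>+x\<in>K. ennreal (\<bar>?w (x + h) - ?w x\<bar> powr p) \<partial>lborel)
        \<le> (\<integral>\<^sup>+x. ennreal ((\<eta> x)\<^sup>2 * norm (flux q (GQ (x + h)) - flux q (GQ x)) powr p) \<partial>lborel)"
      proof (rule nn_integral_mono)
        fix x
        show "ennreal (\<bar>?w (x + h) - ?w x\<bar> powr p) * indicator K x
           \<le> ennreal ((\<eta> x)\<^sup>2 * norm (flux q (GQ (x + h)) - flux q (GQ x)) powr p)"
        proof (cases "x \<in> K")
          case True
          then have "x \<in> V" using KV by blast
          note Q' = VQ'[OF this]
          have "\<bar>?w (x + h) - ?w x\<bar> powr p \<le> norm (flux q (G' (x + h)) - flux q (G' x)) powr p"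
            using p2 by (intro powr_mono2 norm_triangle_ineq3) auto
          then show ?thesis using True \<eta>(2)[OF True] Q' by (simp add: GQ_def ennreal_leI)
        qed simp
      qed
      also note main
      also have "ennreal (2 / c * ((Nf + Nu) * norm h powr (1 + \<theta>) + (2 * M / \<kappa>) powr q * Nu * norm h powr q)) \<le> ennreal (?C * norm h powr \<gamma>)"
      proof (rule ennreal_leI)
        have "norm h powr (1 + \<theta>) \<le> norm h powr \<gamma>" "norm h powr q \<le> norm h powr \<gamma>"
          using hr(3) \<gamma> by (auto intro!: powr_mono')
        then have "(Nf + Nu) * norm h powr (1 + \<theta>) + (2 * M / \<kappa>) powr q * Nu * norm h powr q
            \<le> (Nf + Nu) * norm h powr \<gamma> + (2 * M / \<kappa>) powr q * Nu * norm h powr \<gamma>"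
          using Nf Nu by (intro add_mono mult_left_mono) auto
        also have "\<dots> = ((Nf + Nu) + (2 * M / \<kappa>) powr q * Nu) * norm h powr \<gamma>" by (simp add: algebra_simps)
        finally show "2 / c * ((Nf + Nu) * norm h powr (1 + \<theta>) + (2 * M / \<kappa>) powr q * Nu * norm h powr q) \<le> ?C * norm h powr \<gamma>"
          using c unfolding mult.assoc by (intro mult_left_mono) (auto simp: mult.assoc)
      qed
      finally show ?thesis .
    qed
    moreover have "?C \<ge> 0" using c Nf Nu by simp
    ultimately show ?thesis using d by blast
  qed (auto intro!: exI[of _ 0] exI[of _ 1])
qed

lemma W1_loc_frac_diff:
  fixes f :: "'a::euclidean_space \<Rightarrow> real"
  assumes \<Omega>: "open \<Omega>" and p: "1 < p" and f: "f \<in> W1_loc p \<Omega>" and rep: "borel_rep \<Omega> f f'"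
  shows "frac_diff p p \<Omega> f'"
  unfolding frac_diff_def
proof (intro allI impI)
  fix K assume K: "compact K" "K \<subseteq> \<Omega>"
  obtain G where G: "has_weak_gradient \<Omega> f G" "G \<in> Lp_loc p \<Omega>"
    using f unfolding W1_loc_def by blast
  obtain G' where G': "borel_rep \<Omega> G G'" by (rule ex_borel_rep[OF \<Omega> G(2)])
  show "\<exists>C\<ge>0. \<exists>d>0. \<forall>h. norm h < d \<longrightarrow>
      (\<integral>\<^sup>+x\<in>K. ennreal (\<bar>f' (x + h) - f' x\<bar> powr p) \<partial>lborel) \<le> ennreal (C * norm h powr p)"
  proof (cases "K = {}")
    case False
    obtain e where e: "e > 0" "{x. infdist x K \<le> e} \<subseteq> \<Omega>"
      by (rule compact_in_open_separated[OF False K(1) \<Omega> K(2)])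
    define Q where "Q = {x. infdist x K \<le> e}"
    have Q: "compact Q" "Q \<subseteq> \<Omega>"
      using compact_infdist_le[OF False K(1) e(1)] e by (auto simp: Q_def)
    have op: "open {x. infdist x K < s}" for s by (intro open_Collect_less continuous_intros)
    have "{x. infdist x K < e} \<subseteq> interior Q"
      by (rule interior_maximal[OF _ op]) (auto simp: Q_def)
    then have intQ: "x \<in> interior Q" if "infdist x K < e" for x using that by auto
    define V where "V = {x. infdist x K < e / 2}"
    have V: "open V" unfolding V_def by (rule op)
    have KV: "K \<subseteq> V" using e by (auto simp: V_def)
    define fQ GQ where "fQ x = indicator Q x *\<^sub>R f' x" and "GQ x = indicator Q x *\<^sub>R G' x" for x
    have W: "weak_deriv (interior Q) fQ GQ"
      unfolding fQ_def[abs_def] GQ_def[abs_def] by (rule weak_deriv_of_weak_gradient[OF G(1) \<Omega> rep G' Q])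
    have L: "borel_Lp p GQ" unfolding GQ_def[abs_def] by (rule borel_rep_Lp_loc(2)[OF G(2) G' Q])
    define C where "C = (LINT x|lborel. norm (GQ x) powr p)"
    have C: "0 \<le> C" "(\<integral>\<^sup>+x. ennreal (norm (GQ x) powr p) \<partial>lborel) = ennreal C"
      unfolding C_def by (auto intro!: nn_integral_eq_integral borel_LpD(2)[OF L])
    have "(\<integral>\<^sup>+x\<in>K. ennreal (\<bar>f' (x + h) - f' x\<bar> powr p) \<partial>lborel) \<le> ennreal (C * norm h powr p)"
      if h: "norm h < e / 2" for h
    proof -
      have seg: "x + t *\<^sub>R h \<in> interior Q" if "x \<in> V" "0 \<le> t" "t \<le> 1" for x t
      proof (rule intQ)
        have "norm (t *\<^sub>R h) \<le> norm h" using that by (simp add: mult_left_le_one_le)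
        then show "infdist (x + t *\<^sub>R h) K < e" using infdist_shift[of x "t *\<^sub>R h" K] that h by (simp add: V_def)
      qed
      have VQ: "x \<in> Q" "x + h \<in> Q" if "x \<in> V" for x
        using seg[OF that, of 0] seg[OF that, of 1] interior_subset[of Q] by auto
      have "(\<integral>\<^sup>+x\<in>K. ennreal (\<bar>f' (x + h) - f' x\<bar> powr p) \<partial>lborel) \<le> (\<integral>\<^sup>+x\<in>V. ennreal (\<bar>fQ (x + h) - fQ x\<bar> powr p) \<partial>lborel)"
      proof (rule nn_integral_mono)
        fix x
        have "x \<in> V" if "x \<in> K" using that KV by blast
        then show "ennreal (\<bar>f' (x + h) - f' x\<bar> powr p) * indicator K x \<le> ennreal (\<bar>fQ (x + h) - fQ x\<bar> powr p) * indicator V x"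
          using VQ[of x] by (cases "x \<in> K") (simp_all add: fQ_def)
      qed
      also have "\<dots> \<le> ennreal (norm h powr p) * ennreal C"
        using weak_deriv_difference_bound[OF W V seg p] unfolding C(2) .
      also have "\<dots> = ennreal (C * norm h powr p)" using C(1) by (simp add: ennreal_mult mult.commute)
      finally show ?thesis .
    qed
    then show ?thesis using C(1) e(1) by (intro exI[of _ C] conjI exI[of _ "e / 2"]) auto
  qed (auto intro!: exI[of _ 0] exI[of _ 1])
qed

text \<open>
  The seminorm is defined with a Bochner integral, which yields the bound for the nonnegative
  integral only because the increments are known to be in \<open>L\<^sup>m\<close>.
\<close>

lemma besov_inf_difference_bound:
  fixes v g :: "'a::euclidean_space \<Rightarrow> real"
  assumes v: "v \<in> besov_inf \<beta> m" and m: "0 < m"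
    and g: "g \<in> borel_measurable borel" and ae: "AE x in lborel. v x = g x"
  obtains C where "C \<ge> 0"
    "\<And>h. (\<integral>\<^sup>+x. ennreal (\<bar>g (x + h) - g x\<bar> powr m) \<partial>lborel) \<le> ennreal (C * norm h powr (\<beta> * m))"
proof -
  note [measurable] = g
  have "integrable lborel (\<lambda>x. norm (g x) powr m)"
    by (subst integral_lebesgue_on_eq(2)[of UNIV _ "\<lambda>x. norm (v x) powr m", symmetric])
       (use v ae in \<open>auto simp: besov_inf_def Lp_def\<close>)
  then have L: "borel_Lp m g" using g by (simp add: borel_Lp_def)
  have L': "borel_Lp m (\<lambda>x. g (x + h) - g x)" for h by (intro borel_Lp_diff borel_Lp_translate L m)
  obtain B where B: "\<And>h. h \<noteq> 0 \<Longrightarrow>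
      (LINT x|lebesgue. \<bar>v (x + h) - v x\<bar> powr m / norm h powr (\<beta> * m)) powr (1 / m) \<le> B"
    using v unfolding besov_inf_def bdd_above_def by auto
  show thesis
  proof (rule that[of "(max B 0) powr m"])
    fix h :: 'a
    show "(\<integral>\<^sup>+x. ennreal (\<bar>g (x + h) - g x\<bar> powr m) \<partial>lborel) \<le> ennreal ((max B 0) powr m * norm h powr (\<beta> * m))"
    proof (cases "h = 0")
      case False
      let ?I = "LINT x|lborel. \<bar>g (x + h) - g x\<bar> powr m"
      have I0: "?I \<ge> 0" by simp
      have "(LINT x|lebesgue. \<bar>v (x + h) - v x\<bar> powr m / norm h powr (\<beta> * m))
          = (LINT x|lborel. \<bar>g (x + h) - g x\<bar> powr m / norm h powr (\<beta> * m))"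
      proof (subst integral_lebesgue_on_eq(1)[of UNIV, symmetric])
        show "AE x in lborel. indicator UNIV x *\<^sub>R (\<bar>v (x + h) - v x\<bar> powr m / norm h powr (\<beta> * m)) = \<bar>g (x + h) - g x\<bar> powr m / norm h powr (\<beta> * m)"
          using ae AE_translate[OF ae, of h] by eventually_elim simp
      qed (auto simp: lebesgue_on_UNIV_eq)
      then have "(LINT x|lborel. \<bar>g (x + h) - g x\<bar> powr m / norm h powr (\<beta> * m)) powr (1 / m) \<le> B"
        using B[OF False] by (simp only:)
      then have "(?I / norm h powr (\<beta> * m)) powr (1 / m) \<le> max B 0" by simp
      then have "((?I / norm h powr (\<beta> * m)) powr (1 / m)) powr m \<le> (max B 0) powr m"
        using m by (intro powr_mono2) auto
      then have "?I / norm h powr (\<beta> * m) \<le> (max B 0) powr m"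
        using m I0 by (simp add: powr_powr)
      then have "?I \<le> (max B 0) powr m * norm h powr (\<beta> * m)"
        using False by (simp add: field_simps)
      moreover have "(\<integral>\<^sup>+x. ennreal (\<bar>g (x + h) - g x\<bar> powr m) \<partial>lborel) = ennreal ?I"
        using borel_LpD(2)[OF L'[of h]] by (intro nn_integral_eq_integral) auto
      ultimately show ?thesis by (simp add: ennreal_leI)
    qed simp
  qed simp
qed

lemma besov_inf_loc_Lp_loc:
  fixes f :: "'a::euclidean_space \<Rightarrow> real"
  assumes \<Omega>: "open \<Omega>" and f: "f \<in> besov_inf_loc \<beta> p \<Omega>"
  shows "f \<in> Lp_loc p \<Omega>"
proof -
  have "f \<in> Lp p K" if K: "compact K" "K \<subseteq> \<Omega>" for K
  proof -
    obtain \<xi> where \<xi>: "\<xi> \<in> test_fun \<Omega>" "\<And>x. x \<in> K \<Longrightarrow> \<xi> x = 1"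
      by (rule ex_cutoff[OF K(1) \<Omega> K(2)], rule that; assumption)
    let ?v = "\<lambda>x. \<xi> x * f x"
    have "?v \<in> Lp p UNIV" using f \<xi>(1) unfolding besov_inf_loc_def besov_inf_def by blast
    then have v: "?v \<in> borel_measurable lebesgue" "integrable lebesgue (\<lambda>x. norm (?v x) powr p)"
      by (auto simp: Lp_def lebesgue_on_UNIV_eq)
    have Kl: "K \<in> sets lebesgue" using K by (simp add: lmeasurable_compact fmeasurableD)
    have "?v \<in> borel_measurable (lebesgue_on K)" using v(1) by (rule measurable_restrict_space1)
    then have "f \<in> borel_measurable (lebesgue_on K)"
      by (rule measurable_cong[THEN iffD1, rotated]) (use \<xi>(2) in \<open>auto simp: space_restrict_space\<close>)
    moreover have "integrable (lebesgue_on K) (\<lambda>x. norm (?v x) powr p)"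
      using integrable_mult_indicator[OF Kl v(2)] Kl
      by (subst integrable_restrict_space) auto
    then have "integrable (lebesgue_on K) (\<lambda>x. norm (f x) powr p)"
      by (rule Bochner_Integration.integrable_cong[THEN iffD1, rotated -1]) (use \<xi>(2) in \<open>auto simp: space_restrict_space\<close>)
    ultimately show ?thesis by (simp add: Lp_def)
  qed
  then show ?thesis by (simp add: Lp_loc_def)
qed

text \<open>
  On a neighbourhood of \<open>K\<close> the function agrees with its product with a cut-off, which lies in the
  global Besov space, and small increments at points of \<open>K\<close> do not leave that neighbourhood.
\<close>

lemma besov_inf_loc_frac_diff:
  fixes f :: "'a::euclidean_space \<Rightarrow> real"
  assumes \<Omega>: "open \<Omega>" and p: "0 < p" and f: "f \<in> besov_inf_loc \<beta> p \<Omega>" and rep: "borel_rep \<Omega> f f'"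
  shows "frac_diff p (\<beta> * p) \<Omega> f'"
  unfolding frac_diff_def
proof (intro allI impI)
  fix K assume K: "compact K" "K \<subseteq> \<Omega>"
  show "\<exists>C\<ge>0. \<exists>d>0. \<forall>h. norm h < d \<longrightarrow>
      (\<integral>\<^sup>+x\<in>K. ennreal (\<bar>f' (x + h) - f' x\<bar> powr p) \<partial>lborel) \<le> ennreal (C * norm h powr (\<beta> * p))"
  proof (cases "K = {}")
    case False
    obtain e where e: "e > 0" "{x. infdist x K \<le> e} \<subseteq> \<Omega>"
      by (rule compact_in_open_separated[OF False K(1) \<Omega> K(2)])
    define Q where "Q = {x. infdist x K \<le> e}"
    have Q: "compact Q" "Q \<subseteq> \<Omega>"
      using compact_infdist_le[OF False K(1) e(1)] e by (auto simp: Q_def)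
    obtain \<xi> where \<xi>: "\<xi> \<in> test_fun \<Omega>" "\<And>x. x \<in> Q \<Longrightarrow> \<xi> x = 1"
      by (rule ex_cutoff[OF Q(1) \<Omega> Q(2)], rule that; assumption)
    let ?v = "\<lambda>x. \<xi> x * f x"
    have v: "?v \<in> besov_inf \<beta> p" using f \<xi>(1) unfolding besov_inf_loc_def by blast
    then have "?v \<in> borel_measurable lebesgue" by (auto simp: besov_inf_def Lp_def lebesgue_on_UNIV_eq)
    then obtain g where g: "g \<in> borel_measurable borel" "AE x in lborel. ?v x = g x"
      using completion_ex_borel_measurable_euclidean by blast
    obtain C where C: "C \<ge> 0"
      "\<And>h. (\<integral>\<^sup>+x. ennreal (\<bar>g (x + h) - g x\<bar> powr p) \<partial>lborel) \<le> ennreal (C * norm h powr (\<beta> * p))"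
      by (rule besov_inf_difference_bound[OF v p g], rule that; assumption)
    have fg: "AE x in lborel. x \<in> Q \<longrightarrow> f' x = g x"
      using g(2) rep[unfolded borel_rep_def, THEN conjunct2]
    proof eventually_elim
      case (elim x)
      show ?case
      proof
        assume x: "x \<in> Q"
        then have "x \<in> \<Omega>" using Q by blast
        then show "f' x = g x" using elim \<xi>(2)[OF x] by simp
      qed
    qed
    have "(\<integral>\<^sup>+x\<in>K. ennreal (\<bar>f' (x + h) - f' x\<bar> powr p) \<partial>lborel) \<le> ennreal (C * norm h powr (\<beta> * p))"
      if h: "norm h < e" for h
    proof -
      have KQ: "x \<in> Q" "x + h \<in> Q" if "x \<in> K" for x
        using that h e(1) infdist_shift[of x h K] by (simp_all add: Q_def)
      have "(\<integral>\<^sup>+x\<in>K. ennreal (\<bar>f' (x + h) - f' x\<bar> powr p) \<partial>lborel) \<le> (\<integral>\<^sup>+x. ennreal (\<bar>g (x + h) - g x\<bar> powr p) \<partial>lborel)"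
      proof (rule nn_integral_mono_AE)
        show "AE x in lborel. ennreal (\<bar>f' (x + h) - f' x\<bar> powr p) * indicator K x \<le> ennreal (\<bar>g (x + h) - g x\<bar> powr p)"
          using fg AE_translate[OF fg, of h]
        proof eventually_elim
          case (elim x)
          then show ?case using KQ[of x] by (cases "x \<in> K") simp_all
        qed
      qed
      also have "\<dots> \<le> ennreal (C * norm h powr (\<beta> * p))" by (rule C(2))
      finally show ?thesis .
    qed
    then show ?thesis using C(1) e(1) by (intro exI[of _ C] conjI exI[of _ e]) auto
  qed (auto intro!: exI[of _ 0] exI[of _ 1])
qed

section \<open>Higher integrability of the gradient\<close>

text \<open>
  The flux has modulus \<open>max (|G| - 1) 0 powr (q - 1)\<close> and \<open>(q - 1) p = q\<close>, so integrability of the flux with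
  exponent \<open>t < p n / (n - \<gamma>)\<close> is integrability of the gradient with exponent
  \<open>(q - 1) t < q n / (n - \<gamma>)\<close>.
\<close>

lemma gradient_higher_integrability:
  fixes u f :: "'a::euclidean_space \<Rightarrow> real" and q p \<theta> \<gamma> s :: real
  assumes q: "1 < q" "q < 2" and p: "p = q / (q - 1)" and \<Omega>: "open \<Omega>"
    and sol: "local_weak_solution q \<Omega> f u"
    and f: "f \<in> Lp_loc p \<Omega>" "borel_rep \<Omega> f f'" "frac_diff p (\<theta> * p) \<Omega> f'"
    and \<gamma>: "0 < \<gamma>" "\<gamma> \<le> 1 + \<theta>" "\<gamma> \<le> q" "\<gamma> < DIM('a)"
    and s: "1 \<le> s" "s < DIM('a) * q / (DIM('a) - \<gamma>)"
  shows "weak_gradient \<Omega> u \<in> Lp_loc s \<Omega>"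
proof -
  have p2: "2 < p" using q by (simp add: p field_simps)
  note hw = weak_gradient_Lp_loc[OF sol \<Omega>]
  obtain G' where G': "borel_rep \<Omega> (weak_gradient \<Omega> u) G'" by (rule ex_borel_rep[OF \<Omega> hw(2)])
  note [measurable] = G'[unfolded borel_rep_def, THEN conjunct1]
  define w where "w x = norm (flux q (G' x))" for x
  have [measurable]: "w \<in> borel_measurable borel" unfolding w_def[abs_def] by measurable
  have wm: "w x = max (norm (G' x) - 1) 0 powr (q - 1)" for x by (simp add: w_def norm_flux)
  define t where "t = s / (q - 1)"
  have "t < (DIM('a) * q / (DIM('a) - \<gamma>)) / (q - 1)"
    unfolding t_def using s(2) q(1) by (intro divide_strict_right_mono) auto
  also have "\<dots> = p * DIM('a) / (DIM('a) - \<gamma>)"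
    by (simp add: p mult.commute)
  finally have t: "0 < t" "t < p * DIM('a) / (DIM('a) - \<gamma>)"
    using s q by (simp_all add: t_def)
  have fd: "frac_diff p \<gamma> \<Omega> w"
    unfolding w_def[abs_def] by (rule flux_frac_diff[OF q p \<Omega> sol f(2) G' f(1,3) \<gamma>(2,3)])
  have "weak_gradient \<Omega> u \<in> Lp s K" if K: "compact K" "K \<subseteq> \<Omega>" for K
  proof -
    have Kb[measurable]: "K \<in> sets borel" using K by (simp add: compact_imp_closed)
    have wt: "(\<integral>\<^sup>+x\<in>K. ennreal (w x powr t) \<partial>lborel) < \<infinity>"
    proof (rule fractional_difference_embedding[OF \<Omega> _ _ _ \<gamma>(1,4) _ fd t K])
      fix K assume K: "compact K" "K \<subseteq> \<Omega>"
      have "w x powr p \<le> norm (G' x) powr q" for x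
      proof -
        have "(q - 1) * p = q" using q by (simp add: p)
        then have "w x powr p = max (norm (G' x) - 1) 0 powr q" by (simp add: wm powr_powr)
        also have "\<dots> \<le> norm (G' x) powr q" using q by (intro powr_mono2) auto
        finally show ?thesis .
      qed
      then have "(\<integral>\<^sup>+x\<in>K. ennreal (w x powr p) \<partial>lborel) \<le> (\<integral>\<^sup>+x\<in>K. ennreal (norm (G' x) powr q) \<partial>lborel)"
        by (intro nn_integral_mono mult_right_mono ennreal_leI) auto
      also have "\<dots> < \<infinity>" by (rule borel_rep_Lp_loc(1)[OF hw(2) G' K])
      finally show "(\<integral>\<^sup>+x\<in>K. ennreal (w x powr p) \<partial>lborel) < \<infinity>" .
    qed (use p2 in \<open>auto simp: w_def\<close>)
    have pt: "norm (G' x) powr s \<le> 2 powr s * (1 + w x powr t)" for x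
    proof -
      define m where "m = max (norm (G' x) - 1) 0"
      have "norm (G' x) powr s \<le> (1 + m) powr s" using s by (intro powr_mono2) (auto simp: m_def)
      also have "\<dots> \<le> 2 powr s * (1 powr s + m powr s)" using s by (intro powr_sum_le) (auto simp: m_def)
      also have "m powr s = w x powr t" using q by (simp add: wm m_def[symmetric] powr_powr t_def)
      finally show ?thesis by simp
    qed
    have "(\<integral>\<^sup>+x\<in>K. ennreal (norm (G' x) powr s) \<partial>lborel)
       \<le> (\<integral>\<^sup>+x. ennreal (2 powr s) * (indicator K x + ennreal (w x powr t) * indicator K x) \<partial>lborel)"
    proof (rule nn_integral_mono)
      fix x
      show "ennreal (norm (G' x) powr s) * indicator K x \<le> ennreal (2 powr s) * (indicator K x + ennreal (w x powr t) * indicator K x)"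
      proof (cases "x \<in> K")
        case True
        have "ennreal (norm (G' x) powr s) \<le> ennreal (2 powr s * (1 + w x powr t))" by (rule ennreal_leI[OF pt])
        also have "\<dots> = ennreal (2 powr s) * (1 + ennreal (w x powr t))" by (simp add: ennreal_mult ennreal_plus)
        finally show ?thesis using True by simp
      qed simp
    qed
    also have "\<dots> = ennreal (2 powr s) * (emeasure lborel K + (\<integral>\<^sup>+x\<in>K. ennreal (w x powr t) \<partial>lborel))"
      by (simp add: nn_integral_cmult nn_integral_add)
    also have "\<dots> < \<infinity>"
      using wt emeasure_compact_finite[OF K(1)] by (simp add: ennreal_mult_less_top)
    finally have fin: "(\<integral>\<^sup>+x\<in>K. ennreal (norm (G' x) powr s) \<partial>lborel) < \<infinity>" .
    show ?thesis
      using Lp_iff_nn_integral[OF Kb K(2) G'[unfolded borel_rep_def, THEN conjunct2] Lp_loc_measurable[OF hw(2) K], of s] fin by blast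
  qed
  then show ?thesis by (simp add: Lp_loc_def)
qed

theorem corollary1p5:
  fixes \<Omega> :: "(real ^ 'n) set" and u f :: "real ^ 'n \<Rightarrow> real" and q p \<alpha> n :: real
  assumes "n = real CARD('n)" and "n \<ge> 2"
    and "open \<Omega>" and "connected \<Omega>" and "\<Omega> \<noteq> {}" and "bounded \<Omega>"
    and "1 < q" and "q < 2" and "p = q / (q - 1)"
    and "0 < \<alpha>" and "\<alpha> < 1"
    and "local_weak_solution q \<Omega> f u"
  shows "(f \<in> W1_loc p \<Omega> \<longrightarrow>
            (\<forall>r. 1 \<le> r \<and> r < n * q * (3 - q) / (n * (3 - q) - 2) \<longrightarrow>
               weak_gradient \<Omega> u \<in> Lp_loc r \<Omega>)) \<and>
         (f \<in> besov_inf_loc \<alpha> p \<Omega> \<longrightarrow>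
            (\<alpha> < (q - 1) / (3 - q) \<longrightarrow>
               (\<forall>s. 1 \<le> s \<and> s < n * q / (n - \<alpha> - 1) \<longrightarrow>
                  weak_gradient \<Omega> u \<in> Lp_loc s \<Omega>)) \<and>
            ((q - 1) / (3 - q) \<le> \<alpha> \<longrightarrow>
               (\<forall>s. 1 \<le> s \<and> s < n * q * (3 - q) / (n * (3 - q) - 2) \<longrightarrow>
                  weak_gradient \<Omega> u \<in> Lp_loc s \<Omega>)))"
proof -
  note \<Omega> = assms(3) and q = assms(7,8) and p = assms(9) and sol = assms(12)
  have n: "n = real DIM(real ^ 'n)" using assms(1) by simp
  have p1: "1 < p" "0 < p" using q by (auto simp: p field_simps)
  \<comment> \<open>the exponent \<open>\<gamma>\<close> belonging to the critical integrability; it lies below \<open>q\<close>, so the energy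
       estimate reaches it whenever \<open>1 + \<theta> \<ge> g\<close>\<close>
  define g where "g = 2 / (3 - q)"
  have g: "0 < g" "g < 2" using q by (auto simp: g_def field_simps)
  have "q * (3 - q) - 2 = (q - 1) * (2 - q)" by (simp add: algebra_simps)
  also have "\<dots> > 0" using q by simp
  finally have gq: "g \<le> q" using q by (simp add: g_def divide_le_eq)
  have thr: "1 + (q - 1) / (3 - q) = g" using q by (simp add: g_def field_simps)
  have bound: "n * q * (3 - q) / (n * (3 - q) - 2) = n * q / (n - g)"
  proof -
    have "n - g = (n * (3 - q) - 2) / (3 - q)" using q by (simp add: g_def field_simps)
    then show ?thesis by simp
  qed
  have gain: "weak_gradient \<Omega> u \<in> Lp_loc s \<Omega>"
    if f: "f \<in> Lp_loc p \<Omega>" "\<And>f'. borel_rep \<Omega> f f' \<Longrightarrow> frac_diff p (\<theta> * p) \<Omega> f'"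
      and e: "0 < e" "e \<le> 1 + \<theta>" "e \<le> g" and s: "1 \<le> s" "s < n * q / (n - e)" for \<theta> e s
  proof -
    obtain f' where f': "borel_rep \<Omega> f f'" by (rule ex_borel_rep[OF \<Omega> f(1)])
    show ?thesis
      by (rule gradient_higher_integrability[OF q p \<Omega> sol f(1) f' f(2)[OF f'] e(1,2) _ _ s(1)])
         (use e gq g assms(2) s(2) n in auto)
  qed
  have W1: "f \<in> Lp_loc p \<Omega>" "\<And>f'. borel_rep \<Omega> f f' \<Longrightarrow> frac_diff p (1 * p) \<Omega> f'" if "f \<in> W1_loc p \<Omega>"
    using that W1_loc_frac_diff[OF \<Omega> p1(1) that] by (auto simp: W1_loc_def)
  note besov = besov_inf_loc_Lp_loc[OF \<Omega>] besov_inf_loc_frac_diff[OF \<Omega> p1(2)]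
  show ?thesis
  proof (intro conjI impI allI; elim conjE)
    fix r assume "f \<in> W1_loc p \<Omega>" "1 \<le> r" "r < n * q * (3 - q) / (n * (3 - q) - 2)"
    then show "weak_gradient \<Omega> u \<in> Lp_loc r \<Omega>"
      using g by (intro gain[of 1 g] W1) (auto simp: bound)
  next
    fix s assume "f \<in> besov_inf_loc \<alpha> p \<Omega>" "\<alpha> < (q - 1) / (3 - q)" "1 \<le> s" "s < n * q / (n - \<alpha> - 1)"
    then show "weak_gradient \<Omega> u \<in> Lp_loc s \<Omega>"
      using assms(10) thr by (intro gain[of \<alpha> "1 + \<alpha>"] besov) (auto simp: algebra_simps)
  next
    fix s assume "f \<in> besov_inf_loc \<alpha> p \<Omega>" "(q - 1) / (3 - q) \<le> \<alpha>" "1 \<le> s"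
      "s < n * q * (3 - q) / (n * (3 - q) - 2)"
    then show "weak_gradient \<Omega> u \<in> Lp_loc s \<Omega>"
      using g thr by (intro gain[of \<alpha> g] besov) (auto simp: bound)
  qed
qed

end
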